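(* Let $\kappa\in\{-1,1\}$ and let $\mathcal{H}\in C^1([-1,1])$ be an even function, $\mathcal{H}(y)=\mathcal{H}(-y)$, satisfying $4\mathcal{H}(y)>(1-\kappa)\sqrt{1-y^2}$ for all $y\in[-1,1]$. Then there exists a uniform height estimate for compact vertical $\mathcal{H}$-graphs in $\mathbb{M}^2(\kappa)\times\mathbb{R}$. That is, for $v\in\{e_3,-e_3\}$ there exists a constant $C=C(\mathcal{H},v,\kappa)>0$ such that for every compact vertical graph $\Sigma$ in $\mathbb{M}^2(\kappa)\times\mathbb{R}$ of prescribed mean curvature $\mathcal{H}$, oriented towards $v$ (i.e. $\langle\eta,v\rangle>0$ on $\Sigma$, where $\eta$ is the unit normal of $\Sigma$) and with $\partial\Sigma$ contained in a horizontal plane $\Pi$, the distance of any $p\in\Sigma$ to $\Pi$ is at most $C$.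
   Context: $\mathbb{M}^2(\kappa)$ is the complete simply connected surface of constant curvature $\kappa$: the hyperbolic plane $\mathbb{H}^2$ if $\kappa=-1$, the unit sphere $\mathbb{S}^2$ if $\kappa=1$. $\mathbb{M}^2(\kappa)\times\mathbb{R}$ carries the product metric, and $e_3$ is the unit vertical Killing field (the gradient of the projection onto $\mathbb{R}$). Horizontal planes are the slices $\mathbb{M}^2(\kappa)\times\{t_0\}$. An immersed oriented surface $\Sigma$ with unit normal $\eta$ and angle function $\nu=\langle\eta,e_3\rangle$ is an $\mathcal{H}$-surface (has prescribed mean curvature $\mathcal{H}$) if its mean curvature $H_\Sigma$ with respect to $\eta$ satisfies $H_\Sigma(p)=\mathcal{H}(\nu_p)$ for all $p\in\Sigma$. Here the mean curvature is half the sum of the principal curvatures, with the sign convention that a vertical graph of $u$ with upward unit normal satisfies $\mathrm{div}\big(\nabla u/\sqrt{1+|\nabla u|^2}\big)=2H_\Sigma$. A vertical graph is the graph $\{(x,u(x)):x\in\Omega\}$ of a function $u$ on a domain $\Omega\subset\mathbb{M}^2(\kappa)$. A vertical $\mathcal{H}$-graph is a vertical graph that is an $\mathcal{H}$-surface. *)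

theory Defs
  imports "HOL-Analysis.Analysis"
begin

section \<open>The product spaces $M^2(\kappa) \times R$\<close>

text \<open>For \<open>\<kappa> = 1\<close> the form below is the Euclidean inner product, for \<open>\<kappa> = -1\<close> the Lorentzian
  one.  Accordingly \<open>space_form 1\<close> is the round unit sphere and \<open>space_form (-1)\<close> the
  hyperboloid model of the hyperbolic plane; in both cases the Riemannian metric is the
  restriction of the form to tangent vectors.\<close>

definition form :: "real \<Rightarrow> real^3 \<Rightarrow> real^3 \<Rightarrow> real" where
  "form \<kappa> a b = a$1 * b$1 + a$2 * b$2 + \<kappa> * (a$3 * b$3)"

definition space_form :: "real \<Rightarrow> (real^3) set" where
  "space_form \<kappa> = {x. form \<kappa> x x = \<kappa> \<and> (\<kappa> = -1 \<longrightarrow> x$3 > 0)}"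

type_synonym ambient = "(real^3) \<times> real"

definition metric_form :: "real \<Rightarrow> ambient \<Rightarrow> ambient \<Rightarrow> real" where
  "metric_form \<kappa> a b = form \<kappa> (fst a) (fst b) + snd a * snd b"

definition prod_space :: "real \<Rightarrow> ambient set" where
  "prod_space \<kappa> = space_form \<kappa> \<times> UNIV"

definition prod_tangent :: "real \<Rightarrow> ambient \<Rightarrow> ambient set" where
  "prod_tangent \<kappa> p = {w. form \<kappa> (fst p) (fst w) = 0}"

definition e3 :: ambient where
  "e3 = (0, 1)"

definition horizontal_plane :: "real \<Rightarrow> real \<Rightarrow> ambient set" where
  "horizontal_plane \<kappa> t = space_form \<kappa> \<times> {t}"

text \<open>The Riemannian distance from a point to a set.  Curves are \<open>C\<^sup>1\<close> on the whole closed
  interval, so that the integral giving their length always exists.\<close>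

definition curve_length :: "real \<Rightarrow> (real \<Rightarrow> ambient) \<Rightarrow> real" where
  "curve_length \<kappa> \<gamma> = integral {0..1} (\<lambda>t.
     sqrt (metric_form \<kappa> (vector_derivative \<gamma> (at t)) (vector_derivative \<gamma> (at t))))"

definition dist_to_set :: "real \<Rightarrow> ambient \<Rightarrow> ambient set \<Rightarrow> real" where
  "dist_to_set \<kappa> p A = Inf {curve_length \<kappa> \<gamma> |\<gamma>.
     \<gamma> C1_differentiable_on {0..1} \<and> path_image \<gamma> \<subseteq> prod_space \<kappa> \<and>
     pathstart \<gamma> = p \<and> pathfinish \<gamma> \<in> A}"


section \<open>Surfaces with boundary\<close>

definition C2_on :: "('a::real_normed_vector) set \<Rightarrow> ('a \<Rightarrow> 'b::real_normed_vector) \<Rightarrow> bool" where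
  "C2_on U f \<longleftrightarrow> (\<exists>(f' :: 'a \<Rightarrow> 'a \<Rightarrow>\<^sub>L 'b) (f'' :: 'a \<Rightarrow> 'a \<Rightarrow>\<^sub>L ('a \<Rightarrow>\<^sub>L 'b)).
     (\<forall>z\<in>U. (f has_derivative blinfun_apply (f' z)) (at z)) \<and>
     (\<forall>z\<in>U. (f' has_derivative blinfun_apply (f'' z)) (at z)) \<and>
     continuous_on U f'')"

definition D1 :: "('a::real_normed_vector \<Rightarrow> 'b::real_normed_vector) \<Rightarrow> 'a \<Rightarrow> 'a \<Rightarrow> 'b" where
  "D1 f z a = frechet_derivative f (at z) a"

definition D2 :: "('a::real_normed_vector \<Rightarrow> 'b::real_normed_vector) \<Rightarrow> 'a \<Rightarrow> 'a \<Rightarrow> 'a \<Rightarrow> 'b" where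
  "D2 f z a b = frechet_derivative (\<lambda>w. D1 f w a) (at z) b"

definition half_plane :: "(real \<times> real) set" where
  "half_plane = {z. snd z \<ge> 0}"

text \<open>A chart is the restriction to \<open>U \<inter> half_plane\<close> of a \<open>C\<^sup>2\<close> map on the open set \<open>U\<close>, i.e. it is
  \<open>C\<^sup>2\<close> up to the boundary line.  The values outside the half plane are irrelevant: the first two
  derivatives at points of \<open>U \<inter> half_plane\<close> do not depend on them.  If \<open>U\<close> does not meet the line
  \<open>snd z = 0\<close>, this is an ordinary interior chart.\<close>

definition chart :: "ambient set \<Rightarrow> (real \<times> real) set \<Rightarrow> (real \<times> real \<Rightarrow> ambient) \<Rightarrow> bool" where
  "chart S U X \<longleftrightarrow> open U \<and> C2_on U X \<and>
     (\<forall>z \<in> U \<inter> half_plane. inj (D1 X z)) \<and>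
     (\<exists>Y. homeomorphism (U \<inter> half_plane) (X ` (U \<inter> half_plane)) X Y) \<and>
     openin (top_of_set S) (X ` (U \<inter> half_plane))"

definition chart_at ::
  "ambient set \<Rightarrow> ambient \<Rightarrow> (real \<times> real \<Rightarrow> ambient) \<Rightarrow> real \<times> real \<Rightarrow> bool" where
  "chart_at S p X z \<longleftrightarrow> (\<exists>U. chart S U X \<and> z \<in> U \<inter> half_plane \<and> X z = p)"

definition surface :: "real \<Rightarrow> ambient set \<Rightarrow> bool" where
  "surface \<kappa> S \<longleftrightarrow> S \<subseteq> prod_space \<kappa> \<and> (\<forall>p\<in>S. \<exists>X z. chart_at S p X z)"

definition surface_boundary :: "ambient set \<Rightarrow> ambient set" where
  "surface_boundary S = {p \<in> S. \<exists>X z. chart_at S p X z \<and> snd z = 0}"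

definition tangent_plane :: "ambient set \<Rightarrow> ambient \<Rightarrow> ambient set" where
  "tangent_plane S p = {D1 X z a |X z a. chart_at S p X z}"

definition unit_normal :: "real \<Rightarrow> ambient set \<Rightarrow> (ambient \<Rightarrow> ambient) \<Rightarrow> bool" where
  "unit_normal \<kappa> S \<eta> \<longleftrightarrow> continuous_on S \<eta> \<and>
     (\<forall>p\<in>S. \<eta> p \<in> prod_tangent \<kappa> p \<and> metric_form \<kappa> (\<eta> p) (\<eta> p) = 1 \<and>
       (\<forall>w \<in> tangent_plane S p. metric_form \<kappa> (\<eta> p) w = 0))"


section \<open>Mean curvature and \<open>\<H>\<close>-surfaces\<close>

text \<open>The second fundamental form, evaluated on the tangent vectors \<open>D1 X z a\<close> and \<open>D1 X z b\<close>, is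
  the inner product of \<open>\<eta>\<close> with the covariant derivative in \<open>prod_space \<kappa>\<close>.  That covariant
  derivative differs from the flat second derivative of \<open>X\<close> by a multiple of the position vector
  of the \<open>space_form\<close> factor, which is orthogonal to \<open>\<eta>\<close>.  With this sign, a vertical graph of \<open>u\<close>
  with upward normal has \<open>div (grad u / sqrt (1 + |grad u|\<^sup>2)) = 2 H\<close>.\<close>

definition second_fundamental_form ::
  "real \<Rightarrow> (ambient \<Rightarrow> ambient) \<Rightarrow> (real \<times> real \<Rightarrow> ambient) \<Rightarrow> real \<times> real \<Rightarrow>
   real \<times> real \<Rightarrow> real \<times> real \<Rightarrow> real" where
  "second_fundamental_form \<kappa> \<eta> X z a b = metric_form \<kappa> (D2 X z a b) (\<eta> (X z))"

text \<open>\<open>k\<^sub>1\<close>, \<open>k\<^sub>2\<close> are the diagonal entries of the second fundamental form in an orthonormal basis of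
  the tangent plane consisting of principal directions.\<close>

definition principal_curvatures ::
  "real \<Rightarrow> ambient set \<Rightarrow> (ambient \<Rightarrow> ambient) \<Rightarrow> ambient \<Rightarrow> real \<Rightarrow> real \<Rightarrow> bool" where
  "principal_curvatures \<kappa> S \<eta> p k\<^sub>1 k\<^sub>2 \<longleftrightarrow> (\<exists>X z a b. chart_at S p X z \<and>
     metric_form \<kappa> (D1 X z a) (D1 X z a) = 1 \<and>
     metric_form \<kappa> (D1 X z b) (D1 X z b) = 1 \<and>
     metric_form \<kappa> (D1 X z a) (D1 X z b) = 0 \<and>
     second_fundamental_form \<kappa> \<eta> X z a a = k\<^sub>1 \<and>
     second_fundamental_form \<kappa> \<eta> X z b b = k\<^sub>2 \<and>
     second_fundamental_form \<kappa> \<eta> X z a b = 0)"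

definition mean_curvature ::
  "real \<Rightarrow> ambient set \<Rightarrow> (ambient \<Rightarrow> ambient) \<Rightarrow> ambient \<Rightarrow> real" where
  "mean_curvature \<kappa> S \<eta> p =
     (THE h. \<exists>k\<^sub>1 k\<^sub>2. principal_curvatures \<kappa> S \<eta> p k\<^sub>1 k\<^sub>2 \<and> h = (k\<^sub>1 + k\<^sub>2) / 2)"

definition angle_function :: "real \<Rightarrow> (ambient \<Rightarrow> ambient) \<Rightarrow> ambient \<Rightarrow> real" where
  "angle_function \<kappa> \<eta> p = metric_form \<kappa> (\<eta> p) e3"

definition H_surface ::
  "real \<Rightarrow> (real \<Rightarrow> real) \<Rightarrow> ambient set \<Rightarrow> (ambient \<Rightarrow> ambient) \<Rightarrow> bool" where
  "H_surface \<kappa> \<H> S \<eta> \<longleftrightarrow> surface \<kappa> S \<and> unit_normal \<kappa> S \<eta> \<and>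
     (\<forall>p\<in>S. mean_curvature \<kappa> S \<eta> p = \<H> (angle_function \<kappa> \<eta> p))"

text \<open>Since compact graphs with boundary are considered, a domain may contain some or all of its
  boundary points.\<close>

definition surface_domain :: "real \<Rightarrow> (real^3) set \<Rightarrow> bool" where
  "surface_domain \<kappa> \<Omega> \<longleftrightarrow> \<Omega> \<subseteq> space_form \<kappa> \<and>
     (\<exists>D. openin (top_of_set (space_form \<kappa>)) D \<and> connected D \<and> D \<noteq> {} \<and> D \<subseteq> \<Omega> \<and> \<Omega> \<subseteq> closure D)"

definition vertical_graph :: "real \<Rightarrow> ambient set \<Rightarrow> bool" where
  "vertical_graph \<kappa> S \<longleftrightarrow> (\<exists>\<Omega> u. surface_domain \<kappa> \<Omega> \<and> S = (\<lambda>x. (x, u x)) ` \<Omega>)"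

text \<open>One-sided derivatives at the endpoints: values outside the interval play no role.\<close>

definition C1_on_interval :: "real \<Rightarrow> real \<Rightarrow> (real \<Rightarrow> real) \<Rightarrow> bool" where
  "C1_on_interval a b f \<longleftrightarrow> (\<exists>f'. (\<forall>y\<in>{a..b}. (f has_real_derivative f' y) (at y within {a..b})) \<and>
     continuous_on {a..b} f')"

end

theory Submission imports Defs
begin

text \<open>Let \<open>\<sigma> = 1\<close> for \<open>v = e3\<close> and \<open>\<sigma> = -1\<close> for \<open>v = -e3\<close>, let \<open>h\<close> be the height and \<open>\<nu>\<close> the angle
  function of the surface, so that \<open>\<sigma> \<nu> > 0\<close>.  The estimate comes from two functions on the compact
  surface whose extrema can only lie on the boundary, where \<open>h = t\<close>.

  The maximum of \<open>\<sigma> h\<close> is on the boundary: at an interior maximum the tangent plane is horizontal and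
  the Hessian of \<open>\<sigma> h\<close> is nonpositive, while its trace is \<open>2 \<H> 1 > 0\<close>
  (\<open>H_graph_no_interior_max\<close>).  The minimum of \<open>\<sigma> h + 2 sqrt (\<sigma> \<nu>) / \<delta>\<close> is on the boundary as
  well, if \<open>\<delta>\<close> is small enough.  Since \<open>0 < \<sigma> \<nu> \<le> 1\<close>, the two facts give
  \<open>\<sigma> t - 2 / \<delta> \<le> \<sigma> h \<le> \<sigma> t\<close> (\<open>vertical_height_estimate\<close>), and \<open>2 / \<delta>\<close> is the required constant.

  For the second fact, write the surface near an interior minimum as the graph of \<open>w = \<sigma> h\<close>.
  Minimality means that the gradient bound \<open>|grad w|\<^sup>2 \<le> T w\<close> holds near the point, with equality
  there, where \<open>T s = 1 / y ^ 4 - 1\<close> and \<open>y = \<delta> (c - s) / 2\<close>.  So \<open>|grad w|\<^sup>2 - T w\<close> has a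
  local maximum, and applying the second order operator of the mean curvature equation to it gives, as in Bernstein's
  method, an inequality without third derivatives (\<open>H_graph_touching_inequality\<close>).  At a point of
  angle \<open>\<nu> = y\<^sup>2 < 1\<close> it says
  \<open>4 (\<H> \<nu>)\<^sup>2 + \<kappa> (1 - \<nu>\<^sup>2) + \<delta>\<^sup>2 (1 + 3 \<nu>\<^sup>2) / (2 \<nu>) - 6 \<delta> \<H> \<nu> sqrt \<nu> - 2 \<delta> (1 - \<nu>\<^sup>2) \<H>' \<nu> / sqrt \<nu> \<le> 0\<close>.
  The hypothesis on \<open>\<H>\<close> makes \<open>4 (\<H> \<nu>)\<^sup>2 + \<kappa> (1 - \<nu>\<^sup>2)\<close> positive, hence bounded below by some
  \<open>m > 0\<close>.  The only term that smallness of \<open>\<delta>\<close> does not control uniformly is the last one, for \<open>\<nu>\<close>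
  near \<open>0\<close>; there \<open>\<H>'\<close> is small, because \<open>\<H>\<close> is even and so \<open>\<H>' 0 = 0\<close>, and the
  arithmetic-geometric mean inequality absorbs it into \<open>\<delta>\<^sup>2 / (2 \<nu>)\<close>
  and a fraction of \<open>m\<close>.  Hence the inequality fails for small \<open>\<delta>\<close>
  (\<open>exists_slope_parameter\<close>).  This absorption is what dictates the square root of \<open>\<nu>\<close>.

  The surface is only of class \<open>C\<^sup>2\<close>, so that \<open>|grad w|\<^sup>2\<close> need not be twice differentiable.
  Its gradient is therefore replaced by difference quotients, the equation is differenced instead of
  differentiated (\<open>differenced_equation\<close>), and the second derivative test is applied to
  nearby maxima before passing to the limit (\<open>limit_max_principle\<close>, \<open>gradient_bound_inequality\<close>).
  The coordinates are Fermi coordinates about the geodesic in the direction of \<open>grad w\<close>: there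
  \<open>|grad w|\<^sup>2 = w\<^sub>1\<^sup>2 / c\<^sup>2 + w\<^sub>2\<^sup>2\<close>, nothing depends on the first coordinate explicitly, and \<open>w\<^sub>2\<close> vanishes at
  the point, which removes its second derivatives.

  It remains to see that the definition by charts leads to this equation.  Near an interior point
  the inverse function theorem gives a graph chart, through which every other chart factors
  (\<open>exists_graph_chart\<close>, \<open>chart_factors\<close>); so the mean curvature is the trace of one second
  fundamental form (\<open>mean_curvature_graph_chart\<close>), and \<open>interior_point_H_graph\<close> computes that trace in Fermi coordinates.\<close>

section \<open>Functions of class C1 and C2\<close>

text \<open>Being \<open>C\<^sup>2\<close> means having a derivative of class \<open>C\<^sup>1\<close>; with this predicate the closure
  properties of \<open>C2_on\<close> reduce to those one order below.\<close>

definition C1_on :: "('a::real_normed_vector) set \<Rightarrow> ('a \<Rightarrow> 'b::real_normed_vector) \<Rightarrow> bool" where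
  "C1_on U f \<longleftrightarrow> (\<exists>f' :: 'a \<Rightarrow> 'a \<Rightarrow>\<^sub>L 'b.
     (\<forall>z\<in>U. (f has_derivative blinfun_apply (f' z)) (at z)) \<and> continuous_on U f')"

lemma C2_on_iff_C1_derivative:
  "C2_on U f \<longleftrightarrow> (\<exists>f'. (\<forall>z\<in>U. (f has_derivative blinfun_apply (f' z)) (at z)) \<and> C1_on U f')"
  unfolding C2_on_def C1_on_def by metis

lemma C1_onI:
  assumes "\<And>z. z \<in> U \<Longrightarrow> (f has_derivative blinfun_apply (f' z)) (at z)" "continuous_on U f'"
  shows "C1_on U f"
  using assms unfolding C1_on_def by blast

lemma C2_onI:
  assumes "\<And>z. z \<in> U \<Longrightarrow> (f has_derivative blinfun_apply (f' z)) (at z)" "C1_on U f'"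
  shows "C2_on U f"
  using assms unfolding C2_on_iff_C1_derivative by blast

lemma C1_on_subset: "C1_on U f \<Longrightarrow> V \<subseteq> U \<Longrightarrow> C1_on V f"
  unfolding C1_on_def by (meson continuous_on_subset subsetD)

lemma C2_on_subset: "C2_on U f \<Longrightarrow> V \<subseteq> U \<Longrightarrow> C2_on V f"
  unfolding C2_on_iff_C1_derivative by (meson C1_on_subset subsetD)

lemma C1_on_imp_continuous_on: "C1_on U f \<Longrightarrow> continuous_on U f"
  unfolding C1_on_def
  by (meson continuous_at_imp_continuous_on has_derivative_continuous)

lemma C2_on_imp_C1_on: "C2_on U f \<Longrightarrow> C1_on U f"
  unfolding C2_on_iff_C1_derivative
  by (metis C1_on_def C1_on_imp_continuous_on)

lemma C1_on_const: "C1_on U (\<lambda>z. c)"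
  by (rule C1_onI[where f' = "\<lambda>_. 0"]) (auto simp: zero_blinfun.rep_eq)

lemma C1_on_bounded_linear:
  assumes "bounded_linear L" shows "C1_on U L"
  by (rule C1_onI[where f' = "\<lambda>_. Blinfun L"])
    (auto simp: bounded_linear_Blinfun_apply[OF assms] bounded_linear_imp_has_derivative[OF assms])

lemma C2_on_const: "C2_on U (\<lambda>z. c)"
  by (rule C2_onI[where f' = "\<lambda>_. 0"]) (auto simp: zero_blinfun.rep_eq intro: C1_on_const)

lemma C2_on_bounded_linear:
  assumes "bounded_linear L" shows "C2_on U L"
  by (rule C2_onI[where f' = "\<lambda>_. Blinfun L"])
    (auto simp: bounded_linear_Blinfun_apply[OF assms] bounded_linear_imp_has_derivative[OF assms] C1_on_const)

lemma C1_on_compose: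
  assumes "C1_on U f" "C1_on V g" "f ` U \<subseteq> V"
  shows "C1_on U (\<lambda>z. g (f z))"
proof -
  from assms(1) obtain f' where f': "\<And>z. z \<in> U \<Longrightarrow> (f has_derivative blinfun_apply (f' z)) (at z)"
    "continuous_on U f'" unfolding C1_on_def by blast
  from assms(2) obtain g' where g': "\<And>z. z \<in> V \<Longrightarrow> (g has_derivative blinfun_apply (g' z)) (at z)"
    "continuous_on V g'" unfolding C1_on_def by blast
  show ?thesis
  proof (rule C1_onI[where f' = "\<lambda>z. g' (f z) o\<^sub>L f' z"])
    show "((\<lambda>z. g (f z)) has_derivative blinfun_apply (g' (f z) o\<^sub>L f' z)) (at z)" if "z \<in> U" for z
      using diff_chain_at[OF f'(1)[OF that] g'(1)[of "f z"]] assms(3) that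
      by (simp add: o_def image_subset_iff blinfun_apply_blinfun_compose[abs_def])
    have "continuous_on U f" using assms(1) by (rule C1_on_imp_continuous_on)
    then have "continuous_on U (\<lambda>z. g' (f z))"
      by (rule continuous_on_compose2[OF g'(2)]) (use assms(3) in auto)
    then show "continuous_on U (\<lambda>z. g' (f z) o\<^sub>L f' z)"
      using f'(2) by (rule bounded_bilinear.continuous_on[OF bounded_bilinear_blinfun_compose])
  qed
qed

lemma C1_on_bounded_linear_compose:
  assumes "bounded_linear L" "C1_on U f" shows "C1_on U (\<lambda>z. L (f z))"
  using C1_on_compose[OF assms(2) C1_on_bounded_linear[OF assms(1), of UNIV]] by auto

lemma C1_on_add:
  assumes "C1_on U f" "C1_on U g" shows "C1_on U (\<lambda>z. f z + g z)"
proof -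
  from assms obtain f' g' where f': "\<And>z. z \<in> U \<Longrightarrow> (f has_derivative blinfun_apply (f' z)) (at z)"
    "continuous_on U f'" "\<And>z. z \<in> U \<Longrightarrow> (g has_derivative blinfun_apply (g' z)) (at z)"
    "continuous_on U g'" unfolding C1_on_def by blast
  show ?thesis
    by (rule C1_onI[where f' = "\<lambda>z. f' z + g' z"])
      (auto simp: plus_blinfun.rep_eq intro!: has_derivative_add f' continuous_on_add)
qed

lemma C1_on_bilinear:
  assumes b: "bounded_bilinear m" and "C1_on U f" "C1_on U g"
  shows "C1_on U (\<lambda>z. m (f z) (g z))"
proof -
  from assms obtain f' g' where f': "\<And>z. z \<in> U \<Longrightarrow> (f has_derivative blinfun_apply (f' z)) (at z)"
    "continuous_on U f'" "\<And>z. z \<in> U \<Longrightarrow> (g has_derivative blinfun_apply (g' z)) (at z)"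
    "continuous_on U g'" unfolding C1_on_def by blast
  note [continuous_intros] = bounded_bilinear.continuous_on[OF bounded_bilinear_blinfun_compose]
    bounded_linear.continuous_on[OF bounded_bilinear.bounded_linear_prod_right[OF b]]
    bounded_linear.continuous_on[OF bounded_bilinear.bounded_linear_prod_left[OF b]]
  show ?thesis
  proof (rule C1_onI[where f' = "\<lambda>z. (bounded_bilinear.prod_right m (f z) o\<^sub>L g' z)
        + (bounded_bilinear.prod_left m (g z) o\<^sub>L f' z)"])
    show "((\<lambda>z. m (f z) (g z)) has_derivative
        blinfun_apply ((bounded_bilinear.prod_right m (f z) o\<^sub>L g' z)
        + (bounded_bilinear.prod_left m (g z) o\<^sub>L f' z))) (at z)" if "z \<in> U" for z
      using bounded_bilinear.FDERIV[OF b f'(1) f'(3)] that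
      by (simp add: plus_blinfun.rep_eq bounded_bilinear.prod_right.rep_eq[OF b]
          bounded_bilinear.prod_left.rep_eq[OF b])
  qed (intro continuous_intros f' C1_on_imp_continuous_on assms)
qed

lemma C2_on_compose:
  assumes "C2_on U f" "C2_on V g" "f ` U \<subseteq> V"
  shows "C2_on U (\<lambda>z. g (f z))"
proof -
  from assms(1) obtain f' where f': "\<And>z. z \<in> U \<Longrightarrow> (f has_derivative blinfun_apply (f' z)) (at z)"
    "C1_on U f'" unfolding C2_on_iff_C1_derivative by blast
  from assms(2) obtain g' where g': "\<And>z. z \<in> V \<Longrightarrow> (g has_derivative blinfun_apply (g' z)) (at z)"
    "C1_on V g'" unfolding C2_on_iff_C1_derivative by blast
  show ?thesis
  proof (rule C2_onI[where f' = "\<lambda>z. g' (f z) o\<^sub>L f' z"])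
    show "((\<lambda>z. g (f z)) has_derivative blinfun_apply (g' (f z) o\<^sub>L f' z)) (at z)" if "z \<in> U" for z
      using diff_chain_at[OF f'(1)[OF that] g'(1)[of "f z"]] assms(3) that
      by (simp add: o_def image_subset_iff blinfun_apply_blinfun_compose[abs_def])
    show "C1_on U (\<lambda>z. g' (f z) o\<^sub>L f' z)"
      by (rule C1_on_bilinear[OF bounded_bilinear_blinfun_compose
            C1_on_compose[OF C2_on_imp_C1_on[OF assms(1)] g'(2) assms(3)] f'(2)])
  qed
qed

lemma C2_on_bounded_linear_compose:
  assumes "bounded_linear L" "C2_on U f" shows "C2_on U (\<lambda>z. L (f z))"
  using C2_on_compose[OF assms(2) C2_on_bounded_linear[OF assms(1), of UNIV]] by auto

lemma C2_on_add:
  assumes "C2_on U f" "C2_on U g" shows "C2_on U (\<lambda>z. f z + g z)"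
proof -
  from assms obtain f' g' where f': "\<And>z. z \<in> U \<Longrightarrow> (f has_derivative blinfun_apply (f' z)) (at z)"
    "C1_on U f'" "\<And>z. z \<in> U \<Longrightarrow> (g has_derivative blinfun_apply (g' z)) (at z)"
    "C1_on U g'" unfolding C2_on_iff_C1_derivative by blast
  show ?thesis
    by (rule C2_onI[where f' = "\<lambda>z. f' z + g' z"])
      (auto simp: plus_blinfun.rep_eq intro!: has_derivative_add f' C1_on_add)
qed

lemma C2_on_bilinear:
  assumes b: "bounded_bilinear m" and "C2_on U f" "C2_on U g"
  shows "C2_on U (\<lambda>z. m (f z) (g z))"
proof -
  from assms obtain f' g' where f': "\<And>z. z \<in> U \<Longrightarrow> (f has_derivative blinfun_apply (f' z)) (at z)"
    "C1_on U f'" "\<And>z. z \<in> U \<Longrightarrow> (g has_derivative blinfun_apply (g' z)) (at z)"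
    "C1_on U g'" unfolding C2_on_iff_C1_derivative by blast
  show ?thesis
  proof (rule C2_onI[where f' = "\<lambda>z. (bounded_bilinear.prod_right m (f z) o\<^sub>L g' z)
        + (bounded_bilinear.prod_left m (g z) o\<^sub>L f' z)"])
    show "((\<lambda>z. m (f z) (g z)) has_derivative
        blinfun_apply ((bounded_bilinear.prod_right m (f z) o\<^sub>L g' z)
        + (bounded_bilinear.prod_left m (g z) o\<^sub>L f' z))) (at z)" if "z \<in> U" for z
      using bounded_bilinear.FDERIV[OF b f'(1) f'(3)] that
      by (simp add: plus_blinfun.rep_eq bounded_bilinear.prod_right.rep_eq[OF b]
          bounded_bilinear.prod_left.rep_eq[OF b])
  qed (rule C1_on_add[OF
        C1_on_bilinear[OF bounded_bilinear_blinfun_compose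
          C1_on_bounded_linear_compose[OF bounded_bilinear.bounded_linear_prod_right[OF b]
            C2_on_imp_C1_on[OF assms(2)]] f'(4)]
        C1_on_bilinear[OF bounded_bilinear_blinfun_compose
          C1_on_bounded_linear_compose[OF bounded_bilinear.bounded_linear_prod_left[OF b]
            C2_on_imp_C1_on[OF assms(3)]] f'(2)]])
qed

lemma C1_on_real:
  fixes f :: "real \<Rightarrow> real"
  assumes "\<And>t. t \<in> U \<Longrightarrow> (f has_real_derivative f' t) (at t)" "continuous_on U f'"
  shows "C1_on U f"
  by (rule C1_onI[where f' = "\<lambda>t. blinfun_scaleR_left (f' t)"])
    (use assms in \<open>auto simp: has_field_derivative_def mult_commute_abs intro!: continuous_intros\<close>)

lemma C2_on_real:
  fixes f :: "real \<Rightarrow> real"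
  assumes "\<And>t. t \<in> U \<Longrightarrow> (f has_real_derivative f' t) (at t)"
    and "\<And>t. t \<in> U \<Longrightarrow> (f' has_real_derivative f'' t) (at t)" "continuous_on U f''"
  shows "C2_on U f"
proof (rule C2_onI[where f' = "\<lambda>t. blinfun_scaleR_left (f' t)"])
  show "C1_on U (\<lambda>t. blinfun_scaleR_left (f' t))"
    by (rule C1_on_bounded_linear_compose[OF bounded_linear_blinfun_scaleR_left])
      (rule C1_on_real[OF assms(2,3)])
qed (use assms in \<open>auto simp: has_field_derivative_def mult_commute_abs\<close>)

text \<open>The link between a pair of derivatives witnessing \<open>C2_on\<close> and the directional derivatives
  \<open>D1\<close>, \<open>D2\<close>.\<close>

lemma C2_on_D1_D2:
  assumes "C2_on U f" "open U"
  obtains f' f'' where "\<And>z. z \<in> U \<Longrightarrow> (f has_derivative blinfun_apply (f' z)) (at z)"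
    "\<And>z. z \<in> U \<Longrightarrow> (f' has_derivative blinfun_apply (f'' z)) (at z)"
    "continuous_on U f'" "continuous_on U f''"
    "\<And>z. z \<in> U \<Longrightarrow> D1 f z = blinfun_apply (f' z)"
    "\<And>z a b. z \<in> U \<Longrightarrow> D2 f z a b = blinfun_apply (blinfun_apply (f'' z) b) a"
proof -
  from assms obtain f' :: "'a \<Rightarrow> 'a \<Rightarrow>\<^sub>L 'b" and f'' where
    1: "\<And>z. z \<in> U \<Longrightarrow> (f has_derivative blinfun_apply (f' z)) (at z)"
    and 2: "\<And>z. z \<in> U \<Longrightarrow> (f' has_derivative blinfun_apply (f'' z)) (at z)"
    and 3: "continuous_on U f''"
    unfolding C2_on_def by blast
  have 4: "frechet_derivative f (at z) = blinfun_apply (f' z)" if "z \<in> U" for z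
    using frechet_derivative_at[OF 1[OF that]] by simp
  have "D2 f z a b = blinfun_apply (blinfun_apply (f'' z) b) a" if z: "z \<in> U" for z a b
  proof -
    have "((\<lambda>w. blinfun_apply (f' w) a) has_derivative (\<lambda>b. blinfun_apply (blinfun_apply (f'' z) b) a)) (at z)"
      using bounded_linear.has_derivative[OF blinfun.bounded_linear_left 2[OF z]] by simp
    then have "((\<lambda>w. frechet_derivative f (at w) a) has_derivative (\<lambda>b. blinfun_apply (blinfun_apply (f'' z) b) a)) (at z)"
      by (rule has_derivative_transform_within_open[OF _ \<open>open U\<close> z]) (simp add: 4)
    from fun_cong[OF frechet_derivative_at[OF this], of b] show ?thesis unfolding D2_def D1_def by simp
  qed
  moreover have "continuous_on U f'"
    by (meson 2 continuous_at_imp_continuous_on has_derivative_continuous)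
  ultimately show ?thesis using 1 2 3 4 that unfolding D1_def by blast
qed

section \<open>Maximum principle for limits of difference quotients\<close>

definition has_grad :: "(real \<times> real \<Rightarrow> real) \<Rightarrow> real \<Rightarrow> real \<Rightarrow> real \<times> real \<Rightarrow> bool" where
  "has_grad f p q z \<longleftrightarrow> (f has_derivative (\<lambda>h. p * fst h + q * snd h)) (at z)"

text \<open>The two mixed second derivatives are given by the same function, as for functions of class
  \<open>C\<^sup>2\<close>; continuity is kept apart because the auxiliary functions below only need to have second
  derivatives.\<close>

definition has_hessian :: "(real \<times> real \<Rightarrow> real) \<Rightarrow> (real \<times> real \<Rightarrow> real) \<Rightarrow> (real \<times> real \<Rightarrow> real) \<Rightarrow>
    (real \<times> real \<Rightarrow> real) \<Rightarrow> (real \<times> real \<Rightarrow> real) \<Rightarrow> (real \<times> real \<Rightarrow> real) \<Rightarrow> (real \<times> real) set \<Rightarrow> bool" where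
  "has_hessian u u1 u2 u11 u12 u22 V \<longleftrightarrow> (\<forall>z\<in>V. has_grad u (u1 z) (u2 z) z \<and>
     has_grad u1 (u11 z) (u12 z) z \<and> has_grad u2 (u12 z) (u22 z) z)"

lemma has_grad_line:
  assumes "has_grad f p q (z + s *\<^sub>R (a, b))"
  shows "((\<lambda>s. f (z + s *\<^sub>R (a, b))) has_real_derivative (p * a + q * b)) (at s)"
proof -
  have "((\<lambda>s. z + s *\<^sub>R (a, b)) has_derivative (\<lambda>h. h *\<^sub>R (a, b))) (at s)"
    by (auto intro!: derivative_eq_intros)
  from has_derivative_compose[OF this assms[unfolded has_grad_def]]
  show ?thesis unfolding has_field_derivative_def
    by (rule has_derivative_eq_rhs) (simp add: fun_eq_iff algebra_simps)
qed

lemma local_max_critical: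
  assumes "has_grad f p q z" "open V" "z \<in> V" "\<And>w. w \<in> V \<Longrightarrow> f w \<le> f z"
  shows "p = 0" "q = 0"
proof -
  have *: "p * a + q * b = 0" for a b
  proof -
    have "open ((\<lambda>s::real. z + s *\<^sub>R (a, b)) -` V)"
      by (intro continuous_open_vimage assms(2) continuous_intros)
    moreover have "0 \<in> (\<lambda>s::real. z + s *\<^sub>R (a, b)) -` V" using assms(3) by (simp add: zero_prod_def[symmetric])
    ultimately obtain d where d: "d > 0" "ball 0 d \<subseteq> (\<lambda>s::real. z + s *\<^sub>R (a, b)) -` V"
      by (meson open_contains_ball)
    show ?thesis
      by (rule DERIV_local_max[OF has_grad_line[of f p q z 0] d(1)])
        (use assms(1,4) d(2) in \<open>auto simp: dist_real_def zero_prod_def[symmetric]\<close>)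
  qed
  show "p = 0" using *[of 1 0] by simp
  show "q = 0" using *[of 0 1] by simp
qed

text \<open>Restricted to a line, a positive second derivative at a critical point would make the first
  derivative, and then the function, increase to the right of the point.\<close>

lemma local_max_hessian:
  assumes f: "has_hessian f f1 f2 f11 f12 f22 V" and "open V" "z \<in> V" "\<And>w. w \<in> V \<Longrightarrow> f w \<le> f z"
  shows "f11 z * a\<^sup>2 + 2 * f12 z * a * b + f22 z * b\<^sup>2 \<le> 0"
proof (rule ccontr)
  assume neg: "\<not> ?thesis"
  define g where "g s = f (z + s *\<^sub>R (a, b))" for s :: real
  define g1 where "g1 s = f1 (z + s *\<^sub>R (a, b)) * a + f2 (z + s *\<^sub>R (a, b)) * b" for s :: real
  have "open ((\<lambda>s::real. z + s *\<^sub>R (a, b)) -` V)"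
    by (intro continuous_open_vimage assms(2) continuous_intros)
  moreover have "0 \<in> (\<lambda>s::real. z + s *\<^sub>R (a, b)) -` V" using assms(3) by (simp add: zero_prod_def[symmetric])
  ultimately obtain d where d: "d > 0" "ball 0 d \<subseteq> (\<lambda>s::real. z + s *\<^sub>R (a, b)) -` V"
    by (meson open_contains_ball)
  have inV: "z + s *\<^sub>R (a, b) \<in> V" if "\<bar>s\<bar> < d" for s
    using d(2) that by (auto simp: subset_iff dist_real_def)
  have g: "(g has_real_derivative g1 s) (at s)" if "\<bar>s\<bar> < d" for s
    unfolding g_def g1_def using f inV[OF that] by (intro has_grad_line) (auto simp: has_hessian_def)
  have "(g1 has_real_derivative (f11 z * a + f12 z * b) * a + (f12 z * a + f22 z * b) * b) (at 0)"
    unfolding g1_def using f assms(3)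
    by (intro DERIV_add DERIV_cmult_right has_grad_line) (auto simp: has_hessian_def zero_prod_def[symmetric])
  moreover have "(f11 z * a + f12 z * b) * a + (f12 z * a + f22 z * b) * b > 0"
    using neg by (simp add: power2_eq_square algebra_simps)
  ultimately obtain e where e: "e > 0" "\<And>h. 0 < h \<Longrightarrow> h < e \<Longrightarrow> g1 0 < g1 (0 + h)"
    using DERIV_pos_inc_right by blast
  have "has_grad f (f1 z) (f2 z) z" using f assms(3) by (auto simp: has_hessian_def)
  from local_max_critical[OF this assms(2-4)] have "g1 0 = 0"
    unfolding g1_def by (simp add: zero_prod_def[symmetric])
  define h where "h = min d e / 2"
  have h: "0 < h" "h < d" "h < e" using d(1) e(1) by (auto simp: h_def)
  obtain \<xi> where xi: "0 < \<xi>" "\<xi> < h" "g h - g 0 = (h - 0) * g1 \<xi>"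
  proof -
    have D: "(g has_real_derivative g1 s) (at s)" if "0 \<le> s" "s \<le> h" for s
      using g[of s] that h by simp
    show ?thesis using MVT2[OF h(1), of g g1, OF D] that by metis
  qed
  have "g1 \<xi> > 0" using e(2)[of \<xi>] xi h \<open>g1 0 = 0\<close> by simp
  then have "g h > g 0" using xi(3) h by (smt (verit) mult_pos_pos)
  moreover have "g h \<le> g 0" unfolding g_def using assms(4)[OF inV, of h] h by (simp add: zero_prod_def[symmetric])
  ultimately show False by simp
qed

text \<open>Completing the square in \<open>A\<close> writes the contraction as a positive combination of values of
  the quadratic form of \<open>h\<close>.\<close>

lemma trace_nonpos:
  fixes A11 A12 A22 h11 h12 h22 :: real
  assumes "A11 > 0" "A11 * A22 - A12\<^sup>2 > 0"
    and "\<And>a b. h11 * a\<^sup>2 + 2 * h12 * a * b + h22 * b\<^sup>2 \<le> 0"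
  shows "A11 * h11 + 2 * A12 * h12 + A22 * h22 \<le> 0"
proof -
  have "A11 * (A11 * h11 + 2 * A12 * h12 + A22 * h22)
      = (h11 * A11\<^sup>2 + 2 * h12 * A11 * A12 + h22 * A12\<^sup>2) + (A11 * A22 - A12\<^sup>2) * h22"
    by (simp add: power2_eq_square algebra_simps)
  moreover have "h22 \<le> 0" using assms(3)[of 0 1] by simp
  then have "(A11 * A22 - A12\<^sup>2) * h22 \<le> 0" using assms(2) by (simp add: mult_nonneg_nonpos)
  ultimately have "A11 * (A11 * h11 + 2 * A12 * h12 + A22 * h22) \<le> 0" using assms(3)[of A11 A12] by linarith
  then show ?thesis using assms(1) by (simp add: mult_le_0_iff)
qed

text \<open>The limit \<open>Z0\<close> may fail to have second derivatives.  Subtracting \<open>\<epsilon> |z|\<^sup>2\<close> makes its maximum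
  at \<open>0\<close> strict, which forces maxima of \<open>Z t - \<epsilon> |z|\<^sup>2\<close> to converge to \<open>0\<close> along a sequence; at
  these the second derivative test applies.  The convergence of \<open>Z t\<close> is required along moving
  points, as a substitute for local uniform convergence.\<close>

lemma limit_max_principle:
  fixes Z Z1 Z2 Z11 Z12 Z22 :: "real \<Rightarrow> real \<times> real \<Rightarrow> real" and Z0 :: "real \<times> real \<Rightarrow> real"
  assumes "R > 0" "T0 > 0"
    and A: "\<And>z. z \<in> ball 0 R \<Longrightarrow> A11 z > 0" "\<And>z. z \<in> ball 0 R \<Longrightarrow> A11 z * A22 z - (A12 z)\<^sup>2 > 0"
      "isCont A11 0" "isCont A22 0"
    and Z: "\<And>t. 0 < t \<Longrightarrow> t < T0 \<Longrightarrow> has_hessian (Z t) (Z1 t) (Z2 t) (Z11 t) (Z12 t) (Z22 t) (ball 0 R)"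
    and Z0: "\<And>t x a. (\<And>n. 0 < t n) \<Longrightarrow> t \<longlonglongrightarrow> 0 \<Longrightarrow> x \<longlonglongrightarrow> a \<Longrightarrow> a \<in> ball 0 R \<Longrightarrow>
          (\<lambda>n. Z (t n) (x n)) \<longlonglongrightarrow> Z0 a"
    and J: "\<And>t x. (\<And>n. 0 < t n) \<Longrightarrow> t \<longlonglongrightarrow> 0 \<Longrightarrow> x \<longlonglongrightarrow> 0 \<Longrightarrow>
          (\<lambda>n. A11 (x n) * Z11 (t n) (x n) + 2 * A12 (x n) * Z12 (t n) (x n) + A22 (x n) * Z22 (t n) (x n)) \<longlonglongrightarrow> J"
    and max: "\<And>z. z \<in> ball 0 R \<Longrightarrow> Z0 z \<le> Z0 0"
  shows "J \<le> 0"
proof -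
  define K where "K = (cball 0 (R/2) :: (real \<times> real) set)"
  have K: "compact K" "0 \<in> K" "K \<subseteq> ball 0 R" using \<open>R > 0\<close> by (auto simp: K_def)
  define t where "t n = T0 / (real n + 2)" for n
  have t: "0 < t n" "t n < T0" for n using \<open>T0 > 0\<close> by (auto simp: t_def field_simps add_pos_nonneg)
  have t0: "t \<longlonglongrightarrow> 0" unfolding t_def by real_asymp
  have "J \<le> 2 * \<epsilon> * (A11 0 + A22 0)" if "\<epsilon> > 0" for \<epsilon>
  proof -
    define F where "F n z = Z (t n) z - \<epsilon> * ((fst z)\<^sup>2 + (snd z)\<^sup>2)" for n z
    have hF: "has_hessian (F n) (\<lambda>z. Z1 (t n) z - 2 * \<epsilon> * fst z) (\<lambda>z. Z2 (t n) z - 2 * \<epsilon> * snd z)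
        (\<lambda>z. Z11 (t n) z - 2 * \<epsilon>) (Z12 (t n)) (\<lambda>z. Z22 (t n) z - 2 * \<epsilon>) (ball 0 R)" for n
      using Z[OF t, of n] unfolding has_hessian_def has_grad_def F_def
      by (auto intro!: derivative_eq_intros simp: fun_eq_iff algebra_simps)
    have "continuous_on K (F n)" for n
    proof (rule continuous_at_imp_continuous_on, rule ballI)
      fix z assume "z \<in> K"
      then have "z \<in> ball 0 R" using K by auto
      then have "has_grad (F n) (Z1 (t n) z - 2 * \<epsilon> * fst z) (Z2 (t n) z - 2 * \<epsilon> * snd z) z"
        using hF[of n] unfolding has_hessian_def by blast
      then show "isCont (F n) z"
        unfolding has_grad_def by (rule has_derivative_continuous)
    qed
    then have "\<exists>x\<in>K. \<forall>y\<in>K. F n y \<le> F n x" for n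
      using continuous_attains_sup[OF K(1), of "F n"] K(2) by auto
    then obtain x where x: "\<And>n. x n \<in> K" "\<And>n y. y \<in> K \<Longrightarrow> F n y \<le> F n (x n)" by metis
    obtain a r where ar: "a \<in> K" "strict_mono r" "(x \<circ> r) \<longlonglongrightarrow> a"
      using K(1) x(1) unfolding compact_def by meson
    have tr: "(t \<circ> r) \<longlonglongrightarrow> 0" using LIMSEQ_subseq_LIMSEQ[OF t0 ar(2)] .
    have "(\<lambda>n. Z ((t \<circ> r) n) ((x \<circ> r) n)) \<longlonglongrightarrow> Z0 a"
      by (rule Z0[OF _ tr ar(3)]) (use t ar(1) K in auto)
    then have 1: "(\<lambda>n. F (r n) (x (r n))) \<longlonglongrightarrow> Z0 a - \<epsilon> * ((fst a)\<^sup>2 + (snd a)\<^sup>2)"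
      unfolding F_def using ar(3) by (auto intro!: tendsto_intros simp: o_def)
    have "(\<lambda>n. Z ((t \<circ> r) n) 0) \<longlonglongrightarrow> Z0 0"
      by (rule Z0[OF _ tr tendsto_const]) (use t \<open>R > 0\<close> in auto)
    then have 2: "(\<lambda>n. F (r n) 0) \<longlonglongrightarrow> Z0 0" unfolding F_def by (simp add: o_def)
    have "Z0 0 \<le> Z0 a - \<epsilon> * ((fst a)\<^sup>2 + (snd a)\<^sup>2)"
      by (rule LIMSEQ_le[OF 2 1]) (use x(2)[OF K(2)] in auto)
    then have "\<epsilon> * ((fst a)\<^sup>2 + (snd a)\<^sup>2) \<le> 0" using max[of a] ar(1) K by auto
    then have "(fst a)\<^sup>2 + (snd a)\<^sup>2 \<le> 0" using \<open>\<epsilon> > 0\<close> by (simp add: mult_le_0_iff)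
    then have a0: "a = 0" by (simp add: prod_eq_iff sum_power2_le_zero_iff)
    have xr: "(x \<circ> r) \<longlonglongrightarrow> 0" using ar(3) a0 by simp
    have lim: "(\<lambda>n. A11 ((x \<circ> r) n) * Z11 ((t \<circ> r) n) ((x \<circ> r) n) + 2 * A12 ((x \<circ> r) n) * Z12 ((t \<circ> r) n) ((x \<circ> r) n)
         + A22 ((x \<circ> r) n) * Z22 ((t \<circ> r) n) ((x \<circ> r) n)) \<longlonglongrightarrow> J"
      by (rule J[OF _ tr xr]) (use t in auto)
    have lim2: "(\<lambda>n. 2 * \<epsilon> * (A11 ((x \<circ> r) n) + A22 ((x \<circ> r) n))) \<longlonglongrightarrow> 2 * \<epsilon> * (A11 0 + A22 0)"
      by (intro tendsto_intros isCont_tendsto_compose[OF A(3) xr] isCont_tendsto_compose[OF A(4) xr])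
    have "\<forall>\<^sub>F n in sequentially. (x \<circ> r) n \<in> ball 0 (R/2)"
      using xr \<open>R > 0\<close> by (intro topological_tendstoD[OF xr]) auto
    then have "\<forall>\<^sub>F n in sequentially. A11 ((x \<circ> r) n) * Z11 ((t \<circ> r) n) ((x \<circ> r) n) + 2 * A12 ((x \<circ> r) n) * Z12 ((t \<circ> r) n) ((x \<circ> r) n)
         + A22 ((x \<circ> r) n) * Z22 ((t \<circ> r) n) ((x \<circ> r) n) \<le> 2 * \<epsilon> * (A11 ((x \<circ> r) n) + A22 ((x \<circ> r) n))"
    proof eventually_elim
      case (elim n)
      let ?x = "x (r n)" and ?m = "r n"
      have xb: "?x \<in> ball 0 (R/2)" using elim by simp
      have xb': "?x \<in> ball 0 R" using xb \<open>R > 0\<close> by auto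
      have hF': "has_hessian (F ?m) (\<lambda>z. Z1 (t ?m) z - 2 * \<epsilon> * fst z) (\<lambda>z. Z2 (t ?m) z - 2 * \<epsilon> * snd z)
        (\<lambda>z. Z11 (t ?m) z - 2 * \<epsilon>) (Z12 (t ?m)) (\<lambda>z. Z22 (t ?m) z - 2 * \<epsilon>) (ball 0 (R/2))"
        using hF[of ?m] \<open>R > 0\<close> unfolding has_hessian_def by auto
      have "(Z11 (t ?m) ?x - 2 * \<epsilon>) * a\<^sup>2 + 2 * Z12 (t ?m) ?x * a * b + (Z22 (t ?m) ?x - 2 * \<epsilon>) * b\<^sup>2 \<le> 0" for a b
        by (rule local_max_hessian[OF hF' _ xb]) (use x(2) in \<open>auto simp: K_def\<close>)
      from trace_nonpos[OF A(1)[OF xb'] A(2)[OF xb'] this]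
      show ?case by (simp add: algebra_simps)
    qed
    then show ?thesis by (intro tendsto_le[OF _ lim2 lim]) auto
  qed
  note * = this
  show "J \<le> 0"
  proof (rule ccontr)
    assume "\<not> J \<le> 0"
    define S where "S = \<bar>A11 0 + A22 0\<bar> + 1"
    have S: "S > 0" "A11 0 + A22 0 \<le> S" by (auto simp: S_def)
    have "J \<le> 2 * (J / (4 * S)) * (A11 0 + A22 0)" using \<open>\<not> J \<le> 0\<close> S by (intro *) auto
    also have "\<dots> \<le> 2 * (J / (4 * S)) * S" using \<open>\<not> J \<le> 0\<close> S by (intro mult_left_mono) auto
    also have "\<dots> = J / 2" using S by simp
    finally show False using \<open>\<not> J \<le> 0\<close> by simp
  qed
qed

text \<open>Strict differentiability at \<open>0\<close> in the direction \<open>e\<close>: the base point of the difference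
  quotient may move while it tends to \<open>0\<close>.\<close>

definition strict_quotient :: "('a::real_normed_vector \<Rightarrow> real) \<Rightarrow> 'a \<Rightarrow> real \<Rightarrow> bool" where
  "strict_quotient f e l \<longleftrightarrow> (\<forall>t x. (\<forall>n. 0 < t n) \<longrightarrow> t \<longlonglongrightarrow> 0 \<longrightarrow> x \<longlonglongrightarrow> 0 \<longrightarrow>
     (\<lambda>n. (f (x n + t n *\<^sub>R e) - f (x n)) / t n) \<longlonglongrightarrow> l)"

text \<open>By the mean value theorem the quotient is the derivative at an intermediate point, and the
  derivative is continuous at \<open>a\<close>.\<close>

lemma quotient_tendsto:
  fixes f :: "'a::real_normed_vector \<Rightarrow> real"
  assumes "open V" "a \<in> V" and f: "\<And>z. z \<in> V \<Longrightarrow> (f has_derivative f' z) (at z)"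
    and c: "isCont (\<lambda>z. f' z e) a"
    and "\<And>n. 0 < t n" "t \<longlonglongrightarrow> 0" "x \<longlonglongrightarrow> a"
  shows "(\<lambda>n. (f (x n + t n *\<^sub>R e) - f (x n)) / t n) \<longlonglongrightarrow> f' a e"
proof (rule tendstoI)
  fix \<epsilon> :: real assume "\<epsilon> > 0"
  obtain d1 where d1: "d1 > 0" "\<And>z. dist z a < d1 \<Longrightarrow> dist (f' z e) (f' a e) < \<epsilon>"
    using c \<open>\<epsilon> > 0\<close> unfolding continuous_at_eps_delta dist_norm by blast
  obtain d2 where d2: "d2 > 0" "ball a d2 \<subseteq> V" using assms(1,2) open_contains_ball by blast
  define d where "d = min d1 d2"
  have d: "d > 0" using d1 d2 by (simp add: d_def)
  have "(\<lambda>n. x n + t n *\<^sub>R e) \<longlonglongrightarrow> a + 0 *\<^sub>R e" by (intro tendsto_intros assms)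
  then have "\<forall>\<^sub>F n in sequentially. x n + t n *\<^sub>R e \<in> ball a d"
    using d by (intro topological_tendstoD) auto
  moreover have "\<forall>\<^sub>F n in sequentially. x n \<in> ball a d"
    using d assms(7) by (intro topological_tendstoD) auto
  ultimately show "\<forall>\<^sub>F n in sequentially. dist ((f (x n + t n *\<^sub>R e) - f (x n)) / t n) (f' a e) < \<epsilon>"
  proof eventually_elim
    case (elim n)
    have seg: "x n + s *\<^sub>R e \<in> ball a d" if "0 \<le> s" "s \<le> t n" for s
    proof -
      have "x n + s *\<^sub>R e = (1 - s / t n) *\<^sub>R x n + (s / t n) *\<^sub>R (x n + t n *\<^sub>R e)"
        using assms(5)[of n] by (simp add: algebra_simps)
      moreover have "(1 - s / t n) *\<^sub>R x n + (s / t n) *\<^sub>R (x n + t n *\<^sub>R e) \<in> ball a d"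
        by (rule convexD[OF convex_ball]) (use elim that assms(5)[of n] in auto)
      ultimately show ?thesis by simp
    qed
    have D: "((\<lambda>s. f (x n + s *\<^sub>R e)) has_real_derivative f' (x n + s *\<^sub>R e) e) (at s)" if "0 \<le> s" "s \<le> t n" for s
    proof -
      have "x n + s *\<^sub>R e \<in> V" using seg[OF that] d2(2) by (auto simp: d_def)
      note D = f[OF this]
      have "((\<lambda>s. x n + s *\<^sub>R e) has_derivative (\<lambda>h. h *\<^sub>R e)) (at s)"
        by (auto intro!: derivative_eq_intros)
      from has_derivative_compose[OF this D]
      show ?thesis using linear_scale[OF has_derivative_linear[OF D]]
        by (simp add: has_field_derivative_def mult_commute_abs)
    qed
    obtain \<xi> where xi: "0 < \<xi>" "\<xi> < t n"
      "f (x n + t n *\<^sub>R e) - f (x n + 0 *\<^sub>R e) = (t n - 0) * f' (x n + \<xi> *\<^sub>R e) e"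
      using MVT2[OF assms(5)[of n], of "\<lambda>s. f (x n + s *\<^sub>R e)" "\<lambda>s. f' (x n + s *\<^sub>R e) e", OF D] by metis
    have "dist (f' (x n + \<xi> *\<^sub>R e) e) (f' a e) < \<epsilon>"
      using seg[of \<xi>] xi by (intro d1(2)) (auto simp: d_def dist_commute)
    then show ?case using xi(3) assms(5)[of n] by simp
  qed
qed

lemma strict_quotientI:
  fixes f :: "'a::real_normed_vector \<Rightarrow> real"
  assumes "open V" "0 \<in> V" and "\<And>z. z \<in> V \<Longrightarrow> (f has_derivative f' z) (at z)"
    and "isCont (\<lambda>z. f' z e) 0" "f' 0 e = l"
  shows "strict_quotient f e l"
  unfolding strict_quotient_def
  using quotient_tendsto[where V = V and a = 0 and f' = f', OF assms(1-4)] assms(5) by simp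

lemma strict_quotientD:
  assumes "strict_quotient f e l" "\<And>n. 0 < t n" "t \<longlonglongrightarrow> 0" "x \<longlonglongrightarrow> 0"
  shows "(\<lambda>n. (f (x n + t n *\<^sub>R e) - f (x n)) / t n) \<longlonglongrightarrow> l"
  using assms unfolding strict_quotient_def by blast

lemma shifted_tendsto:
  fixes f :: "'a::real_normed_vector \<Rightarrow> real"
  assumes "isCont f 0" "t \<longlonglongrightarrow> 0" "x \<longlonglongrightarrow> 0"
  shows "(\<lambda>n. f (x n + t n *\<^sub>R e)) \<longlonglongrightarrow> f 0" "(\<lambda>n. f (x n)) \<longlonglongrightarrow> f 0"
proof -
  have "(\<lambda>n. x n + t n *\<^sub>R e) \<longlonglongrightarrow> 0 + 0 *\<^sub>R e" by (intro tendsto_intros assms)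
  then show "(\<lambda>n. f (x n + t n *\<^sub>R e)) \<longlonglongrightarrow> f 0" using isCont_tendsto_compose[OF assms(1)] by simp
  show "(\<lambda>n. f (x n)) \<longlonglongrightarrow> f 0" using isCont_tendsto_compose[OF assms(1,3)] .
qed

lemma strict_quotient_const: "strict_quotient (\<lambda>z. c) e 0"
  unfolding strict_quotient_def by simp

lemma strict_quotient_cmult:
  fixes f :: "'a::real_normed_vector \<Rightarrow> real"
  assumes "strict_quotient f e l" shows "strict_quotient (\<lambda>z. c * f z) e (c * l)"
  unfolding strict_quotient_def
proof (intro allI impI)
  fix t :: "nat \<Rightarrow> real" and x :: "nat \<Rightarrow> 'a" assume *: "\<forall>n. 0 < t n" "t \<longlonglongrightarrow> 0" "x \<longlonglongrightarrow> 0"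
  have "(\<lambda>n. c * ((f (x n + t n *\<^sub>R e) - f (x n)) / t n)) \<longlonglongrightarrow> c * l"
    using * by (intro tendsto_intros strict_quotientD[OF assms]) auto
  then show "(\<lambda>n. (c * f (x n + t n *\<^sub>R e) - c * f (x n)) / t n) \<longlonglongrightarrow> c * l"
    by (simp add: algebra_simps)
qed

lemma strict_quotient_add:
  fixes f g :: "'a::real_normed_vector \<Rightarrow> real"
  assumes "strict_quotient f e l" "strict_quotient g e m"
  shows "strict_quotient (\<lambda>z. f z + g z) e (l + m)"
  unfolding strict_quotient_def
proof (intro allI impI)
  fix t :: "nat \<Rightarrow> real" and x :: "nat \<Rightarrow> 'a" assume *: "\<forall>n. 0 < t n" "t \<longlonglongrightarrow> 0" "x \<longlonglongrightarrow> 0"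
  have "(\<lambda>n. (f (x n + t n *\<^sub>R e) - f (x n)) / t n + (g (x n + t n *\<^sub>R e) - g (x n)) / t n) \<longlonglongrightarrow> l + m"
    using * by (intro tendsto_add strict_quotientD[OF assms(1)] strict_quotientD[OF assms(2)]) auto
  then show "(\<lambda>n. (f (x n + t n *\<^sub>R e) + g (x n + t n *\<^sub>R e) - (f (x n) + g (x n))) / t n) \<longlonglongrightarrow> l + m"
    by (simp add: field_simps add_divide_distrib diff_divide_distrib)
qed

lemma strict_quotient_mult:
  fixes f g :: "'a::real_normed_vector \<Rightarrow> real"
  assumes "strict_quotient f e l" "strict_quotient g e m" "isCont f 0" "isCont g 0"
  shows "strict_quotient (\<lambda>z. f z * g z) e (f 0 * m + l * g 0)"
  unfolding strict_quotient_def
proof (intro allI impI)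
  fix t :: "nat \<Rightarrow> real" and x :: "nat \<Rightarrow> 'a" assume *: "\<forall>n. 0 < t n" "t \<longlonglongrightarrow> 0" "x \<longlonglongrightarrow> 0"
  have lim: "(\<lambda>n. f (x n + t n *\<^sub>R e) * ((g (x n + t n *\<^sub>R e) - g (x n)) / t n)
      + (f (x n + t n *\<^sub>R e) - f (x n)) / t n * g (x n)) \<longlonglongrightarrow> f 0 * m + l * g 0"
    using tendsto_add[OF
        tendsto_mult[OF shifted_tendsto(1)[OF assms(3) *(2,3)] strict_quotientD[OF assms(2) *(1)[rule_format] *(2,3)]]
        tendsto_mult[OF strict_quotientD[OF assms(1) *(1)[rule_format] *(2,3)] shifted_tendsto(2)[OF assms(4) *(2,3)]]] .
  have eq: "f (x n + t n *\<^sub>R e) * ((g (x n + t n *\<^sub>R e) - g (x n)) / t n)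
      + (f (x n + t n *\<^sub>R e) - f (x n)) / t n * g (x n)
      = (f (x n + t n *\<^sub>R e) * g (x n + t n *\<^sub>R e) - f (x n) * g (x n)) / t n" for n
    using *(1)[rule_format, of n] by (simp add: field_simps)
  from lim show "(\<lambda>n. (f (x n + t n *\<^sub>R e) * g (x n + t n *\<^sub>R e) - f (x n) * g (x n)) / t n) \<longlonglongrightarrow> f 0 * m + l * g 0"
    by (simp only: eq)
qed

text \<open>The set \<open>Y\<close> is needed for functions such as \<open>\<H>\<close> on a closed interval, which are evaluated up
  to the end point.\<close>

definition strict_deriv :: "(real \<Rightarrow> real) \<Rightarrow> real \<Rightarrow> real \<Rightarrow> real set \<Rightarrow> bool" where
  "strict_deriv g D y Y \<longleftrightarrow> (\<forall>\<epsilon>>0. \<exists>d>0. \<forall>a\<in>Y. \<forall>b\<in>Y. \<bar>a - y\<bar> < d \<longrightarrow> \<bar>b - y\<bar> < d \<longrightarrow>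
     \<bar>g b - g a - D * (b - a)\<bar> \<le> \<epsilon> * \<bar>b - a\<bar>)"

lemma C1_strict_deriv:
  fixes g :: "real \<Rightarrow> real"
  assumes I: "is_interval I" "y \<in> I" and g: "\<And>s. s \<in> I \<Longrightarrow> (g has_real_derivative g' s) (at s within I)"
    and c: "continuous_on I g'"
  shows "strict_deriv g (g' y) y I"
  unfolding strict_deriv_def
proof (intro allI impI)
  fix \<epsilon> :: real assume "\<epsilon> > 0"
  obtain d where d: "d > 0" "\<And>s. s \<in> I \<Longrightarrow> dist s y < d \<Longrightarrow> dist (g' s) (g' y) < \<epsilon>"
    using c \<open>\<epsilon> > 0\<close> I(2) unfolding continuous_on_iff by blast
  have lip: "\<bar>g b - g a - g' y * (b - a)\<bar> \<le> \<epsilon> * \<bar>b - a\<bar>"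
    if ab: "a \<in> I" "b \<in> I" "\<bar>a - y\<bar> < d" "\<bar>b - y\<bar> < d" "a < b" for a b
  proof -
    have sub: "s \<in> I" if "a \<le> s" "s \<le> b" for s
      using I(1) ab that unfolding is_interval_1 by blast
    have "\<exists>s\<in>{a<..<b}. (\<lambda>s. g s - g' y * s) b - (\<lambda>s. g s - g' y * s) a = (g' s - g' y) * (b - a)"
    proof -
      have D: "((\<lambda>s. g s - g' y * s) has_derivative (\<lambda>h. (g' s - g' y) * h)) (at s within {a..b})" if "a \<le> s" "s \<le> b" for s
      proof -
        have "(g has_real_derivative g' s) (at s within {a..b})"
          using g[OF sub[OF that]] by (rule has_field_derivative_subset) (use sub in auto)
        then have "((\<lambda>s. g s - g' y * s) has_real_derivative (g' s - g' y * 1)) (at s within {a..b})"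
          by (intro DERIV_diff DERIV_cmult DERIV_ident)
        then show ?thesis by (simp add: has_field_derivative_def)
      qed
      show ?thesis
        using mvt_simple[OF ab(5), of "\<lambda>s. g s - g' y * s" "\<lambda>s h. (g' s - g' y) * h"] D by auto
    qed
    then obtain s where s: "a < s" "s < b" "g b - g a - g' y * (b - a) = (g' s - g' y) * (b - a)"
      by (auto simp: algebra_simps)
    have "\<bar>s - y\<bar> < d" using s ab by linarith
    then have "\<bar>g' s - g' y\<bar> \<le> \<epsilon>" using d(2)[of s] sub[of s] s by (auto simp: dist_real_def)
    then show ?thesis unfolding s(3) abs_mult by (rule mult_right_mono) simp
  qed
  show "\<exists>d>0. \<forall>a\<in>I. \<forall>b\<in>I. \<bar>a - y\<bar> < d \<longrightarrow> \<bar>b - y\<bar> < d \<longrightarrow> \<bar>g b - g a - g' y * (b - a)\<bar> \<le> \<epsilon> * \<bar>b - a\<bar>"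
  proof (rule exI[of _ d], intro conjI ballI impI d(1))
    fix a b assume ab: "a \<in> I" "b \<in> I" "\<bar>a - y\<bar> < d" "\<bar>b - y\<bar> < d"
    consider "a < b" | "a = b" | "b < a" by linarith
    then show "\<bar>g b - g a - g' y * (b - a)\<bar> \<le> \<epsilon> * \<bar>b - a\<bar>"
    proof cases
      case 3
      have "g b - g a - g' y * (b - a) = - (g a - g b - g' y * (a - b))" by (simp add: algebra_simps)
      then show ?thesis using lip[of b a] 3 ab by (simp only: abs_minus_cancel abs_minus_commute[of b a])
    qed (use lip ab in auto)
  qed
qed

lemma strict_quotient_compose:
  fixes f :: "'a::real_normed_vector \<Rightarrow> real"
  assumes f: "strict_quotient f e l" "isCont f 0" "\<And>z. f z \<in> Y" and g: "strict_deriv g D (f 0) Y"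
  shows "strict_quotient (\<lambda>z. g (f z)) e (D * l)"
  unfolding strict_quotient_def
proof (intro allI impI)
  fix t :: "nat \<Rightarrow> real" and x :: "nat \<Rightarrow> 'a" assume *: "\<forall>n. 0 < t n" "t \<longlonglongrightarrow> 0" "x \<longlonglongrightarrow> 0"
  define b where "b n = f (x n + t n *\<^sub>R e)" for n
  define a where "a n = f (x n)" for n
  have q: "(\<lambda>n. (b n - a n) / t n) \<longlonglongrightarrow> l"
    unfolding a_def b_def using * by (intro strict_quotientD[OF f(1)]) auto
  have ba: "b \<longlonglongrightarrow> f 0" "a \<longlonglongrightarrow> f 0"
    unfolding a_def b_def using shifted_tendsto[OF f(2) *(2,3)] by auto
  have "(\<lambda>n. (g (b n) - g (a n)) / t n - D * ((b n - a n) / t n)) \<longlonglongrightarrow> 0"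
  proof (rule tendstoI)
    fix \<epsilon> :: real assume "\<epsilon> > 0"
    \<comment> \<open>the increments \<open>(b - a) / t\<close> are eventually bounded by \<open>|l| + 1\<close>\<close>
    define \<epsilon>' where "\<epsilon>' = \<epsilon> / (\<bar>l\<bar> + 1)"
    have "\<epsilon>' > 0" using \<open>\<epsilon> > 0\<close> by (simp add: \<epsilon>'_def add_nonneg_pos)
    then obtain d where d: "d > 0" "\<And>a b. a \<in> Y \<Longrightarrow> b \<in> Y \<Longrightarrow> \<bar>a - f 0\<bar> < d \<Longrightarrow> \<bar>b - f 0\<bar> < d \<Longrightarrow>
        \<bar>g b - g a - D * (b - a)\<bar> \<le> \<epsilon>' * \<bar>b - a\<bar>"
      using g unfolding strict_deriv_def by meson
    have "\<forall>\<^sub>F n in sequentially. dist (b n) (f 0) < d" "\<forall>\<^sub>F n in sequentially. dist (a n) (f 0) < d"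
      using ba d(1) tendstoD by blast+
    moreover have "\<forall>\<^sub>F n in sequentially. dist ((b n - a n) / t n) l < 1"
      using q by (rule tendstoD) simp
    ultimately show "\<forall>\<^sub>F n in sequentially. dist ((g (b n) - g (a n)) / t n - D * ((b n - a n) / t n)) 0 < \<epsilon>"
    proof eventually_elim
      case (elim n)
      have tn: "0 < t n" using * by auto
      have "(g (b n) - g (a n)) / t n - D * ((b n - a n) / t n) = (g (b n) - g (a n) - D * (b n - a n)) / t n"
        using tn by (simp add: field_simps)
      then have "\<bar>(g (b n) - g (a n)) / t n - D * ((b n - a n) / t n)\<bar> = \<bar>g (b n) - g (a n) - D * (b n - a n)\<bar> / t n"
        using tn by simp
      also have "\<dots> \<le> \<epsilon>' * \<bar>b n - a n\<bar> / t n"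
        by (rule divide_right_mono[OF d(2)]) (use f(3) elim tn in \<open>auto simp: a_def b_def dist_real_def\<close>)
      also have "\<dots> = \<epsilon>' * \<bar>(b n - a n) / t n\<bar>" using tn by simp
      also have "\<dots> < \<epsilon>' * (\<bar>l\<bar> + 1)"
        using elim(3) \<open>\<epsilon>' > 0\<close> by (intro mult_strict_left_mono) (auto simp: dist_real_def)
      also have "\<dots> = \<epsilon>" by (simp add: \<epsilon>'_def add_nonneg_pos)
      finally show ?case by simp
    qed
  qed
  from tendsto_add[OF this tendsto_mult[OF tendsto_const[of D] q]]
  show "(\<lambda>n. (g (f (x n + t n *\<^sub>R e)) - g (f (x n))) / t n) \<longlonglongrightarrow> D * l"
    by (simp add: a_def b_def)
qed

section \<open>Gradient bounds from differenced equations\<close>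

lemma has_grad_eq: "has_grad f p q z \<Longrightarrow> p = p' \<Longrightarrow> q = q' \<Longrightarrow> has_grad f p' q' z"
  by simp

lemma has_grad_add: "has_grad f p q z \<Longrightarrow> has_grad g p' q' z \<Longrightarrow> has_grad (\<lambda>z. f z + g z) (p + p') (q + q') z"
  unfolding has_grad_def by (drule (1) has_derivative_add) (simp add: algebra_simps)

lemma has_grad_diff: "has_grad f p q z \<Longrightarrow> has_grad g p' q' z \<Longrightarrow> has_grad (\<lambda>z. f z - g z) (p - p') (q - q') z"
  unfolding has_grad_def by (drule (1) has_derivative_diff) (simp add: algebra_simps)

lemma has_grad_mult: "has_grad f p q z \<Longrightarrow> has_grad g p' q' z \<Longrightarrow>
    has_grad (\<lambda>z. f z * g z) (f z * p' + p * g z) (f z * q' + q * g z) z"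
  unfolding has_grad_def by (drule (1) has_derivative_mult) (simp add: algebra_simps)

lemma has_grad_cmult: "has_grad f p q z \<Longrightarrow> has_grad (\<lambda>z. c * f z) (c * p) (c * q) z"
  unfolding has_grad_def by (drule has_derivative_mult_right[of _ _ _ c]) (simp add: algebra_simps)

lemma has_grad_chain:
  assumes "has_grad f p q z" "(h has_real_derivative D) (at (f z))"
  shows "has_grad (\<lambda>z. h (f z)) (D * p) (D * q) z"
  using has_derivative_compose[OF assms(1)[unfolded has_grad_def] assms(2)[unfolded has_field_derivative_def]]
  unfolding has_grad_def by (simp add: algebra_simps)

lemma has_grad_snd: "has_grad snd 0 1 z"
  unfolding has_grad_def by (auto intro!: derivative_eq_intros)

lemma has_grad_isCont: "has_grad f p q z \<Longrightarrow> isCont f z"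
  unfolding has_grad_def by (rule has_derivative_continuous)

definition quotient :: "real \<Rightarrow> real \<times> real \<Rightarrow> (real \<times> real \<Rightarrow> real) \<Rightarrow> real \<times> real \<Rightarrow> real" where
  "quotient t e f z = (f (z + t *\<^sub>R e) - f z) / t"

lemma has_grad_quotient:
  assumes "has_grad f (f1 z) (f2 z) z" "has_grad f (f1 (z + t *\<^sub>R e)) (f2 (z + t *\<^sub>R e)) (z + t *\<^sub>R e)"
  shows "has_grad (quotient t e f) (quotient t e f1 z) (quotient t e f2 z) z"
proof -
  have "((\<lambda>z. z + t *\<^sub>R e) has_derivative (\<lambda>h. h)) (at z)"
    by (auto intro!: derivative_eq_intros)
  from has_derivative_compose[OF this assms(2)[unfolded has_grad_def]]
  have "has_grad (\<lambda>z. f (z + t *\<^sub>R e)) (f1 (z + t *\<^sub>R e)) (f2 (z + t *\<^sub>R e)) z"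
    unfolding has_grad_def by simp
  from has_grad_cmult[OF has_grad_diff[OF this assms(1)], of "1 / t"]
  show ?thesis by (simp add: quotient_def[abs_def])
qed

lemma has_hessian_quotient:
  assumes "has_hessian u u1 u2 u11 u12 u22 V" "W \<subseteq> V" "\<And>z. z \<in> W \<Longrightarrow> z + t *\<^sub>R e \<in> V"
  shows "has_hessian (quotient t e u) (quotient t e u1) (quotient t e u2)
    (quotient t e u11) (quotient t e u12) (quotient t e u22) W"
  using assms unfolding has_hessian_def by (auto intro!: has_grad_quotient)

lemma quotient_limit:
  assumes "has_hessian u u1 u2 u11 u12 u22 (ball 0 R)" "a \<in> ball 0 R"
    and t: "\<And>n. 0 < t n" "t \<longlonglongrightarrow> 0" "x \<longlonglongrightarrow> a"
  shows "(\<lambda>n. quotient (t n) (1, 0) u (x n)) \<longlonglongrightarrow> u1 a"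
    and "(\<lambda>n. quotient (t n) (0, 1) u (x n)) \<longlonglongrightarrow> u2 a"
proof -
  have g: "\<And>z. z \<in> ball 0 R \<Longrightarrow> (u has_derivative (\<lambda>h. u1 z * fst h + u2 z * snd h)) (at z)"
    using assms(1) unfolding has_hessian_def has_grad_def by blast
  have c: "isCont u1 a" "isCont u2 a"
    using assms(1,2) unfolding has_hessian_def by (blast intro: has_grad_isCont)+
  show "(\<lambda>n. quotient (t n) (1, 0) u (x n)) \<longlonglongrightarrow> u1 a"
    using quotient_tendsto[where V = "ball 0 R" and f = u and e = "(1, 0)" and a = a
        and f' = "\<lambda>z h. u1 z * fst h + u2 z * snd h", OF open_ball assms(2) g _ t] c
    by (simp add: quotient_def)
  show "(\<lambda>n. quotient (t n) (0, 1) u (x n)) \<longlonglongrightarrow> u2 a"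
    using quotient_tendsto[where V = "ball 0 R" and f = u and e = "(0, 1)" and a = a
        and f' = "\<lambda>z h. u1 z * fst h + u2 z * snd h", OF open_ball assms(2) g _ t] c
    by (simp add: quotient_def)
qed

text \<open>Subtract the equation at \<open>x\<close> from the equation at \<open>x + t e\<close>, with the second derivatives of
  \<open>u\<close> taken at the shifted point where they multiply differences of coefficients, and divide by
  \<open>t\<close>.  This plays the part of differentiating the equation once, and uses no third derivative of
  \<open>u\<close>.\<close>

lemma differenced_equation:
  assumes "R > 0" and pde: "\<And>z. z \<in> ball 0 R \<Longrightarrow> A11 z * u11 z + 2 * A12 z * u12 z + A22 z * u22 z + b z = 0"
    and c: "isCont u11 0" "isCont u12 0" "isCont u22 0"
    and q: "strict_quotient A11 e a11" "strict_quotient A12 e a12" "strict_quotient A22 e a22" "strict_quotient b e b'"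
    and t: "\<And>n. 0 < t n" "t \<longlonglongrightarrow> 0" "x \<longlonglongrightarrow> 0"
  shows "(\<lambda>n. A11 (x n) * quotient (t n) e u11 (x n) + 2 * A12 (x n) * quotient (t n) e u12 (x n)
      + A22 (x n) * quotient (t n) e u22 (x n)) \<longlonglongrightarrow> - (a11 * u11 0 + 2 * a12 * u12 0 + a22 * u22 0 + b')"
proof -
  define y where "y n = x n + t n *\<^sub>R e" for n
  have y: "y \<longlonglongrightarrow> 0"
  proof -
    have "(\<lambda>n. x n + t n *\<^sub>R e) \<longlonglongrightarrow> 0 + 0 *\<^sub>R e" by (intro tendsto_intros t)
    then show ?thesis by (simp add: y_def[abs_def])
  qed
  have "\<forall>\<^sub>F n in sequentially. x n \<in> ball 0 R" "\<forall>\<^sub>F n in sequentially. y n \<in> ball 0 R"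
    using \<open>R > 0\<close> topological_tendstoD[OF t(3) open_ball, of 0 R] topological_tendstoD[OF y open_ball, of 0 R]
    by simp_all
  then have ev: "\<forall>\<^sub>F n in sequentially.
      - (quotient (t n) e A11 (x n) * u11 (y n) + 2 * quotient (t n) e A12 (x n) * u12 (y n)
        + quotient (t n) e A22 (x n) * u22 (y n) + quotient (t n) e b (x n))
      = A11 (x n) * quotient (t n) e u11 (x n) + 2 * A12 (x n) * quotient (t n) e u12 (x n)
      + A22 (x n) * quotient (t n) e u22 (x n)"
  proof eventually_elim
    case (elim n)
    have "- ((A11 (y n) - A11 (x n)) * u11 (y n) + 2 * (A12 (y n) - A12 (x n)) * u12 (y n)
        + (A22 (y n) - A22 (x n)) * u22 (y n) + (b (y n) - b (x n)))
      = A11 (x n) * (u11 (y n) - u11 (x n)) + 2 * A12 (x n) * (u12 (y n) - u12 (x n))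
      + A22 (x n) * (u22 (y n) - u22 (x n))"
      using pde[OF elim(1)] pde[OF elim(2)] by (simp add: algebra_simps)
    from arg_cong[OF this, of "\<lambda>s. s * inverse (t n)"]
    show ?case unfolding quotient_def y_def[symmetric] divide_inverse
      by (simp add: algebra_simps)
  qed
  have "(\<lambda>n. - (quotient (t n) e A11 (x n) * u11 (y n) + 2 * quotient (t n) e A12 (x n) * u12 (y n)
        + quotient (t n) e A22 (x n) * u22 (y n) + quotient (t n) e b (x n)))
      \<longlonglongrightarrow> - (a11 * u11 0 + 2 * a12 * u12 0 + a22 * u22 0 + b')"
    unfolding quotient_def
    by (intro tendsto_intros strict_quotientD[OF q(1) t] strict_quotientD[OF q(2) t]
        strict_quotientD[OF q(3) t] strict_quotientD[OF q(4) t]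
        isCont_tendsto_compose[OF c(1) y] isCont_tendsto_compose[OF c(2) y] isCont_tendsto_compose[OF c(3) y])
  then show ?thesis by (rule Lim_transform_eventually) (rule ev)
qed

text \<open>Bernstein's computation for \<open>Z = \<alpha> u\<^sub>1\<^sup>2 + u\<^sub>2\<^sup>2 - T u\<close>.  Let \<open>Z t\<close> be the same expression
  with \<open>u\<^sub>1\<close>, \<open>u\<^sub>2\<close> replaced by difference quotients.  In its contraction with \<open>A\<close>, the second
  derivatives of the first quotient enter through \<open>differenced_equation\<close>, and those of the second
  quotient are multiplied by a factor with limit \<open>u\<^sub>2 0 = 0\<close>, so it suffices that they stay
  bounded.\<close>

lemma gradient_bound_inequality:
  fixes u u1 u2 u11 u12 u22 A11 A12 A22 b :: "real \<times> real \<Rightarrow> real" and \<alpha> \<alpha>1 \<alpha>2 T T1 T2 :: "real \<Rightarrow> real"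
  assumes R: "R > 0" and u: "has_hessian u u1 u2 u11 u12 u22 (ball 0 R)"
    and c: "isCont u11 0" "isCont u12 0" "isCont u22 0"
    and pde: "\<And>z. z \<in> ball 0 R \<Longrightarrow> A11 z * u11 z + 2 * A12 z * u12 z + A22 z * u22 z + b z = 0"
    and A: "\<And>z. z \<in> ball 0 R \<Longrightarrow> A11 z > 0" "\<And>z. z \<in> ball 0 R \<Longrightarrow> A11 z * A22 z - (A12 z)\<^sup>2 > 0"
      "isCont A11 0" "isCont A12 0" "isCont A22 0"
    and q1: "strict_quotient A11 (1, 0) a11" "strict_quotient A12 (1, 0) a12" "strict_quotient A22 (1, 0) a22"
      "strict_quotient b (1, 0) b'"
    and q2: "strict_quotient A11 (0, 1) d11" "strict_quotient A12 (0, 1) d12" "strict_quotient A22 (0, 1) d22"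
      "strict_quotient b (0, 1) d'"
    and \<alpha>: "\<And>r. \<bar>r\<bar> < R \<Longrightarrow> (\<alpha> has_real_derivative \<alpha>1 r) (at r)"
      "\<And>r. \<bar>r\<bar> < R \<Longrightarrow> (\<alpha>1 has_real_derivative \<alpha>2 r) (at r)" "isCont \<alpha>2 0" "\<alpha>1 0 = 0"
    and T: "\<And>z. z \<in> ball 0 R \<Longrightarrow> (T has_real_derivative T1 (u z)) (at (u z))"
      "\<And>z. z \<in> ball 0 R \<Longrightarrow> (T1 has_real_derivative T2 (u z)) (at (u z))" "isCont T2 (u 0)"
    and u2: "u2 0 = 0"
    and max: "\<And>z. z \<in> ball 0 R \<Longrightarrow>
      \<alpha> (snd z) * (u1 z)\<^sup>2 + (u2 z)\<^sup>2 - T (u z) \<le> \<alpha> 0 * (u1 0)\<^sup>2 + (u2 0)\<^sup>2 - T (u 0)"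
  shows "- 2 * \<alpha> 0 * u1 0 * (a11 * u11 0 + 2 * a12 * u12 0 + a22 * u22 0 + b')
    + A11 0 * (2 * \<alpha> 0 * (u11 0)\<^sup>2 + 2 * (u12 0)\<^sup>2 - T2 (u 0) * (u1 0)\<^sup>2 - T1 (u 0) * u11 0)
    + 2 * A12 0 * (2 * \<alpha> 0 * u11 0 * u12 0 + 2 * u12 0 * u22 0 - T1 (u 0) * u12 0)
    + A22 0 * (\<alpha>2 0 * (u1 0)\<^sup>2 + 2 * \<alpha> 0 * (u12 0)\<^sup>2 + 2 * (u22 0)\<^sup>2 - T1 (u 0) * u22 0) \<le> 0"
proof -
  let ?e1 = "(1, 0) :: real \<times> real" and ?e2 = "(0, 1) :: real \<times> real"
  define Z where "Z t z = \<alpha> (snd z) * (quotient t ?e1 u z * quotient t ?e1 u z)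
     + quotient t ?e2 u z * quotient t ?e2 u z - T (u z)" for t z
  define Z1 where "Z1 t z = 2 * (\<alpha> (snd z) * (quotient t ?e1 u z * quotient t ?e1 u1 z)
     + quotient t ?e2 u z * quotient t ?e2 u1 z) - T1 (u z) * u1 z" for t z
  define Z2 where "Z2 t z = \<alpha>1 (snd z) * (quotient t ?e1 u z * quotient t ?e1 u z)
     + 2 * (\<alpha> (snd z) * (quotient t ?e1 u z * quotient t ?e1 u2 z)
     + quotient t ?e2 u z * quotient t ?e2 u2 z) - T1 (u z) * u2 z" for t z
  define Z11 where "Z11 t z = 2 * (\<alpha> (snd z) * (quotient t ?e1 u1 z * quotient t ?e1 u1 z + quotient t ?e1 u z * quotient t ?e1 u11 z)
     + quotient t ?e2 u1 z * quotient t ?e2 u1 z + quotient t ?e2 u z * quotient t ?e2 u11 z)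
     - T2 (u z) * u1 z * u1 z - T1 (u z) * u11 z" for t z
  define Z12 where "Z12 t z = 2 * \<alpha>1 (snd z) * (quotient t ?e1 u z * quotient t ?e1 u1 z)
     + 2 * (\<alpha> (snd z) * (quotient t ?e1 u1 z * quotient t ?e1 u2 z + quotient t ?e1 u z * quotient t ?e1 u12 z)
     + quotient t ?e2 u1 z * quotient t ?e2 u2 z + quotient t ?e2 u z * quotient t ?e2 u12 z)
     - T2 (u z) * u1 z * u2 z - T1 (u z) * u12 z" for t z
  define Z22 where "Z22 t z = \<alpha>2 (snd z) * (quotient t ?e1 u z * quotient t ?e1 u z)
     + 4 * \<alpha>1 (snd z) * (quotient t ?e1 u z * quotient t ?e1 u2 z)
     + 2 * (\<alpha> (snd z) * (quotient t ?e1 u2 z * quotient t ?e1 u2 z + quotient t ?e1 u z * quotient t ?e1 u22 z)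
     + quotient t ?e2 u2 z * quotient t ?e2 u2 z + quotient t ?e2 u z * quotient t ?e2 u22 z)
     - T2 (u z) * u2 z * u2 z - T1 (u z) * u22 z" for t z
  have Rball: "z \<in> ball 0 R" if "z \<in> ball 0 (R / 2)" for z :: "real \<times> real" using that R by auto
  have sR: "\<bar>snd z\<bar> < R" if "z \<in> ball 0 R" for z :: "real \<times> real"
    using that norm_snd_le[of "snd z" "fst z"] by (cases z) auto
  have hess: "has_hessian (Z t) (Z1 t) (Z2 t) (Z11 t) (Z12 t) (Z22 t) (ball 0 (R / 2))" if t: "0 < t" "t < R / 2" for t
    unfolding has_hessian_def
  proof
    fix z :: "real \<times> real" assume z: "z \<in> ball 0 (R / 2)"
    have sh: "has_hessian (quotient t e u) (quotient t e u1) (quotient t e u2)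
        (quotient t e u11) (quotient t e u12) (quotient t e u22) (ball 0 (R / 2))" if "norm e \<le> 1" for e
    proof (rule has_hessian_quotient[OF u])
      fix w :: "real \<times> real" assume "w \<in> ball 0 (R / 2)"
      then have "norm w < R / 2" by simp
      moreover have "norm (t *\<^sub>R e) \<le> t" using that t by (simp add: mult_left_le)
      ultimately have "norm (w + t *\<^sub>R e) < R" using norm_triangle_ineq[of w "t *\<^sub>R e"] t(2) by linarith
      then show "w + t *\<^sub>R e \<in> ball 0 R" by simp
    qed (use Rball in auto)
    have e: "norm ?e1 \<le> 1" "norm ?e2 \<le> 1" by (auto simp: norm_Pair)
    note g1 = sh[OF e(1), unfolded has_hessian_def, rule_format, OF z]
    note g2 = sh[OF e(2), unfolded has_hessian_def, rule_format, OF z]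
    note gu = u[unfolded has_hessian_def, rule_format, OF Rball[OF z]]
    have g\<alpha>: "has_grad (\<lambda>z. \<alpha> (snd z)) (\<alpha>1 (snd z) * 0) (\<alpha>1 (snd z) * 1) z"
      "has_grad (\<lambda>z. \<alpha>1 (snd z)) (\<alpha>2 (snd z) * 0) (\<alpha>2 (snd z) * 1) z"
      using \<alpha>(1,2) sR[OF Rball[OF z]] by (blast intro: has_grad_chain[OF has_grad_snd])+
    have gT: "has_grad (\<lambda>z. T (u z)) (T1 (u z) * u1 z) (T1 (u z) * u2 z) z"
      "has_grad (\<lambda>z. T1 (u z)) (T2 (u z) * u1 z) (T2 (u z) * u2 z) z"
      using T(1,2)[OF Rball[OF z]] gu by (auto intro!: has_grad_chain[where f = u])
    have "has_grad (Z t) (Z1 t z) (Z2 t z) z"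
      unfolding Z_def[abs_def] Z1_def Z2_def
      by (rule has_grad_eq, (rule has_grad_add has_grad_diff has_grad_mult has_grad_cmult
            g\<alpha> gT g1[THEN conjunct1] g2[THEN conjunct1])+) (simp_all add: algebra_simps)
    moreover have "has_grad (Z1 t) (Z11 t z) (Z12 t z) z"
      unfolding Z1_def[abs_def] Z11_def Z12_def
      by (rule has_grad_eq, (rule has_grad_add has_grad_diff has_grad_cmult[where c = 2] has_grad_mult
            g\<alpha> gT g1[THEN conjunct1] g2[THEN conjunct1] gu[THEN conjunct2, THEN conjunct1]
            g1[THEN conjunct2, THEN conjunct1] g2[THEN conjunct2, THEN conjunct1])+) (simp_all add: algebra_simps)
    moreover have "has_grad (Z2 t) (Z12 t z) (Z22 t z) z"
      unfolding Z2_def[abs_def] Z22_def Z12_def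
      by (rule has_grad_eq, (rule has_grad_add has_grad_diff has_grad_cmult[where c = 2] has_grad_mult
            g\<alpha> gT g1[THEN conjunct1] g2[THEN conjunct1] gu[THEN conjunct2, THEN conjunct2]
            g1[THEN conjunct2, THEN conjunct2] g2[THEN conjunct2, THEN conjunct2])+) (simp_all add: algebra_simps)
    ultimately show "has_grad (Z t) (Z1 t z) (Z2 t z) z \<and> has_grad (Z1 t) (Z11 t z) (Z12 t z) z \<and> has_grad (Z2 t) (Z12 t z) (Z22 t z) z"
      by blast
  qed
  define Z0 where "Z0 z = \<alpha> (snd z) * (u1 z * u1 z) + u2 z * u2 z - T (u z)" for z
  have b0: "0 \<in> ball 0 R" using R by simp
  have u0: "has_grad u (u1 0) (u2 0) 0" "has_grad u1 (u11 0) (u12 0) 0" "has_grad u2 (u12 0) (u22 0) 0"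
    using u b0 unfolding has_hessian_def by blast+
  define l1 where "l1 = - (a11 * u11 0 + 2 * a12 * u12 0 + a22 * u22 0 + b')"
  define l2 where "l2 = - (d11 * u11 0 + 2 * d12 * u12 0 + d22 * u22 0 + d')"
  have "2 * \<alpha> 0 * u1 0 * l1 + 2 * u2 0 * l2
    + A11 0 * (2 * (\<alpha> 0 * (u11 0 * u11 0) + u12 0 * u12 0) - T2 (u 0) * u1 0 * u1 0 - T1 (u 0) * u11 0)
    + 2 * A12 0 * (2 * \<alpha>1 0 * (u1 0 * u11 0) + 2 * (\<alpha> 0 * (u11 0 * u12 0) + u12 0 * u22 0)
      - T2 (u 0) * u1 0 * u2 0 - T1 (u 0) * u12 0)
    + A22 0 * (\<alpha>2 0 * (u1 0 * u1 0) + 4 * \<alpha>1 0 * (u1 0 * u12 0) + 2 * (\<alpha> 0 * (u12 0 * u12 0) + u22 0 * u22 0)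
      - T2 (u 0) * u2 0 * u2 0 - T1 (u 0) * u22 0) \<le> 0" (is "?J \<le> 0")
  proof (rule limit_max_principle[where Z = Z and ?Z0.0 = Z0 and R = "R/2" and ?T0.0 = "R/2",
      OF _ _ A(1)[OF Rball] A(2)[OF Rball] A(3) A(5) hess])
 fix t :: "nat \<Rightarrow> real" and x :: "nat \<Rightarrow> real \<times> real" and a assume t: "\<And>n. 0 < t n" "t \<longlonglongrightarrow> 0" "x \<longlonglongrightarrow> a" and a: "a \<in> ball 0 (R / 2)"
    note aR = Rball[OF a]
    have ga: "has_grad u (u1 a) (u2 a) a" using u aR unfolding has_hessian_def by blast
    have "(\<lambda>n. \<alpha> (snd (x n))) \<longlonglongrightarrow> \<alpha> (snd a)"
      by (rule isCont_tendsto_compose[OF DERIV_isCont[OF \<alpha>(1)[OF sR[OF aR]]] tendsto_snd[OF t(3)]])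
    moreover have "(\<lambda>n. T (u (x n))) \<longlonglongrightarrow> T (u a)"
      by (rule isCont_tendsto_compose[OF DERIV_isCont[OF T(1)[OF aR]]])
        (rule isCont_tendsto_compose[OF has_grad_isCont[OF ga] t(3)])
    ultimately show "(\<lambda>n. Z (t n) (x n)) \<longlonglongrightarrow> Z0 a"
      unfolding Z_def Z0_def by (intro tendsto_intros quotient_limit[OF u aR t])
  next
    fix t :: "nat \<Rightarrow> real" and x :: "nat \<Rightarrow> real \<times> real" assume t: "\<And>n. 0 < t n" "t \<longlonglongrightarrow> 0" "x \<longlonglongrightarrow> 0"
    have sq: "strict_quotient u1 (1,0) (u11 0)" "strict_quotient u1 (0,1) (u12 0)"
       "strict_quotient u2 (1,0) (u12 0)" "strict_quotient u2 (0,1) (u22 0)"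
    proof -
      have g1: "\<And>z. z \<in> ball 0 R \<Longrightarrow> (u1 has_derivative (\<lambda>h. u11 z * fst h + u12 z * snd h)) (at z)"
       and g2: "\<And>z. z \<in> ball 0 R \<Longrightarrow> (u2 has_derivative (\<lambda>h. u12 z * fst h + u22 z * snd h)) (at z)"
        using u unfolding has_hessian_def has_grad_def by blast+
      show "strict_quotient u1 (1,0) (u11 0)" "strict_quotient u1 (0,1) (u12 0)"
        by (rule strict_quotientI[OF open_ball b0 g1]; use c in simp)+
      show "strict_quotient u2 (1,0) (u12 0)" "strict_quotient u2 (0,1) (u22 0)"
        by (rule strict_quotientI[OF open_ball b0 g2]; use c in simp)+
    qed
    note lims = quotient_limit[OF u b0 t]
      sq[THEN strict_quotientD, OF t, folded quotient_def]
    have s0: "(\<lambda>n. snd (x n)) \<longlonglongrightarrow> 0" using tendsto_snd[OF t(3)] by simp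
    have cs: "(\<lambda>n. \<alpha> (snd (x n))) \<longlonglongrightarrow> \<alpha> 0" "(\<lambda>n. \<alpha>1 (snd (x n))) \<longlonglongrightarrow> \<alpha>1 0" "(\<lambda>n. \<alpha>2 (snd (x n))) \<longlonglongrightarrow> \<alpha>2 0"
      using \<alpha>(1)[of 0] \<alpha>(2)[of 0] \<alpha>(3) R by (auto intro!: isCont_tendsto_compose[OF _ s0] DERIV_isCont)
    have uc: "(\<lambda>n. u (x n)) \<longlonglongrightarrow> u 0" "(\<lambda>n. u1 (x n)) \<longlonglongrightarrow> u1 0" "(\<lambda>n. u2 (x n)) \<longlonglongrightarrow> u2 0"
      "(\<lambda>n. u11 (x n)) \<longlonglongrightarrow> u11 0" "(\<lambda>n. u12 (x n)) \<longlonglongrightarrow> u12 0" "(\<lambda>n. u22 (x n)) \<longlonglongrightarrow> u22 0"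
      "(\<lambda>n. A11 (x n)) \<longlonglongrightarrow> A11 0" "(\<lambda>n. A12 (x n)) \<longlonglongrightarrow> A12 0" "(\<lambda>n. A22 (x n)) \<longlonglongrightarrow> A22 0"
      using u0 c A(3-5) by (auto intro!: isCont_tendsto_compose[OF _ t(3)] has_grad_isCont)
    have Tc: "(\<lambda>n. T1 (u (x n))) \<longlonglongrightarrow> T1 (u 0)" "(\<lambda>n. T2 (u (x n))) \<longlonglongrightarrow> T2 (u 0)"
      using T(2)[OF b0] T(3) by (auto intro!: isCont_tendsto_compose[OF _ uc(1)] DERIV_isCont)
    note d1 = differenced_equation[OF R pde c q1 t, folded l1_def]
    note d2 = differenced_equation[OF R pde c q2 t, folded l2_def]
    define G1 where "G1 n = A11 (x n) * quotient (t n) ?e1 u11 (x n) + 2 * A12 (x n) * quotient (t n) ?e1 u12 (x n)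
      + A22 (x n) * quotient (t n) ?e1 u22 (x n)" for n
    define G2 where "G2 n = A11 (x n) * quotient (t n) ?e2 u11 (x n) + 2 * A12 (x n) * quotient (t n) ?e2 u12 (x n)
      + A22 (x n) * quotient (t n) ?e2 u22 (x n)" for n
    have G: "G1 \<longlonglongrightarrow> l1" "G2 \<longlonglongrightarrow> l2" using d1 d2 by (simp_all add: G1_def[abs_def] G2_def[abs_def])
    have "(\<lambda>n. 2 * \<alpha> (snd (x n)) * quotient (t n) ?e1 u (x n) * G1 n + 2 * quotient (t n) ?e2 u (x n) * G2 n
    + A11 (x n) * (2 * (\<alpha> (snd (x n)) * (quotient (t n) ?e1 u1 (x n) * quotient (t n) ?e1 u1 (x n)) + quotient (t n) ?e2 u1 (x n) * quotient (t n) ?e2 u1 (x n))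
       - T2 (u (x n)) * u1 (x n) * u1 (x n) - T1 (u (x n)) * u11 (x n))
    + 2 * A12 (x n) * (2 * \<alpha>1 (snd (x n)) * (quotient (t n) ?e1 u (x n) * quotient (t n) ?e1 u1 (x n))
       + 2 * (\<alpha> (snd (x n)) * (quotient (t n) ?e1 u1 (x n) * quotient (t n) ?e1 u2 (x n)) + quotient (t n) ?e2 u1 (x n) * quotient (t n) ?e2 u2 (x n))
      - T2 (u (x n)) * u1 (x n) * u2 (x n) - T1 (u (x n)) * u12 (x n))
    + A22 (x n) * (\<alpha>2 (snd (x n)) * (quotient (t n) ?e1 u (x n) * quotient (t n) ?e1 u (x n)) + 4 * \<alpha>1 (snd (x n)) * (quotient (t n) ?e1 u (x n) * quotient (t n) ?e1 u2 (x n))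
       + 2 * (\<alpha> (snd (x n)) * (quotient (t n) ?e1 u2 (x n) * quotient (t n) ?e1 u2 (x n)) + quotient (t n) ?e2 u2 (x n) * quotient (t n) ?e2 u2 (x n))
      - T2 (u (x n)) * u2 (x n) * u2 (x n) - T1 (u (x n)) * u22 (x n))) \<longlonglongrightarrow> ?J"
      by (intro tendsto_add tendsto_diff tendsto_mult tendsto_const lims cs uc Tc G)
    then show "(\<lambda>n. A11 (x n) * Z11 (t n) (x n) + 2 * A12 (x n) * Z12 (t n) (x n) + A22 (x n) * Z22 (t n) (x n)) \<longlonglongrightarrow> ?J"
      by (rule Lim_transform_eventually)
        (rule always_eventually, rule allI, simp add: Z11_def Z12_def Z22_def G1_def G2_def algebra_simps)
  next
    fix z :: "real \<times> real" assume "z \<in> ball 0 (R / 2)"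
    from max[OF Rball[OF this]] show "Z0 z \<le> Z0 0" by (simp add: Z0_def power2_eq_square)
  qed (use R in auto)
  then show ?thesis by (simp add: \<alpha>(4) u2 l1_def power2_eq_square algebra_simps)
qed

section \<open>The prescribed mean curvature equation in Fermi coordinates\<close>

text \<open>The solutions of \<open>y'' = - \<kappa> y\<close>: the sine and cosine of the geometry of curvature \<open>\<kappa>\<close>.\<close>

definition csk :: "real \<Rightarrow> real \<Rightarrow> real" where
  "csk \<kappa> r = (if \<kappa> = 1 then cos r else cosh r)"

definition snk :: "real \<Rightarrow> real \<Rightarrow> real" where
  "snk \<kappa> r = (if \<kappa> = 1 then sin r else sinh r)"

lemma csk_snk_0 [simp]: "csk \<kappa> 0 = 1" "snk \<kappa> 0 = 0"
  by (auto simp: csk_def snk_def)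

lemma csk_snk_deriv:
  assumes "\<kappa> \<in> {-1, 1}"
  shows "(csk \<kappa> has_real_derivative - \<kappa> * snk \<kappa> r) (at r)" "(snk \<kappa> has_real_derivative csk \<kappa> r) (at r)"
  using assms unfolding csk_def[abs_def] snk_def[abs_def]
  by (auto intro!: derivative_eq_intros)

lemma csk_snk_squares:
  assumes "\<kappa> \<in> {-1, 1}" shows "(csk \<kappa> r)\<^sup>2 + \<kappa> * (snk \<kappa> r)\<^sup>2 = 1"
  using assms cosh_square_eq[of r] by (auto simp: csk_def snk_def)

lemma csk_pos: "\<bar>r\<bar> < 1 \<Longrightarrow> csk \<kappa> r > 0"
  using cos_gt_zero_pi[of r] pi_gt3 by (auto simp: csk_def)

text \<open>Continuity is included so that products and compositions can be handled by one set of rules.\<close>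

definition strict_diff :: "(real \<times> real \<Rightarrow> real) \<Rightarrow> real \<times> real \<Rightarrow> real \<Rightarrow> bool" where
  "strict_diff f e l \<longleftrightarrow> strict_quotient f e l \<and> isCont f 0"

lemma strict_diff_eq: "strict_diff f e l \<Longrightarrow> l = l' \<Longrightarrow> strict_diff f e l'"
  by simp

lemma strict_diff_const: "strict_diff (\<lambda>z. c) e 0"
  by (simp add: strict_diff_def strict_quotient_const)

lemma strict_diff_add:
  "strict_diff f e l \<Longrightarrow> strict_diff g e m \<Longrightarrow> strict_diff (\<lambda>z. f z + g z) e (l + m)"
  by (simp add: strict_diff_def strict_quotient_add)

lemma strict_diff_cmult: "strict_diff f e l \<Longrightarrow> strict_diff (\<lambda>z. c * f z) e (c * l)"
  by (simp add: strict_diff_def strict_quotient_cmult)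

lemma strict_diff_mult:
  "strict_diff f e l \<Longrightarrow> strict_diff g e m \<Longrightarrow> strict_diff (\<lambda>z. f z * g z) e (f 0 * m + l * g 0)"
  by (simp add: strict_diff_def strict_quotient_mult)

lemma strict_diff_compose:
  assumes f: "strict_diff f e l" "\<And>z. f z \<in> Y" and g: "strict_deriv g D (f 0) Y"
  shows "strict_diff (\<lambda>z. g (f z)) e (D * l)"
  unfolding strict_diff_def
proof
  show "strict_quotient (\<lambda>z. g (f z)) e (D * l)"
    using strict_quotient_compose[where f = f and g = g and Y = Y, OF _ _ f(2) g] f(1) by (auto simp: strict_diff_def)
  have fc: "isCont f 0" using f(1) by (simp add: strict_diff_def)
  obtain d where d: "d > 0" "\<And>a b. a \<in> Y \<Longrightarrow> b \<in> Y \<Longrightarrow> \<bar>a - f 0\<bar> < d \<Longrightarrow> \<bar>b - f 0\<bar> < d \<Longrightarrow>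
        \<bar>g b - g a - D * (b - a)\<bar> \<le> 1 * \<bar>b - a\<bar>"
    using g unfolding strict_deriv_def by (meson zero_less_one)
  have "\<forall>\<^sub>F z in at 0. dist (f z) (f 0) < d"
    using fc d(1) unfolding isCont_def by (rule tendstoD)
  then have ev: "\<forall>\<^sub>F z in at 0. dist (g (f z)) (g (f 0)) \<le> (1 + \<bar>D\<bar>) * dist (f z) (f 0)"
  proof eventually_elim
    case (elim z)
    have "\<bar>g (f z) - g (f 0) - D * (f z - f 0)\<bar> \<le> 1 * \<bar>f z - f 0\<bar>"
      by (rule d(2)) (use elim f(2) d(1) in \<open>auto simp: dist_real_def\<close>)
    moreover have "\<bar>g (f z) - g (f 0)\<bar> \<le> \<bar>g (f z) - g (f 0) - D * (f z - f 0)\<bar> + \<bar>D * (f z - f 0)\<bar>" by linarith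
    ultimately have "\<bar>g (f z) - g (f 0)\<bar> \<le> \<bar>f z - f 0\<bar> + \<bar>D\<bar> * \<bar>f z - f 0\<bar>" by (simp add: abs_mult)
    then show ?case by (simp add: dist_real_def algebra_simps)
  qed
  have "((\<lambda>z. (1 + \<bar>D\<bar>) * dist (f z) (f 0)) \<longlongrightarrow> (1 + \<bar>D\<bar>) * dist (f 0) (f 0)) (at 0)"
    using fc unfolding isCont_def by (intro tendsto_intros)
  then have "((\<lambda>z. dist (g (f z)) (g (f 0))) \<longlongrightarrow> 0) (at 0)"
    by (intro tendsto_sandwich[OF always_eventually ev tendsto_const]) simp_all
  then show "isCont (\<lambda>z. g (f z)) 0" unfolding isCont_def by (rule tendsto_dist_iff[THEN iffD2])
qed

lemma strict_diff_grad:
  assumes "R > 0" "\<And>z. z \<in> ball 0 R \<Longrightarrow> has_grad f (f1 z) (f2 z) z" "isCont f1 0" "isCont f2 0"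
  shows "strict_diff f e (f1 0 * fst e + f2 0 * snd e)"
  unfolding strict_diff_def
proof
  show "strict_quotient f e (f1 0 * fst e + f2 0 * snd e)"
    by (rule strict_quotientI[where V = "ball 0 R" and f' = "\<lambda>z h. f1 z * fst h + f2 z * snd h"])
      (use assms in \<open>auto simp: has_grad_def intro!: continuous_intros\<close>)
  show "isCont f 0" using assms(1) assms(2)[of 0] by (auto intro: has_grad_isCont)
qed

lemma strict_diff_snd:
  assumes "R > 0" "\<And>r. \<bar>r\<bar> < R \<Longrightarrow> (f has_real_derivative f1 r) (at r)" "isCont f1 0"
  shows "strict_diff (\<lambda>z. f (snd z)) e (f1 0 * snd e)"
proof -
  have sR: "\<bar>snd z\<bar> < R" if "z \<in> ball 0 R" for z :: "real \<times> real"
    using that norm_snd_le[of "snd z" "fst z"] by (cases z) auto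
  have "strict_diff (\<lambda>z. f (snd z)) e (0 * fst e + f1 (snd (0 :: real \<times> real)) * snd e)"
  proof (rule strict_diff_grad[OF assms(1)])
    show "has_grad (\<lambda>z. f (snd z)) 0 (f1 (snd z)) z" if "z \<in> ball 0 R" for z
      using has_grad_chain[OF has_grad_snd assms(2)[OF sR[OF that]]] by simp
    show "isCont (\<lambda>z. f1 (snd z)) 0"
      using assms(3) by (auto intro!: continuous_at_compose[of 0 snd f1, unfolded o_def] continuous_intros)
  qed simp
  then show ?thesis by simp
qed

text \<open>The square root of \<open>1 + |grad u|\<^sup>2\<close> for the metric \<open>c\<^sup>2 ds\<^sup>2 + dr\<^sup>2\<close>, where \<open>c = csk \<kappa> r\<close>;
  its reciprocal is the angle function of the graph.\<close>

definition graph_W :: "real \<Rightarrow> (real \<times> real \<Rightarrow> real) \<Rightarrow> (real \<times> real \<Rightarrow> real) \<Rightarrow> real \<times> real \<Rightarrow> real" where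
  "graph_W \<kappa> u1 u2 z = sqrt (1 + (u1 z)\<^sup>2 / (csk \<kappa> (snd z))\<^sup>2 + (u2 z)\<^sup>2)"

text \<open>Expanding \<open>div (grad u / W) = 2 \<H> (1 / W)\<close> for the metric \<open>c\<^sup>2 ds\<^sup>2 + dr\<^sup>2\<close> and multiplying
  by \<open>c\<^sup>2 W\<^sup>3\<close> gives the equation below.  The radius is at most \<open>1\<close> so that \<open>c\<close> is positive.\<close>

definition H_graph :: "real \<Rightarrow> (real \<Rightarrow> real) \<Rightarrow> real \<Rightarrow> (real \<times> real \<Rightarrow> real) \<Rightarrow> (real \<times> real \<Rightarrow> real) \<Rightarrow> (real \<times> real \<Rightarrow> real) \<Rightarrow>
    (real \<times> real \<Rightarrow> real) \<Rightarrow> (real \<times> real \<Rightarrow> real) \<Rightarrow> (real \<times> real \<Rightarrow> real) \<Rightarrow> bool" where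
  "H_graph \<kappa> \<H> R u u1 u2 u11 u12 u22 \<longleftrightarrow> 0 < R \<and> R \<le> 1 \<and> has_hessian u u1 u2 u11 u12 u22 (ball 0 R) \<and>
    isCont u11 0 \<and> isCont u12 0 \<and> isCont u22 0 \<and>
    (\<forall>z\<in>ball 0 R. ((csk \<kappa> (snd z))\<^sup>2 + (u1 z)\<^sup>2) * u22 z
       - 2 * u1 z * u2 z * (u12 z + \<kappa> * u1 z * snk \<kappa> (snd z) / csk \<kappa> (snd z))
       + (1 + (u2 z)\<^sup>2) * (u11 z - \<kappa> * u2 z * csk \<kappa> (snd z) * snk \<kappa> (snd z))
     = 2 * (csk \<kappa> (snd z))\<^sup>2 * graph_W \<kappa> u1 u2 z ^ 3 * \<H> (1 / graph_W \<kappa> u1 u2 z))"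

lemma graph_W_ge_1: "graph_W \<kappa> u1 u2 z \<ge> 1"
  unfolding graph_W_def by (simp add: add_nonneg_nonneg)

lemma H_graph_equation:
  assumes "H_graph \<kappa> \<H> R u u1 u2 u11 u12 u22" "z \<in> ball 0 R"
  shows "((csk \<kappa> (snd z))\<^sup>2 + (u1 z)\<^sup>2) * u22 z
       - 2 * u1 z * u2 z * (u12 z + \<kappa> * u1 z * snk \<kappa> (snd z) / csk \<kappa> (snd z))
       + (1 + (u2 z)\<^sup>2) * (u11 z - \<kappa> * u2 z * csk \<kappa> (snd z) * snk \<kappa> (snd z))
     = 2 * (csk \<kappa> (snd z))\<^sup>2 * graph_W \<kappa> u1 u2 z ^ 3 * \<H> (1 / graph_W \<kappa> u1 u2 z)"
  using assms unfolding H_graph_def by blast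

lemma H_graph_no_interior_max:
  assumes G: "H_graph \<kappa> \<H> R u u1 u2 u11 u12 u22" and "\<H> 1 > 0"
    and max: "\<And>z. z \<in> ball 0 R \<Longrightarrow> u z \<le> u 0"
  shows False
proof -
  have R: "0 \<in> ball (0 :: real \<times> real) R" using G by (simp add: H_graph_def)
  have h: "has_hessian u u1 u2 u11 u12 u22 (ball 0 R)" using G by (simp add: H_graph_def)
  have gr: "has_grad u (u1 0) (u2 0) 0" using h R by (auto simp: has_hessian_def)
  have crit: "u1 0 = 0" "u2 0 = 0" using local_max_critical[OF gr open_ball R max] by auto
  have "u11 0 \<le> 0" using local_max_hessian[OF h open_ball R max, of 1 0] by simp
  moreover have "u22 0 \<le> 0" using local_max_hessian[OF h open_ball R max, of 0 1] by simp
  moreover have "u22 0 + u11 0 = 2 * \<H> 1"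
  proof -
    have "0 \<in> ball (0 :: real \<times> real) R" by (rule R)
    from H_graph_equation[OF G this] show ?thesis by (simp add: crit graph_W_def)
  qed
  ultimately show False using assms(2) by linarith
qed

text \<open>The coefficients of the equation depend on \<open>u\<close> only through its gradient and are strictly
  differentiable since \<open>u\<close> is of class \<open>C\<^sup>2\<close>.  At the origin \<open>u\<^sub>2\<close> and the derivative of \<open>csk \<kappa>\<close>
  vanish, which leaves few terms.\<close>

lemma H_graph_strict_diff:
  assumes \<kappa>: "\<kappa> \<in> {-1, 1}" and G: "H_graph \<kappa> \<H> R u u1 u2 u11 u12 u22" and q0: "u2 0 = 0"
    and H: "\<And>y. y \<in> {-1..1} \<Longrightarrow> (\<H> has_real_derivative \<H>' y) (at y within {-1..1})"
      "continuous_on {-1..1} \<H>'"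
    and w: "w = graph_W \<kappa> u1 u2 0"
  defines "b \<equiv> \<lambda>z. - 2 * (\<kappa> * ((u1 z * u1 z) * (u2 z * (snk \<kappa> (snd z) / csk \<kappa> (snd z)))))
      + ((- \<kappa>) * ((1 + u2 z * u2 z) * (u2 z * (csk \<kappa> (snd z) * snk \<kappa> (snd z))))
      + (- 2) * ((csk \<kappa> (snd z))\<^sup>2 * (graph_W \<kappa> u1 u2 z * (graph_W \<kappa> u1 u2 z * (graph_W \<kappa> u1 u2 z
            * \<H> (inverse (graph_W \<kappa> u1 u2 z)))))))"
    and "d1 \<equiv> \<lambda>e. u11 0 * fst e + u12 0 * snd e"
    and "d2 \<equiv> \<lambda>e. u12 0 * fst e + u22 0 * snd e"
  shows "strict_diff (\<lambda>z. 1 + u2 z * u2 z) e 0"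
    and "strict_diff (\<lambda>z. (- 1) * (u1 z * u2 z)) e (- u1 0 * d2 e)"
    and "strict_diff (\<lambda>z. (csk \<kappa> (snd z))\<^sup>2 + u1 z * u1 z) e (2 * u1 0 * d1 e)"
    and "strict_diff b e (- 2 * (3 * w * u1 0 * d1 e * \<H> (1 / w) - u1 0 * d1 e * \<H>' (1 / w)))"
proof -
  have R: "0 < R" "R \<le> 1" and h: "has_hessian u u1 u2 u11 u12 u22 (ball 0 R)"
    and c: "isCont u11 0" "isCont u12 0" "isCont u22 0"
    using G by (auto simp: H_graph_def)
  have g: "\<And>z. z \<in> ball 0 R \<Longrightarrow> has_grad u1 (u11 z) (u12 z) z" "\<And>z. z \<in> ball 0 R \<Longrightarrow> has_grad u2 (u12 z) (u22 z) z"
    using h unfolding has_hessian_def by auto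
  have s1: "strict_diff u1 e (d1 e)" unfolding d1_def by (rule strict_diff_grad[OF R(1) g(1) c(1,2)])
  have s2: "strict_diff u2 e (d2 e)" unfolding d2_def by (rule strict_diff_grad[OF R(1) g(2) c(2,3)])
  note D = csk_snk_deriv[OF \<kappa>]
  note [derivative_intros] = D[THEN DERIV_chain2]
  have cp: "csk \<kappa> r \<noteq> 0" if "\<bar>r\<bar> < 1" for r using csk_pos[OF that, of \<kappa>] by simp
  have cc: "isCont (csk \<kappa>) 0" "isCont (snk \<kappa>) 0" using D by (auto intro: DERIV_isCont)
  have k1: "strict_diff (\<lambda>z. snk \<kappa> (snd z) / csk \<kappa> (snd z)) e
      ((csk \<kappa> 0 * csk \<kappa> 0 - snk \<kappa> 0 * (- \<kappa> * snk \<kappa> 0)) / (csk \<kappa> 0 * csk \<kappa> 0) * snd e)"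
  proof (rule strict_diff_snd[where R = 1])
    show "((\<lambda>r. snk \<kappa> r / csk \<kappa> r) has_real_derivative
        (csk \<kappa> r * csk \<kappa> r - snk \<kappa> r * (- \<kappa> * snk \<kappa> r)) / (csk \<kappa> r * csk \<kappa> r)) (at r)" if "\<bar>r\<bar> < 1" for r
      by (rule DERIV_divide[OF D(2) D(1) cp[OF that]])
  qed (use cc in \<open>auto intro!: continuous_intros\<close>)
  have k2: "strict_diff (\<lambda>z. csk \<kappa> (snd z) * snk \<kappa> (snd z)) e
      ((- \<kappa> * snk \<kappa> 0 * snk \<kappa> 0 + csk \<kappa> 0 * csk \<kappa> 0) * snd e)"
    by (rule strict_diff_snd[where R = 1])
      (use D cc in \<open>auto intro!: derivative_eq_intros continuous_intros\<close>)
  have k3: "strict_diff (\<lambda>z. (csk \<kappa> (snd z))\<^sup>2) e (2 * csk \<kappa> 0 * (- \<kappa> * snk \<kappa> 0) * snd e)"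
    by (rule strict_diff_snd[where R = 1])
      (use D cc in \<open>auto intro!: derivative_eq_intros continuous_intros\<close>)
  have k4: "strict_diff (\<lambda>z. 1 / (csk \<kappa> (snd z))\<^sup>2) e
     ((0 * (csk \<kappa> 0)\<^sup>2 - 1 * (2 * csk \<kappa> 0 * (- \<kappa> * snk \<kappa> 0))) / ((csk \<kappa> 0)\<^sup>2 * (csk \<kappa> 0)\<^sup>2) * snd e)"
  proof (rule strict_diff_snd[where R = 1 and ?f1.0 = "\<lambda>r. (0 * (csk \<kappa> r)\<^sup>2 - 1 * (2 * csk \<kappa> r * (- \<kappa> * snk \<kappa> r))) / ((csk \<kappa> r)\<^sup>2 * (csk \<kappa> r)\<^sup>2)"])
    have "((\<lambda>r. (csk \<kappa> r)\<^sup>2) has_real_derivative 2 * csk \<kappa> r * (- \<kappa> * snk \<kappa> r)) (at r)" for r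
      using D by (auto intro!: derivative_eq_intros)
    then show "((\<lambda>r. 1 / (csk \<kappa> r)\<^sup>2) has_real_derivative
        (0 * (csk \<kappa> r)\<^sup>2 - 1 * (2 * csk \<kappa> r * (- \<kappa> * snk \<kappa> r))) / ((csk \<kappa> r)\<^sup>2 * (csk \<kappa> r)\<^sup>2)) (at r)" if "\<bar>r\<bar> < 1" for r
      using cp[OF that] by (intro DERIV_divide) auto
  qed (use cc in \<open>auto intro!: continuous_intros\<close>)
  show "strict_diff (\<lambda>z. 1 + u2 z * u2 z) e 0"
    by (rule strict_diff_eq, (rule strict_diff_add strict_diff_const strict_diff_mult s2)+) (simp add: q0)
  then have k5: "strict_diff (\<lambda>z. 1 + u2 z * u2 z) e 0" .
  show "strict_diff (\<lambda>z. (- 1) * (u1 z * u2 z)) e (- u1 0 * d2 e)"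
    by (rule strict_diff_eq, (rule strict_diff_cmult strict_diff_mult s1 s2)+) (simp add: q0)
  show "strict_diff (\<lambda>z. (csk \<kappa> (snd z))\<^sup>2 + u1 z * u1 z) e (2 * u1 0 * d1 e)"
    by (rule strict_diff_eq, (rule strict_diff_add k3 strict_diff_mult s1)+) simp
  have w1: "w \<ge> 1" using graph_W_ge_1 w by simp
  have w2: "w\<^sup>2 = 1 + (u1 0)\<^sup>2" using w by (simp add: graph_W_def q0 add_nonneg_nonneg)
  define S where "S z = (1 + u2 z * u2 z) + (u1 z * u1 z) * (1 / (csk \<kappa> (snd z))\<^sup>2)" for z
  have S0: "S 0 = w\<^sup>2" unfolding w2 by (simp add: S_def q0 power2_eq_square)
  have SW: "graph_W \<kappa> u1 u2 z = sqrt (S z)" for z by (simp add: graph_W_def S_def power2_eq_square)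
  have SWf: "graph_W \<kappa> u1 u2 = (\<lambda>z. sqrt (S z))" by (rule ext) (rule SW)
  have Spos: "S z \<in> {0<..}" for z by (simp add: S_def add_pos_nonneg)
  have sS: "strict_diff S e (2 * u1 0 * d1 e)"
    unfolding S_def[abs_def] by (rule strict_diff_eq, (rule strict_diff_add[OF k5] strict_diff_mult s1 k4)+) simp
  have "strict_deriv sqrt (inverse (sqrt (S 0)) / 2) (S 0) {0<..}"
    by (rule C1_strict_deriv) (use Spos[of 0] in \<open>auto intro!: DERIV_subset[OF DERIV_real_sqrt] continuous_intros\<close>)
  from strict_diff_compose[OF sS Spos this]
  have "strict_diff (graph_W \<kappa> u1 u2) e (inverse (sqrt (S 0)) / 2 * (2 * u1 0 * d1 e))"
    unfolding SWf .
  then have sW: "strict_diff (graph_W \<kappa> u1 u2) e (u1 0 * d1 e / w)"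
  proof (rule strict_diff_eq)
    have "sqrt (S 0) = w" "w \<noteq> 0" using w1 by (auto simp: S0)
    then show "inverse (sqrt (S 0)) / 2 * (2 * u1 0 * d1 e) = u1 0 * d1 e / w" by (simp add: field_simps)
  qed
  have Wpos: "graph_W \<kappa> u1 u2 z \<in> {0<..}" for z using graph_W_ge_1[of \<kappa> u1 u2 z] by simp
  have "strict_deriv inverse (- (inverse (graph_W \<kappa> u1 u2 0) ^ Suc (Suc 0))) (graph_W \<kappa> u1 u2 0) {0<..}"
    by (rule C1_strict_deriv) (use Wpos[of 0] in \<open>auto intro!: has_field_derivative_at_within[OF DERIV_inverse[unfolded numeral_2_eq_2]] continuous_intros simp del: power_Suc\<close>)
  from strict_diff_compose[OF sW Wpos this]
  have sI: "strict_diff (\<lambda>z. inverse (graph_W \<kappa> u1 u2 z)) e (- (inverse w ^ Suc (Suc 0)) * (u1 0 * d1 e / w))"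
    by (simp add: w)
  have Ipos: "inverse (graph_W \<kappa> u1 u2 z) \<in> {-1..1}" for z
    using graph_W_ge_1[of \<kappa> u1 u2 z] by (simp add: inverse_eq_divide) (smt (verit) divide_nonneg_nonneg)
  have "strict_deriv \<H> (\<H>' (inverse (graph_W \<kappa> u1 u2 0))) (inverse (graph_W \<kappa> u1 u2 0)) {-1..1}"
    by (rule C1_strict_deriv[OF _ Ipos H]) (auto simp: is_interval_cc)
  from strict_diff_compose[OF sI Ipos this]
  have sH: "strict_diff (\<lambda>z. \<H> (inverse (graph_W \<kappa> u1 u2 z))) e
     (\<H>' (inverse w) * (- (inverse w ^ Suc (Suc 0)) * (u1 0 * d1 e / w)))"
    by (simp add: w)
  show "strict_diff b e (- 2 * (3 * w * u1 0 * d1 e * \<H> (1 / w) - u1 0 * d1 e * \<H>' (1 / w)))"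
    unfolding b_def
    by (rule strict_diff_eq, (rule strict_diff_add strict_diff_cmult[where c = "-2"] strict_diff_cmult[where c = "-\<kappa>"]
        strict_diff_cmult[where c = \<kappa>] k5 k1 k2 k3 sH sW strict_diff_mult s1 s2)+)
      (use w1 in \<open>simp add: q0 w[symmetric] field_simps\<close>)
qed

text \<open>With \<open>\<nu> = 1 / k\<^sup>2\<close>, \<open>h = \<H> \<nu>\<close> and \<open>h' = \<H>' \<nu>\<close>, this is half the contracted Hessian of
  \<open>|grad u|\<^sup>2 - T u\<close> at a point where the gradient bound is touched.\<close>

definition touching_defect :: "real \<Rightarrow> real \<Rightarrow> real \<Rightarrow> real \<Rightarrow> real \<Rightarrow> real" where
  "touching_defect \<kappa> h h' \<delta> k = 4 * h\<^sup>2 * k ^ 8 + \<kappa> * (k ^ 8 - k ^ 4) + \<delta>\<^sup>2 * (k ^ 10 / 2 + 3 / 2 * k ^ 6)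
     - 6 * h * \<delta> * k ^ 7 - 2 * \<delta> * (k ^ 9 - k ^ 5) * h'"

text \<open>Minimality of \<open>u + 2 / \<delta> * sqrt (1 / W)\<close> at the origin is the gradient bound
  \<open>|grad u|\<^sup>2 \<le> T u\<close> with equality there, so that \<open>gradient_bound_inequality\<close> applies.  If the
  gradient does not vanish, the first order conditions fix \<open>u\<^sub>1\<^sub>1\<close> and \<open>u\<^sub>1\<^sub>2\<close>, the equation fixes
  \<open>u\<^sub>2\<^sub>2\<close>, and the result is a function of \<open>k = 1 / sqrt \<nu>\<close> alone.  If it vanishes, the inequality
  says that the squared norm of the Hessian is at most \<open>\<delta>\<close> times its trace \<open>2 \<H> 1\<close>, whereas it is
  at least half the square of the trace.\<close>

lemma H_graph_touching_inequality:
  assumes \<kappa>: "\<kappa> \<in> {-1, 1}" and G: "H_graph \<kappa> \<H> R u u1 u2 u11 u12 u22" and q0: "u2 0 = 0"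
    and H: "\<And>y. y \<in> {-1..1} \<Longrightarrow> (\<H> has_real_derivative \<H>' y) (at y within {-1..1})"
      "continuous_on {-1..1} \<H>'"
    and \<delta>: "\<delta> > 0"
    and min: "\<And>z. z \<in> ball 0 R \<Longrightarrow> u 0 + 2 / \<delta> * sqrt (1 / graph_W \<kappa> u1 u2 0) \<le> u z + 2 / \<delta> * sqrt (1 / graph_W \<kappa> u1 u2 z)"
  shows "\<H> 1 \<le> \<delta> \<or> (\<exists>k\<ge>1. touching_defect \<kappa> (\<H> (1 / k\<^sup>2)) (\<H>' (1 / k\<^sup>2)) \<delta> k \<le> 0)"
proof -
  have R: "0 < R" "R \<le> 1" and h: "has_hessian u u1 u2 u11 u12 u22 (ball 0 R)"
    and c: "isCont u11 0" "isCont u12 0" "isCont u22 0"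
    using G by (auto simp: H_graph_def)
  note D = csk_snk_deriv[OF \<kappa>]
  have cp: "csk \<kappa> r > 0" if "\<bar>r\<bar> < 1" for r using csk_pos[OF that] .
  have cc: "isCont (csk \<kappa>) 0" "isCont (snk \<kappa>) 0" using D by (auto intro: DERIV_isCont)
  define w where "w = graph_W \<kappa> u1 u2 0"
  define k where "k = sqrt w"
  have w1: "w \<ge> 1" using graph_W_ge_1 w_def by simp
  have k1: "k \<ge> 1" and kw: "w = k\<^sup>2" using w1 by (auto simp: k_def)
  have w2: "w\<^sup>2 = 1 + (u1 0)\<^sup>2" by (simp add: w_def graph_W_def q0 add_nonneg_nonneg)
  have p2: "(u1 0)\<^sup>2 = k ^ 4 - 1" using w2 kw by (simp add: power_mult[symmetric])
  define c0 where "c0 = u 0 + 2 / \<delta> * (1 / k)"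
  have sk: "sqrt (1 / w) = 1 / k" by (simp add: k_def real_sqrt_divide)
  define Y where "Y s = \<delta> * (c0 - s) / 2" for s
  have Y0: "Y (u 0) = 1 / k" using \<delta> by (simp add: Y_def c0_def field_simps)
  \<comment> \<open>\<open>sqrt (1 / W) \<ge> Y\<close> is equivalent to \<open>W\<^sup>2 - 1 \<le> T\<close> where \<open>Y\<close> is positive\<close>
  define T where "T s = inverse (Y s) ^ 4 - 1" for s
  define T1 where "T1 s = 2 * \<delta> * inverse (Y s) ^ 5" for s
  define T2 where "T2 s = 5 * \<delta>\<^sup>2 * inverse (Y s) ^ 6" for s
  have gu: "has_grad u (u1 z) (u2 z) z" if "z \<in> ball 0 R" for z using h that by (auto simp: has_hessian_def)
  have b0: "0 \<in> ball (0 :: real \<times> real) R" using R by simp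
  have "isCont (\<lambda>z. Y (u z)) 0" unfolding Y_def
    using has_grad_isCont[OF gu[OF b0]] by (intro continuous_intros) auto
  moreover have "Y (u 0) > 0" using Y0 k1 by simp
  ultimately obtain d where d: "d > 0" "\<And>z. dist z 0 < d \<Longrightarrow> dist (Y (u z)) (Y (u 0)) < Y (u 0)"
    unfolding continuous_at_eps_delta dist_norm by blast
  define r where "r = min R d"
  have r: "0 < r" "r \<le> R" "r \<le> d" using R d by (auto simp: r_def)
  have rR: "z \<in> ball 0 R" if "z \<in> ball 0 r" for z :: "real \<times> real" using that r by auto
  have Yp: "Y (u z) > 0" if "z \<in> ball 0 r" for z
    using d(2)[of z] that r by (simp add: dist_real_def)
  have snd1: "\<bar>snd z\<bar> < 1" if "z \<in> ball 0 R" for z :: "real \<times> real"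
    using that norm_snd_le[of "snd z" "fst z"] R by (cases z) auto
  define A11 where "A11 = (\<lambda>z. 1 + u2 z * u2 z)"
  define A12 where "A12 = (\<lambda>z. (- 1) * (u1 z * u2 z))"
  define A22 where "A22 = (\<lambda>z. (csk \<kappa> (snd z))\<^sup>2 + u1 z * u1 z)"
  define b where "b = (\<lambda>z. - 2 * (\<kappa> * ((u1 z * u1 z) * (u2 z * (snk \<kappa> (snd z) / csk \<kappa> (snd z)))))
      + ((- \<kappa>) * ((1 + u2 z * u2 z) * (u2 z * (csk \<kappa> (snd z) * snk \<kappa> (snd z))))
      + (- 2) * ((csk \<kappa> (snd z))\<^sup>2 * (graph_W \<kappa> u1 u2 z * (graph_W \<kappa> u1 u2 z * (graph_W \<kappa> u1 u2 z
            * \<H> (inverse (graph_W \<kappa> u1 u2 z))))))))"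
  have sd: "strict_diff A11 e 0" "strict_diff A12 e (- u1 0 * (u12 0 * fst e + u22 0 * snd e))"
      "strict_diff A22 e (2 * u1 0 * (u11 0 * fst e + u12 0 * snd e))"
      "strict_diff b e (- 2 * (3 * w * u1 0 * (u11 0 * fst e + u12 0 * snd e) * \<H> (1 / w) - u1 0 * (u11 0 * fst e + u12 0 * snd e) * \<H>' (1 / w)))" for e
    unfolding A11_def A12_def A22_def b_def
    using H_graph_strict_diff[OF \<kappa> G q0 H w_def, of e] by blast+
  note sq = sd[unfolded strict_diff_def, THEN conjunct1]
  note isc = sd[unfolded strict_diff_def, THEN conjunct2]
  have q1: "strict_quotient A11 (1, 0) 0" "strict_quotient A12 (1, 0) (- u1 0 * u12 0)"
      "strict_quotient A22 (1, 0) (2 * u1 0 * u11 0)"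
      "strict_quotient b (1, 0) (- 2 * (3 * w * u1 0 * u11 0 * \<H> (1 / w) - u1 0 * u11 0 * \<H>' (1 / w)))"
    using sq[of "(1, 0)"] by simp_all
  have pde: "A11 z * u11 z + 2 * A12 z * u12 z + A22 z * u22 z + b z = 0" if "z \<in> ball 0 R" for z
    using H_graph_equation[OF G that] unfolding A11_def A12_def A22_def b_def
    by (simp add: power2_eq_square power3_eq_cube algebra_simps inverse_eq_divide)
  define \<alpha> where "\<alpha> s = inverse (csk \<kappa> s) ^ 2" for s
  define \<alpha>1 where "\<alpha>1 s = 2 * \<kappa> * (snk \<kappa> s * inverse (csk \<kappa> s) ^ 3)" for s
  define \<alpha>2 where "\<alpha>2 s = 2 * \<kappa> * (csk \<kappa> s * inverse (csk \<kappa> s) ^ 3 + 3 * \<kappa> * snk \<kappa> s * snk \<kappa> s * inverse (csk \<kappa> s) ^ 4)" for s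
  have Di: "((\<lambda>s. inverse (csk \<kappa> s)) has_real_derivative \<kappa> * snk \<kappa> s * inverse (csk \<kappa> s) ^ 2) (at s)" if "\<bar>s\<bar> < 1" for s
    using DERIV_inverse_fun[OF D(1)[of s]] cp[OF that] by (simp add: power2_eq_square mult_ac)
  have Da1: "(\<alpha> has_real_derivative \<alpha>1 s) (at s)" if "\<bar>s\<bar> < 1" for s
    unfolding \<alpha>_def[abs_def] \<alpha>1_def
    by (rule DERIV_cong[OF DERIV_power[OF Di[OF that]]]) (simp add: power2_eq_square power3_eq_cube)
  have Da2: "(\<alpha>1 has_real_derivative \<alpha>2 s) (at s)" if "\<bar>s\<bar> < 1" for s
    unfolding \<alpha>1_def[abs_def] \<alpha>2_def
    by (rule DERIV_cong[OF DERIV_cmult[OF DERIV_mult[OF D(2) DERIV_power[OF Di[OF that]]]]])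
      (simp add: power2_eq_square power3_eq_cube power4_eq_xxxx algebra_simps)
  have ca2: "isCont \<alpha>2 0" unfolding \<alpha>2_def[abs_def] using cc by (intro continuous_intros) auto
  have DY: "((\<lambda>s. inverse (Y s)) has_real_derivative \<delta> / 2 * inverse (Y s) ^ 2) (at s)" if "Y s > 0" for s
  proof -
    have "(Y has_real_derivative - \<delta> / 2) (at s)"
      unfolding Y_def[abs_def] by (auto intro!: derivative_eq_intros)
    from DERIV_inverse_fun[OF this] that show ?thesis by (simp add: power2_eq_square mult_ac)
  qed
  have DT1: "(T has_real_derivative T1 s) (at s)" if "Y s > 0" for s
    unfolding T_def[abs_def] T1_def
    by (rule DERIV_cong[OF DERIV_diff[OF DERIV_power[OF DY[OF that]] DERIV_const]])
      (simp add: eval_nat_numeral)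
  have DT2: "(T1 has_real_derivative T2 s) (at s)" if "Y s > 0" for s
    unfolding T1_def[abs_def] T2_def
    by (rule DERIV_cong[OF DERIV_cmult[OF DERIV_power[OF DY[OF that]]]])
      (simp add: eval_nat_numeral)
  have cT2: "isCont T2 (u 0)"
    unfolding T2_def[abs_def] using \<open>Y (u 0) > 0\<close>
    by (intro continuous_intros) (auto simp: Y_def[abs_def] intro!: continuous_intros)
  have slope: "\<alpha> (snd z) * (u1 z)\<^sup>2 + (u2 z)\<^sup>2 \<le> T (u z)" if z: "z \<in> ball 0 r" for z
  proof -
    define W where "W = graph_W \<kappa> u1 u2 z"
    have W1: "W \<ge> 1" unfolding W_def by (rule graph_W_ge_1)
    have W2: "W\<^sup>2 = 1 + (\<alpha> (snd z) * (u1 z)\<^sup>2 + (u2 z)\<^sup>2)"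
      unfolding W_def graph_W_def \<alpha>_def by (simp add: add_nonneg_nonneg divide_inverse power_inverse mult.commute)
    have "c0 \<le> u z + 2 / \<delta> * sqrt (1 / W)"
      using min[OF rR[OF z]] unfolding c0_def W_def w_def[symmetric] sk by simp
    then have "Y (u z) \<le> sqrt (1 / W)" using \<delta> by (simp add: Y_def field_simps)
    then have "Y (u z) ^ 4 \<le> sqrt (1 / W) ^ 4" using Yp[OF z] by (intro power_mono) auto
    also have "\<dots> = (1 / W)\<^sup>2" using W1 by (simp add: power4_eq_xxxx power2_eq_square)
    finally have "Y (u z) ^ 4 \<le> 1 / W\<^sup>2" by (simp add: power_one_over)
    then have "W\<^sup>2 \<le> 1 / Y (u z) ^ 4" using W1 Yp[OF z] by (simp add: field_simps)
    then show ?thesis unfolding T_def using W2 by (simp add: inverse_eq_divide power_one_over)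
  qed
  have T0: "T (u 0) = (u1 0)\<^sup>2" "T1 (u 0) = 2 * \<delta> * k ^ 5" "T2 (u 0) = 5 * \<delta>\<^sup>2 * k ^ 6"
    using p2 by (auto simp: T_def T1_def T2_def Y0)
  have \<alpha>0: "\<alpha> 0 = 1" "\<alpha>1 0 = 0" "\<alpha>2 0 = 2 * \<kappa>" by (auto simp: \<alpha>_def \<alpha>1_def \<alpha>2_def)
  have max: "\<alpha> (snd z) * (u1 z)\<^sup>2 + (u2 z)\<^sup>2 - T (u z) \<le> \<alpha> 0 * (u1 0)\<^sup>2 + (u2 0)\<^sup>2 - T (u 0)" if "z \<in> ball 0 r" for z
    using slope[OF that] by (simp add: \<alpha>0 T0 q0)
  define p where "p = u1 0"
  have b0r: "0 \<in> ball (0 :: real \<times> real) r" using r by simp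
  have crit: "2 * p * u11 0 - 2 * \<delta> * k ^ 5 * p = 0" "2 * p * u12 0 = 0"
  proof -
    have gz: "has_grad (\<lambda>z. \<alpha> (snd z)) 0 0 0"
      using has_grad_chain[OF has_grad_snd[of 0], of \<alpha> "\<alpha>1 0"] Da1[of 0] by (simp add: \<alpha>0)
    have g12: "has_grad u1 (u11 0) (u12 0) 0" "has_grad u2 (u12 0) (u22 0) 0"
      using h b0 by (auto simp: has_hessian_def)
    have gT: "has_grad (\<lambda>z. T (u z)) (2 * \<delta> * k ^ 5 * u1 0) (2 * \<delta> * k ^ 5 * u2 0) 0"
      using has_grad_chain[OF gu[OF b0] DT1[OF \<open>Y (u 0) > 0\<close>]] by (simp add: T0)
    have "has_grad (\<lambda>z. \<alpha> (snd z) * (u1 z * u1 z) + u2 z * u2 z - T (u z))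
        (2 * p * u11 0 - 2 * \<delta> * k ^ 5 * p) (2 * p * u12 0) 0"
      by (rule has_grad_eq, (rule has_grad_diff[OF _ gT] has_grad_add has_grad_mult gz g12)+)
        (simp_all add: \<alpha>0 q0 p_def)
    from local_max_critical[OF this open_ball b0r] max
    show "2 * p * u11 0 - 2 * \<delta> * k ^ 5 * p = 0" "2 * p * u12 0 = 0" by (auto simp: power2_eq_square)
  qed
  have main: "- 2 * \<alpha> 0 * u1 0 * (0 * u11 0 + 2 * (- u1 0 * u12 0) * u12 0 + 2 * u1 0 * u11 0 * u22 0
      + (- 2 * (3 * w * u1 0 * u11 0 * \<H> (1 / w) - u1 0 * u11 0 * \<H>' (1 / w))))
    + A11 0 * (2 * \<alpha> 0 * (u11 0)\<^sup>2 + 2 * (u12 0)\<^sup>2 - T2 (u 0) * (u1 0)\<^sup>2 - T1 (u 0) * u11 0)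
    + 2 * A12 0 * (2 * \<alpha> 0 * u11 0 * u12 0 + 2 * u12 0 * u22 0 - T1 (u 0) * u12 0)
    + A22 0 * (\<alpha>2 0 * (u1 0)\<^sup>2 + 2 * \<alpha> 0 * (u12 0)\<^sup>2 + 2 * (u22 0)\<^sup>2 - T1 (u 0) * u22 0) \<le> 0"
  proof (rule gradient_bound_inequality[where R = r and T = T and \<alpha> = \<alpha> and b = b and ?\<alpha>1.0 = \<alpha>1 and u = u])
    show "has_hessian u u1 u2 u11 u12 u22 (ball 0 r)" using h rR by (auto simp: has_hessian_def)
    show "A11 z > 0" if "z \<in> ball 0 r" for z by (simp add: A11_def add_pos_nonneg)
    show "A11 z * A22 z - (A12 z)\<^sup>2 > 0" if "z \<in> ball 0 r" for z
    proof -
      have "A11 z * A22 z - (A12 z)\<^sup>2 = (csk \<kappa> (snd z))\<^sup>2 * (1 + (u2 z)\<^sup>2) + (u1 z)\<^sup>2"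
        by (simp add: A11_def A22_def A12_def power2_eq_square algebra_simps)
      also have "\<dots> > 0" using cp[OF snd1[OF rR[OF that]]] by (intro add_pos_nonneg mult_pos_pos) auto
      finally show ?thesis .
    qed
    show "A11 z * u11 z + 2 * A12 z * u12 z + A22 z * u22 z + b z = 0" if "z \<in> ball 0 r" for z
      using pde rR[OF that] by blast
    show "(\<alpha> has_real_derivative \<alpha>1 s) (at s)" "(\<alpha>1 has_real_derivative \<alpha>2 s) (at s)" if "\<bar>s\<bar> < r" for s
      using Da1 Da2 that r R by auto
    show "(T has_real_derivative T1 (u z)) (at (u z))" "(T1 has_real_derivative T2 (u z)) (at (u z))"
      if "z \<in> ball 0 r" for z using DT1 DT2 Yp[OF that] by auto
    show "strict_quotient A11 (1, 0) 0" "strict_quotient A12 (1, 0) (- u1 0 * u12 0)"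
      "strict_quotient A22 (1, 0) (2 * u1 0 * u11 0)"
      "strict_quotient b (1, 0) (- 2 * (3 * w * u1 0 * u11 0 * \<H> (1 / w) - u1 0 * u11 0 * \<H>' (1 / w)))"
      by (rule q1)+
  qed (rule r c ca2 cT2 \<alpha>0 q0 isc sq | erule max)+
  define Hk where "Hk = \<H> (1 / k\<^sup>2)"
  define Hk' where "Hk' = \<H>' (1 / k\<^sup>2)"
  define m where "m = u11 0"
  define n where "n = u12 0"
  define v where "v = u22 0"
  have eq0: "k ^ 4 * v + m = 2 * k ^ 6 * Hk"
    using pde[OF b0] kw p2 unfolding A11_def A12_def A22_def b_def w_def[symmetric] Hk_def v_def m_def
    by (simp add: q0 power2_eq_square inverse_eq_divide eval_nat_numeral mult_ac)
  have A0: "A11 0 = 1" "A12 0 = 0" "A22 0 = k ^ 4"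
    using p2 by (auto simp: A11_def A12_def A22_def q0 power2_eq_square)
  have main': "- 2 * p * (- 2 * p * n\<^sup>2 + 2 * p * m * v - 2 * (3 * k\<^sup>2 * p * m * Hk - p * m * Hk'))
     + (2 * m\<^sup>2 + 2 * n\<^sup>2 - 5 * \<delta>\<^sup>2 * k ^ 6 * p\<^sup>2 - 2 * \<delta> * k ^ 5 * m)
     + k ^ 4 * (2 * \<kappa> * p\<^sup>2 + 2 * n\<^sup>2 + 2 * v\<^sup>2 - 2 * \<delta> * k ^ 5 * v) \<le> 0"
    using main unfolding A0 T0 \<alpha>0 kw Hk_def[symmetric] Hk'_def[symmetric] m_def[symmetric] n_def[symmetric] v_def[symmetric] p_def[symmetric]
    by (simp add: power2_eq_square algebra_simps)
  show ?thesis
  proof (cases "p = 0")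
    case True
    then have "k ^ 4 = 1" using p2 by (simp add: p_def)
    then have "k = 1" using k1 self_le_power[of k 4] by simp
    have 1: "v + m = 2 * \<H> 1" using eq0 \<open>k = 1\<close> by (simp add: Hk_def)
    have 2: "2 * m\<^sup>2 + 2 * v\<^sup>2 + 4 * n\<^sup>2 \<le> 2 * \<delta> * (v + m)"
      using main' \<open>k = 1\<close> True by (simp add: algebra_simps)
    have "(v + m)\<^sup>2 \<le> 2 * m\<^sup>2 + 2 * v\<^sup>2 + 4 * n\<^sup>2"
    proof -
      have "2 * m\<^sup>2 + 2 * v\<^sup>2 + 4 * n\<^sup>2 - (v + m)\<^sup>2 = (v - m)\<^sup>2 + 4 * n\<^sup>2"
        by (simp add: power2_sum power2_diff)
      also have "\<dots> \<ge> 0" by simp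
      finally show ?thesis by simp
    qed
    then have 3: "(2 * \<H> 1) * (2 * \<H> 1) \<le> 2 * \<delta> * (2 * \<H> 1)" using 2 1 by (simp add: power2_eq_square)
    have "\<H> 1 \<le> \<delta>"
    proof (rule ccontr)
      assume "\<not> \<H> 1 \<le> \<delta>"
      then have "2 * \<delta> * (2 * \<H> 1) < (2 * \<H> 1) * (2 * \<H> 1)" using \<delta> by (intro mult_strict_right_mono) auto
      then show False using 3 by simp
    qed
    then show ?thesis by simp
  next
    case False
    have m: "m = \<delta> * k ^ 5" using crit(1) False by (simp add: m_def)
    have n: "n = 0" using crit(2) False by (simp add: n_def)
    have "k ^ 4 * v = k ^ 4 * (2 * k\<^sup>2 * Hk - \<delta> * k)"
      using eq0 m by (simp add: eval_nat_numeral algebra_simps)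
    then have v: "v = 2 * k\<^sup>2 * Hk - \<delta> * k" using k1 by simp
    have pk: "p\<^sup>2 = k ^ 4 - 1" using p2 by (simp add: p_def)
    have "- 2 * p * (- 2 * p * n\<^sup>2 + 2 * p * m * v - 2 * (3 * k\<^sup>2 * p * m * Hk - p * m * Hk'))
      = - 4 * p\<^sup>2 * (m * v - 3 * k\<^sup>2 * m * Hk + m * Hk')"
      by (simp add: n power2_eq_square algebra_simps)
    then have "- 4 * (k ^ 4 - 1) * (m * v - 3 * k\<^sup>2 * m * Hk + m * Hk')
     + (2 * m\<^sup>2 - 5 * \<delta>\<^sup>2 * k ^ 6 * (k ^ 4 - 1) - 2 * \<delta> * k ^ 5 * m)
     + k ^ 4 * (2 * \<kappa> * (k ^ 4 - 1) + 2 * v\<^sup>2 - 2 * \<delta> * k ^ 5 * v) \<le> 0"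
      using main' n by (simp add: pk)
    also have "- 4 * (k ^ 4 - 1) * (m * v - 3 * k\<^sup>2 * m * Hk + m * Hk')
     + (2 * m\<^sup>2 - 5 * \<delta>\<^sup>2 * k ^ 6 * (k ^ 4 - 1) - 2 * \<delta> * k ^ 5 * m)
     + k ^ 4 * (2 * \<kappa> * (k ^ 4 - 1) + 2 * v\<^sup>2 - 2 * \<delta> * k ^ 5 * v)
     = 2 * (4 * Hk\<^sup>2 * k ^ 8 + \<kappa> * (k ^ 8 - k ^ 4) + \<delta>\<^sup>2 * (k ^ 10 / 2 + 3 / 2 * k ^ 6)
      - 6 * Hk * \<delta> * k ^ 7 - 2 * \<delta> * (k ^ 9 - k ^ 5) * Hk')"
      unfolding m v by (simp add: eval_nat_numeral algebra_simps)
    finally show ?thesis using k1 unfolding Hk_def Hk'_def touching_defect_def by (intro disjI2 exI[of _ k]) auto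
  qed
qed

lemma even_derivative_0:
  assumes "(f has_real_derivative D) (at 0)" "\<And>y. \<bar>y\<bar> \<le> 1 \<Longrightarrow> f y = f (- y)"
  shows "D = 0"
proof -
  have "((\<lambda>y. f (- y)) has_real_derivative - D) (at 0)"
  proof -
    have "(uminus has_real_derivative - 1) (at (0::real))" by (auto intro!: derivative_eq_intros)
    moreover have "(f has_real_derivative D) (at (- (0::real)))" using assms(1) by simp
    ultimately have "((\<lambda>y. f (- y)) has_real_derivative D * - 1) (at 0)" by (rule DERIV_chain2[rotated])
    then show ?thesis by simp
  qed
  then have "(f has_real_derivative - D) (at 0)"
  proof (rule has_field_derivative_transform_within_open[where S = "ball 0 1"])
    show "f (- x) = f x" if "x \<in> ball 0 1" for x using assms(2)[of x] that by (simp add: dist_real_def)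
  qed simp_all
  with assms(1) have "D = - D" by (rule DERIV_unique)
  then show ?thesis by simp
qed

text \<open>After division by \<open>k ^ 8\<close>, with \<open>y = 1 / k\<close>, the sum \<open>4 \<H>\<^sup>2 + \<kappa> (1 - y ^ 4)\<close> is at least
  some \<open>m > 0\<close> by hypothesis.  The term with \<open>\<H>\<close> costs at most \<open>m / 8\<close>.  For the term with \<open>\<H>'\<close>,
  if \<open>y\<^sup>2\<close> is small then \<open>\<H>'\<close> is small and \<open>2 a \<epsilon> \<le> a\<^sup>2 / 2 + 2 \<epsilon>\<^sup>2\<close> with \<open>a = \<delta> / y\<close> absorbs it;
  otherwise \<open>y\<close> is bounded below and \<open>\<delta>\<close> makes it at most \<open>m / 8\<close>.\<close>

lemma exists_slope_parameter:
  assumes \<kappa>: "\<kappa> \<in> {-1, 1::real}"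
    and cont: "continuous_on {-1..1} \<H>" "continuous_on {-1..1} \<H>'" and "\<H>' 0 = 0"
    and pos: "\<And>y. y \<in> {-1..1} \<Longrightarrow> 4 * \<H> y > (1 - \<kappa>) * sqrt (1 - y\<^sup>2)"
  obtains \<delta> :: real where "\<delta> > 0" "\<delta> < \<H> 1"
    "\<And>k. k \<ge> 1 \<Longrightarrow> touching_defect \<kappa> (\<H> (1 / k\<^sup>2)) (\<H>' (1 / k\<^sup>2)) \<delta> k > 0"
proof -
  have I: "compact {0..1::real}" "{0..1::real} \<noteq> {}" by auto
  have cont01: "continuous_on {0..1} \<H>" "continuous_on {0..1} \<H>'"
    using cont by (auto elim: continuous_on_subset)
  have posQ: "4 * (\<H> y)\<^sup>2 + \<kappa> * (1 - y\<^sup>2) > 0" if y: "y \<in> {0..1}" for y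
  proof -
    have y2: "y\<^sup>2 \<le> 1" using y by (simp add: power_le_one)
    have P: "4 * \<H> y > (1 - \<kappa>) * sqrt (1 - y\<^sup>2)" using pos y by simp
    show ?thesis
    proof (cases "\<kappa> = 1")
      case True
      then show ?thesis using P y2 by (simp add: add_pos_nonneg)
    next
      case False
      then have k: "\<kappa> = -1" using \<kappa> by simp
      have "sqrt (1 - y\<^sup>2) < 2 * \<H> y" using P k by simp
      then have "(sqrt (1 - y\<^sup>2))\<^sup>2 < (2 * \<H> y)\<^sup>2" using y2 by (intro power_strict_mono) auto
      then show ?thesis using y2 k by (simp add: power_mult_distrib)
    qed
  qed
  have "continuous_on {0..1} (\<lambda>y. 4 * (\<H> y)\<^sup>2 + \<kappa> * (1 - y\<^sup>2))"
    using cont01 by (intro continuous_intros)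
  from continuous_attains_inf[OF I this] obtain y0 where y0: "y0 \<in> {0..1}"
    "\<And>y. y \<in> {0..1} \<Longrightarrow> 4 * (\<H> y0)\<^sup>2 + \<kappa> * (1 - y0\<^sup>2) \<le> 4 * (\<H> y)\<^sup>2 + \<kappa> * (1 - y\<^sup>2)" by blast
  define m where "m = 4 * (\<H> y0)\<^sup>2 + \<kappa> * (1 - y0\<^sup>2)"
  have m: "m > 0" unfolding m_def using posQ y0(1) by blast
  have mle: "m \<le> 4 * (\<H> y)\<^sup>2 + \<kappa> * (1 - y\<^sup>2)" if "y \<in> {0..1}" for y using y0 that by (simp add: m_def)
  obtain h where h: "h > 0" "\<And>y. y \<in> {0..1} \<Longrightarrow> \<bar>\<H> y\<bar> \<le> h"
    using compact_imp_bounded[OF compact_continuous_image[OF cont01(1) I(1)]]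
    unfolding bounded_pos by auto
  obtain M where M: "M > 0" "\<And>y. y \<in> {0..1} \<Longrightarrow> \<bar>\<H>' y\<bar> \<le> M"
    using compact_imp_bounded[OF compact_continuous_image[OF cont01(2) I(1)]]
    unfolding bounded_pos by auto
  \<comment> \<open>chosen such that \<open>2 \<epsilon>\<^sup>2 = m / 8\<close>\<close>
  define \<epsilon> where "\<epsilon> = sqrt m / 4"
  have e: "\<epsilon> > 0" "2 * \<epsilon>\<^sup>2 = m / 8" using m by (auto simp: \<epsilon>_def power_divide)
  obtain \<nu> where nu: "\<nu> > 0" "\<And>y. y \<in> {0..1} \<Longrightarrow> dist y 0 < \<nu> \<Longrightarrow> dist (\<H>' y) (\<H>' 0) < \<epsilon>"
    using cont01(2) e(1) unfolding continuous_on_iff by (meson atLeastAtMost_iff order_refl zero_le_one)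
  \<comment> \<open>the last two bounds make the terms with \<open>\<H>\<close> and, for \<open>y \<ge> \<nu>\<close>, with \<open>\<H>'\<close> at most \<open>m / 8\<close>\<close>
  define \<delta> where "\<delta> = min (\<H> 1 / 2) (min (m / (48 * h)) (m * \<nu> / (16 * M)))"
  have H1: "\<H> 1 > 0" using pos[of 1] by simp
  have d: "\<delta> > 0" "\<delta> < \<H> 1" "\<delta> \<le> m / (48 * h)" "\<delta> \<le> m * \<nu> / (16 * M)"
    using H1 m h(1) M(1) nu(1) by (auto simp: \<delta>_def)
  have "touching_defect \<kappa> (\<H> (1 / k\<^sup>2)) (\<H>' (1 / k\<^sup>2)) \<delta> k > 0" if k: "k \<ge> 1" for k
  proof -
    define y where "y = 1 / k"
    have y: "0 < y" "y \<le> 1" and ky: "k = 1 / y" using k by (auto simp: y_def)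
    have y2: "y\<^sup>2 \<in> {0..1}" "y\<^sup>2 = 1 / k\<^sup>2" using y by (auto simp: y_def power_le_one power_one_over)
    define Hy where "Hy = \<H> (y\<^sup>2)"
    define Hy' where "Hy' = \<H>' (y\<^sup>2)"
    have a1: "m \<le> 4 * Hy\<^sup>2 + \<kappa> * (1 - y ^ 4)"
      using mle[OF y2(1)] by (simp add: Hy_def power_mult[symmetric])
    have a2: "6 * Hy * \<delta> * y \<le> m / 8"
    proof -
      have "Hy * \<delta> * y \<le> h * \<delta> * 1"
        using h(2)[OF y2(1)] h(1) y d(1) unfolding Hy_def by (intro mult_mono) auto
      also have "\<dots> \<le> h * (m / (48 * h)) * 1" using d(3) h(1) by (intro mult_right_mono mult_left_mono) auto
      also have "\<dots> = m / 48" using h(1) by simp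
      finally show ?thesis by simp
    qed
    have a3: "2 * \<delta> * (1 - y ^ 4) * Hy' / y \<le> \<delta>\<^sup>2 / (2 * y\<^sup>2) + m / 8"
    proof -
      have y4: "0 \<le> 1 - y ^ 4" "1 - y ^ 4 \<le> 1" using y by (auto simp: power_le_one)
      have "(1 - y ^ 4) * Hy' \<le> (1 - y ^ 4) * \<bar>Hy'\<bar>" using y4 by (intro mult_left_mono) auto
      also have "\<dots> \<le> 1 * \<bar>Hy'\<bar>" using y4 by (intro mult_right_mono) auto
      finally have "(1 - y ^ 4) * Hy' \<le> \<bar>Hy'\<bar>" by simp
      then have "2 * \<delta> / y * ((1 - y ^ 4) * Hy') \<le> 2 * \<delta> / y * \<bar>Hy'\<bar>"
        using d(1) y by (intro mult_left_mono) auto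
      then have b1: "2 * \<delta> * (1 - y ^ 4) * Hy' / y \<le> 2 * (\<delta> / y) * \<bar>Hy'\<bar>" by simp
      show ?thesis
      proof (cases "y\<^sup>2 < \<nu>")
        case True
        then have "\<bar>Hy'\<bar> \<le> \<epsilon>" using nu(2)[OF y2(1)] y \<open>\<H>' 0 = 0\<close> by (simp add: Hy'_def dist_real_def)
        then have "2 * (\<delta> / y) * \<bar>Hy'\<bar> \<le> 2 * (\<delta> / y) * \<epsilon>" using d(1) y by (intro mult_left_mono) auto
        also have "\<dots> \<le> (\<delta> / y)\<^sup>2 / 2 + 2 * \<epsilon>\<^sup>2"
          using zero_le_power2[of "\<delta> / y - 2 * \<epsilon>"] by (simp add: power2_diff power_mult_distrib)
        finally show ?thesis using b1 e(2) by (simp add: power_divide)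
      next
        case False
        have "y\<^sup>2 \<le> y" using y by (simp add: power2_eq_square mult_left_le)
        then have yn: "\<nu> \<le> y" using False by simp
        have "2 * (\<delta> / y) * \<bar>Hy'\<bar> \<le> 2 * (\<delta> / \<nu>) * M"
          using M y d(1) nu(1) yn M(2)[OF y2(1)] unfolding Hy'_def
          by (intro mult_mono mult_left_mono divide_left_mono) auto
        also have "\<dots> \<le> 2 * (m * \<nu> / (16 * M) / \<nu>) * M"
          using d(4) nu(1) M(1) by (intro mult_right_mono mult_left_mono divide_right_mono) auto
        also have "\<dots> = m / 8" using nu(1) M(1) by simp
        finally have "2 * (\<delta> / y) * \<bar>Hy'\<bar> \<le> m / 8" .
        moreover have "\<delta>\<^sup>2 / (2 * y\<^sup>2) \<ge> 0" by simp
        ultimately show ?thesis using b1 by linarith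
      qed
    qed
    define E where "E = 4 * Hy\<^sup>2 + \<kappa> * (1 - y ^ 4) + (\<delta>\<^sup>2 / (2 * y\<^sup>2) + 3 / 2 * \<delta>\<^sup>2 * y\<^sup>2) - 6 * Hy * \<delta> * y - 2 * \<delta> * (1 - y ^ 4) * Hy' / y"
    have "3 / 2 * \<delta>\<^sup>2 * y\<^sup>2 \<ge> 0" by simp
    then have "E > 0" unfolding E_def using a1 a2 a3 m by linarith
    then have "E * k ^ 8 > 0" using k by simp
    also have "E * k ^ 8 = 4 * Hy\<^sup>2 * k ^ 8 + \<kappa> * (k ^ 8 - k ^ 4) + \<delta>\<^sup>2 * (k ^ 10 / 2 + 3 / 2 * k ^ 6)
      - 6 * Hy * \<delta> * k ^ 7 - 2 * \<delta> * (k ^ 9 - k ^ 5) * Hy'"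
    proof -
      have "E = 4 * Hy\<^sup>2 + \<kappa> * (1 - y ^ 4) + (\<delta>\<^sup>2 * (k * k) / 2 + 3 / 2 * \<delta>\<^sup>2 * y\<^sup>2) - 6 * Hy * \<delta> * y - 2 * \<delta> * (1 - y ^ 4) * Hy' * k"
        using k by (simp add: E_def y_def power2_eq_square)
      then have "E * k ^ 8 = 4 * Hy\<^sup>2 * k ^ 8 + \<kappa> * (k ^ 8 - y ^ 4 * k ^ 8)
        + \<delta>\<^sup>2 * (k * k * k ^ 8 / 2 + 3 / 2 * (y\<^sup>2 * k ^ 8)) - 6 * Hy * \<delta> * (y * k ^ 8)
        - 2 * \<delta> * (k * k ^ 8 - y ^ 4 * k ^ 8 * k) * Hy'"
        by (simp add: ring_distribs)
      moreover have "y ^ 4 * k ^ 8 = k ^ 4" "y\<^sup>2 * k ^ 8 = k ^ 6" "y * k ^ 8 = k ^ 7"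
        "k * k * k ^ 8 = k ^ 10" "k * k ^ 8 = k ^ 9" "k ^ 4 * k = k ^ 5"
        using k by (simp_all add: y_def power_one_over power_add[symmetric] field_simps power_numeral_reduce)
      ultimately show ?thesis by (simp only:)
    qed
    finally show ?thesis unfolding Hy_def Hy'_def y2(2) touching_defect_def .
  qed
  with d that show ?thesis by blast
qed

section \<open>Chain rule, symmetry and inversion for second derivatives\<close>

lemma D1_D2_compose:
  assumes f: "C2_on U f" "open U" and g: "C2_on V g" "open V" and fU: "f ` U \<subseteq> V" and z: "z \<in> U"
  shows "D1 (\<lambda>z. g (f z)) z a = D1 g (f z) (D1 f z a)"
    and "D2 (\<lambda>z. g (f z)) z a b = D2 g (f z) (D1 f z a) (D1 f z b) + D1 g (f z) (D2 f z a b)"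
proof -
  obtain f' f'' where F: "\<And>z. z \<in> U \<Longrightarrow> (f has_derivative blinfun_apply (f' z)) (at z)"
    "\<And>z. z \<in> U \<Longrightarrow> (f' has_derivative blinfun_apply (f'' z)) (at z)"
    "\<And>z. z \<in> U \<Longrightarrow> D1 f z = blinfun_apply (f' z)"
    "\<And>z a b. z \<in> U \<Longrightarrow> D2 f z a b = blinfun_apply (blinfun_apply (f'' z) b) a"
    using C2_on_D1_D2[OF f] by metis
  obtain g' g'' where G: "\<And>z. z \<in> V \<Longrightarrow> (g has_derivative blinfun_apply (g' z)) (at z)"
    "\<And>z. z \<in> V \<Longrightarrow> (g' has_derivative blinfun_apply (g'' z)) (at z)"
    "\<And>z. z \<in> V \<Longrightarrow> D1 g z = blinfun_apply (g' z)"
    "\<And>z a b. z \<in> V \<Longrightarrow> D2 g z a b = blinfun_apply (blinfun_apply (g'' z) b) a"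
    using C2_on_D1_D2[OF g] by metis
  have D: "D1 (\<lambda>z. g (f z)) z a = blinfun_apply (g' (f z)) (blinfun_apply (f' z) a)" if "z \<in> U" for z a
  proof -
    have "f z \<in> V" using fU that by auto
    from frechet_derivative_at[OF has_derivative_compose[OF F(1)[OF that] G(1)[OF this]]]
    show ?thesis by (simp add: D1_def) metis
  qed
  have fz: "f z \<in> V" using fU z by auto
  show "D1 (\<lambda>z. g (f z)) z a = D1 g (f z) (D1 f z a)"
    using D[OF z] by (simp add: F(3)[OF z] G(3)[OF fz])
  have h1: "((\<lambda>w. g' (f w)) has_derivative (\<lambda>b. blinfun_apply (g'' (f z)) (blinfun_apply (f' z) b))) (at z)"
    by (rule has_derivative_compose[OF F(1)[OF z] G(2)[OF fz]])
  have h2: "((\<lambda>w. blinfun_apply (f' w) a) has_derivative (\<lambda>b. blinfun_apply (blinfun_apply (f'' z) b) a)) (at z)"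
    using bounded_linear.has_derivative[OF blinfun.bounded_linear_left F(2)[OF z]] by simp
  have "((\<lambda>w. blinfun_apply (g' (f w)) (blinfun_apply (f' w) a)) has_derivative
     (\<lambda>b. blinfun_apply (g' (f z)) (blinfun_apply (blinfun_apply (f'' z) b) a)
        + blinfun_apply (blinfun_apply (g'' (f z)) (blinfun_apply (f' z) b)) (blinfun_apply (f' z) a))) (at z)"
    by (rule blinfun.FDERIV[OF h1 h2])
  then have "((\<lambda>w. D1 (\<lambda>z. g (f z)) w a) has_derivative
     (\<lambda>b. blinfun_apply (g' (f z)) (blinfun_apply (blinfun_apply (f'' z) b) a)
        + blinfun_apply (blinfun_apply (g'' (f z)) (blinfun_apply (f' z) b)) (blinfun_apply (f' z) a))) (at z)"
    by (rule has_derivative_transform_within_open[OF _ \<open>open U\<close> z]) (simp add: D)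
  from fun_cong[OF frechet_derivative_at[OF this], of b]
  show "D2 (\<lambda>z. g (f z)) z a b = D2 g (f z) (D1 f z a) (D1 f z b) + D1 g (f z) (D2 f z a b)"
    unfolding F(3)[OF z] F(4)[OF z] G(4)[OF fz] G(3)[OF fz] by (simp add: D2_def add.commute)
qed

lemma D1_D2_eq_on_open:
  assumes "open W" "z \<in> W" "\<And>w. w \<in> W \<Longrightarrow> f w = g w"
  shows "D1 f z = D1 g z" "D2 f z = D2 g z"
proof -
  have *: "(f has_derivative D) (at w) \<longleftrightarrow> (g has_derivative D) (at w)" if "w \<in> W" for w D
    using has_derivative_transform_within_open[OF _ assms(1) that] assms(3) by metis
  have D1: "D1 f w = D1 g w" if "w \<in> W" for w
    unfolding D1_def frechet_derivative_def *[OF that] ..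
  show "D1 f z = D1 g z" using D1 assms(2) .
  have "((\<lambda>w. D1 f w a) has_derivative D) (at z) \<longleftrightarrow> ((\<lambda>w. D1 g w a) has_derivative D) (at z)" for a D
    using has_derivative_transform_within_open[OF _ assms(1,2), of "\<lambda>w. D1 f w a" D UNIV "\<lambda>w. D1 g w a"]
      has_derivative_transform_within_open[OF _ assms(1,2), of "\<lambda>w. D1 g w a" D UNIV "\<lambda>w. D1 f w a"] D1 by auto
  then show "D2 f z = D2 g z" unfolding D2_def[abs_def] frechet_derivative_def by simp
qed

text \<open>At points of the boundary line this follows from the interior by continuity of the
  derivatives.  It makes boundary charts behave like interior ones.\<close>

lemma D1_D2_eq_on_half_plane:
  fixes f g :: "real \<times> real \<Rightarrow> 'b::real_normed_vector"
  assumes f: "C2_on U f" and g: "C2_on U g" and "open U" and z: "z \<in> U \<inter> half_plane"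
    and eq: "\<And>w. w \<in> U \<inter> half_plane \<Longrightarrow> f w = g w"
  shows "D1 f z a = D1 g z a" "D2 f z a b = D2 g z a b"
proof -
  obtain f' f'' where F: "continuous_on U f'" "continuous_on U f''"
    "\<And>z. z \<in> U \<Longrightarrow> D1 f z = blinfun_apply (f' z)"
    "\<And>z a b. z \<in> U \<Longrightarrow> D2 f z a b = blinfun_apply (blinfun_apply (f'' z) b) a"
    using C2_on_D1_D2[OF f \<open>open U\<close>] by metis
  obtain g' g'' where G: "continuous_on U g'" "continuous_on U g''"
    "\<And>z. z \<in> U \<Longrightarrow> D1 g z = blinfun_apply (g' z)"
    "\<And>z a b. z \<in> U \<Longrightarrow> D2 g z a b = blinfun_apply (blinfun_apply (g'' z) b) a"
    using C2_on_D1_D2[OF g \<open>open U\<close>] by metis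
  define W where "W = U \<inter> {w. 0 < snd w}"
  have W: "open W" unfolding W_def using \<open>open U\<close> by (intro open_Int open_Collect_less continuous_intros)
  have WU: "W \<subseteq> U" by (auto simp: W_def)
  have int: "D1 f w = D1 g w" "D2 f w = D2 g w" if "w \<in> W" for w
  proof -
    have "f w = g w" if "w \<in> W" for w using eq that by (auto simp: W_def half_plane_def)
    from D1_D2_eq_on_open[OF W that this] show "D1 f w = D1 g w" "D2 f w = D2 g w" by auto
  qed
  \<comment> \<open>approach \<open>z\<close> from the interior of the half plane\<close>
  define x where "x n = z + (0, 1 / real (Suc n))" for n
  have "(\<lambda>n. z + (0, 1 / real (Suc n))) \<longlonglongrightarrow> z + (0, 0)"
    by (intro tendsto_intros) real_asymp
  then have x: "x \<longlonglongrightarrow> z" by (simp add: x_def[abs_def] zero_prod_def[symmetric])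
  have "\<forall>\<^sub>F n in sequentially. x n \<in> U" using x \<open>open U\<close> z by (auto intro: topological_tendstoD)
  moreover have "0 < snd (x n)" for n using z by (auto simp: x_def half_plane_def add_nonneg_pos)
  ultimately have xW: "\<forall>\<^sub>F n in sequentially. x n \<in> W" by (auto simp: W_def)
  have zU: "z \<in> U" using z by auto
  have c: "isCont h z" if "continuous_on U h" for h :: "real \<times> real \<Rightarrow> 'c::topological_space"
    using that \<open>open U\<close> zU by (simp add: continuous_on_eq_continuous_at)
  have l: "(\<lambda>n. f' (x n)) \<longlonglongrightarrow> f' z" "(\<lambda>n. f'' (x n)) \<longlonglongrightarrow> f'' z"
     "(\<lambda>n. g' (x n)) \<longlonglongrightarrow> g' z" "(\<lambda>n. g'' (x n)) \<longlonglongrightarrow> g'' z"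
    using isCont_tendsto_compose[OF c[OF F(1)] x] isCont_tendsto_compose[OF c[OF F(2)] x]
      isCont_tendsto_compose[OF c[OF G(1)] x] isCont_tendsto_compose[OF c[OF G(2)] x] by auto
  have "(\<lambda>n. blinfun_apply (f' (x n)) a - blinfun_apply (g' (x n)) a) \<longlonglongrightarrow> blinfun_apply (f' z) a - blinfun_apply (g' z) a"
    by (intro tendsto_intros l)
  moreover have "\<forall>\<^sub>F n in sequentially. blinfun_apply (f' (x n)) a - blinfun_apply (g' (x n)) a = 0"
    using xW
  proof eventually_elim
    case (elim n)
    then have "D1 f (x n) = D1 g (x n)" "x n \<in> U" using int WU by auto
    then show ?case using F(3) G(3) by simp
  qed
  ultimately have "blinfun_apply (f' z) a - blinfun_apply (g' z) a = 0"
    by (blast intro: LIMSEQ_unique tendsto_eventually)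
  then show "D1 f z a = D1 g z a" using F(3)[OF zU] G(3)[OF zU] by simp
  have "(\<lambda>n. blinfun_apply (blinfun_apply (f'' (x n)) b) a - blinfun_apply (blinfun_apply (g'' (x n)) b) a)
    \<longlonglongrightarrow> blinfun_apply (blinfun_apply (f'' z) b) a - blinfun_apply (blinfun_apply (g'' z) b) a"
    by (intro tendsto_intros l)
  moreover have "\<forall>\<^sub>F n in sequentially. blinfun_apply (blinfun_apply (f'' (x n)) b) a - blinfun_apply (blinfun_apply (g'' (x n)) b) a = 0"
    using xW
  proof eventually_elim
    case (elim n)
    then have "D2 f (x n) a b = D2 g (x n) a b" "x n \<in> U" using int WU by auto
    then show ?case using F(4) G(4) by simp
  qed
  ultimately have "blinfun_apply (blinfun_apply (f'' z) b) a - blinfun_apply (blinfun_apply (g'' z) b) a = 0"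
    by (blast intro: LIMSEQ_unique tendsto_eventually)
  then show "D2 f z a b = D2 g z a b" using F(4)[OF zU] G(4)[OF zU] by simp
qed

text \<open>The second difference \<open>f (z + t a + t b) - f (z + t a) - f (z + t b) + f z\<close> is symmetric in
  \<open>a\<close> and \<open>b\<close>; divided by \<open>t\<^sup>2\<close> it tends to the second derivative, by the mean value theorem in
  one direction and strict differentiability in the other.\<close>

lemma D2_symmetric_real:
  fixes f :: "'a::real_normed_vector \<Rightarrow> real"
  assumes f: "C2_on U f" "open U" and z: "z \<in> U"
  shows "D2 f z a b = D2 f z b a"
proof -
  obtain f' f'' where F: "\<And>z. z \<in> U \<Longrightarrow> (f has_derivative blinfun_apply (f' z)) (at z)"
    "\<And>z. z \<in> U \<Longrightarrow> (f' has_derivative blinfun_apply (f'' z)) (at z)"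
    "continuous_on U f''"
    "\<And>z a b. z \<in> U \<Longrightarrow> D2 f z a b = blinfun_apply (blinfun_apply (f'' z) b) a"
    using C2_on_D1_D2[OF f] by metis
  obtain d where d: "d > 0" "ball z d \<subseteq> U" using f(2) z open_contains_ball by blast
  define N where "N = norm a + norm b + 1"
  have N: "N > 0" "norm a + norm b < N" by (auto simp: N_def add_nonneg_pos)
  define t where "t n = d / N / real (Suc n)" for n
  have tpos: "0 < t n" for n using d N by (simp add: t_def)
  have t0: "t \<longlonglongrightarrow> 0" unfolding t_def by real_asymp
  have tle: "t n \<le> d / N" for n unfolding t_def
    using d(1) N(1) divide_left_mono[of 1 "real (Suc n)" "d / N"] by simp
  define S where "S t = f (z + t *\<^sub>R a + t *\<^sub>R b) - f (z + t *\<^sub>R a) - f (z + t *\<^sub>R b) + f z" for t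
  have key: "(\<lambda>n. S (t n) / t n / t n) \<longlonglongrightarrow> blinfun_apply (blinfun_apply (f'' z) b) a"
    if ab: "norm a + norm b < N" and S: "\<And>t. S t = f (z + t *\<^sub>R a + t *\<^sub>R b) - f (z + t *\<^sub>R a) - f (z + t *\<^sub>R b) + f z"
    for a b
  proof -
    have inU: "z + s *\<^sub>R a + s' *\<^sub>R b \<in> U" if "0 \<le> s" "s \<le> t n" "0 \<le> s'" "s' \<le> t n" for s s' n
    proof -
      have "norm (s *\<^sub>R a + s' *\<^sub>R b) \<le> norm (s *\<^sub>R a) + norm (s' *\<^sub>R b)" by (rule norm_triangle_ineq)
      also have "\<dots> \<le> t n * norm a + t n * norm b" using that by (auto intro!: add_mono mult_right_mono)
      also have "\<dots> = t n * (norm a + norm b)" by (simp add: algebra_simps)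
      also have "\<dots> < t n * N" using ab tpos by (intro mult_strict_left_mono) auto
      also have "\<dots> \<le> d" using tle[of n] N by (simp add: field_simps)
      finally show ?thesis using d(2) by (auto simp: subset_iff dist_norm norm_minus_commute add.assoc)
    qed
    have "\<exists>\<xi>. 0 < \<xi> \<and> \<xi> < t n \<and> S (t n) = t n * (blinfun_apply (f' (z + \<xi> *\<^sub>R a + t n *\<^sub>R b)) a - blinfun_apply (f' (z + \<xi> *\<^sub>R a)) a)" for n
    proof -
      have D: "((\<lambda>s. f (z + s *\<^sub>R a + t n *\<^sub>R b) - f (z + s *\<^sub>R a)) has_real_derivative
        blinfun_apply (f' (z + s *\<^sub>R a + t n *\<^sub>R b)) a - blinfun_apply (f' (z + s *\<^sub>R a)) a) (at s)"
        if s: "0 \<le> s" "s \<le> t n" for s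
      proof -
        have l: "((\<lambda>s. z + s *\<^sub>R a + c) has_derivative (\<lambda>h. h *\<^sub>R a)) (at s)" for c
          by (auto intro!: derivative_eq_intros)
        have D1: "((\<lambda>s. f (z + s *\<^sub>R a + s' *\<^sub>R b)) has_real_derivative blinfun_apply (f' (z + s *\<^sub>R a + s' *\<^sub>R b)) a) (at s)"
          if "0 \<le> s'" "s' \<le> t n" for s'
          using has_derivative_compose[OF l F(1)[OF inU[OF s that]]]
          by (simp add: has_field_derivative_def blinfun.scaleR_right mult_commute_abs)
        show ?thesis using DERIV_diff[OF D1[of "t n"] D1[of 0]] tpos[of n] by simp
      qed
      show ?thesis using MVT2[OF tpos[of n] D] by (auto simp: S algebra_simps)
    qed
    then obtain \<xi> where xi: "\<And>n. 0 < \<xi> n" "\<And>n. \<xi> n < t n"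
      "\<And>n. S (t n) = t n * (blinfun_apply (f' (z + \<xi> n *\<^sub>R a + t n *\<^sub>R b)) a - blinfun_apply (f' (z + \<xi> n *\<^sub>R a)) a)"
      by metis
    have "\<xi> \<longlonglongrightarrow> 0"
      by (rule tendsto_sandwich[OF _ _ tendsto_const t0]) (use xi in \<open>auto intro!: always_eventually less_imp_le\<close>)
    then have "(\<lambda>n. z + \<xi> n *\<^sub>R a) \<longlonglongrightarrow> z + 0 *\<^sub>R a" by (intro tendsto_intros)
    then have lim: "(\<lambda>n. z + \<xi> n *\<^sub>R a) \<longlonglongrightarrow> z" by simp
    have D: "((\<lambda>w. blinfun_apply (f' w) a) has_derivative (\<lambda>b. blinfun_apply (blinfun_apply (f'' w) b) a)) (at w)" if "w \<in> U" for w
      using bounded_linear.has_derivative[OF blinfun.bounded_linear_left F(2)[OF that]] by simp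
    have c: "isCont (\<lambda>w. blinfun_apply (blinfun_apply (f'' w) b) a) z"
      using F(3) f(2) z by (intro continuous_intros) (simp add: continuous_on_eq_continuous_at)
    have "(\<lambda>n. (blinfun_apply (f' (z + \<xi> n *\<^sub>R a + t n *\<^sub>R b)) a - blinfun_apply (f' (z + \<xi> n *\<^sub>R a)) a) / t n)
      \<longlonglongrightarrow> blinfun_apply (blinfun_apply (f'' z) b) a"
      using quotient_tendsto[OF f(2) z D c tpos t0 lim] .
    then show ?thesis using tpos by (simp add: xi(3) less_imp_neq[THEN not_sym])
  qed
  have "(\<lambda>n. S (t n) / t n / t n) \<longlonglongrightarrow> blinfun_apply (blinfun_apply (f'' z) b) a"
    by (rule key) (use N in \<open>auto simp: S_def\<close>)
  moreover have "(\<lambda>n. S (t n) / t n / t n) \<longlonglongrightarrow> blinfun_apply (blinfun_apply (f'' z) a) b"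
    by (rule key) (use N in \<open>auto simp: S_def algebra_simps\<close>)
  ultimately show ?thesis using F(4)[OF z] LIMSEQ_unique by metis
qed

lemma D1_D2_linear:
  assumes L: "bounded_linear L" and f: "C2_on U f" "open U" "z \<in> U"
  shows "D1 (\<lambda>z. L (f z)) z a = L (D1 f z a)" "D2 (\<lambda>z. L (f z)) z a b = L (D2 f z a b)"
proof -
  have 1: "D1 L w = L" for w
    unfolding D1_def using frechet_derivative_at[OF bounded_linear_imp_has_derivative[OF L]] by metis
  have 2: "D2 L w a b = 0" for w a b unfolding D2_def 1 by simp
  show "D1 (\<lambda>z. L (f z)) z a = L (D1 f z a)" "D2 (\<lambda>z. L (f z)) z a b = L (D2 f z a b)"
    using D1_D2_compose[OF f(1,2) C2_on_bounded_linear[OF L, of UNIV] open_UNIV _ f(3)] by (auto simp: 1 2)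
qed

lemma D2_symmetric:
  fixes f :: "'a::real_normed_vector \<Rightarrow> 'b::euclidean_space"
  assumes f: "C2_on U f" "open U" and z: "z \<in> U"
  shows "D2 f z a b = D2 f z b a"
proof (rule euclidean_eqI)
  fix i :: 'b assume "i \<in> Basis"
  have L: "bounded_linear (\<lambda>y. y \<bullet> i)" by (rule bounded_linear_inner_left)
  show "D2 f z a b \<bullet> i = D2 f z b a \<bullet> i"
    using D2_symmetric_real[OF C2_on_bounded_linear_compose[OF L f(1)] f(2) z, of a b]
    by (simp add: D1_D2_linear[OF L f z])
qed

lemma D1_bounded_linear:
  assumes "C2_on U f" "open U" "z \<in> U" shows "bounded_linear (D1 f z)"
proof -
  obtain f' where "\<And>z. z \<in> U \<Longrightarrow> D1 f z = blinfun_apply (f' z)" using C2_on_D1_D2[OF assms(1,2)] by metis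
  then show ?thesis using assms(3) by (simp add: blinfun.bounded_linear_right)
qed

lemma D2_bounded_linear:
  assumes "C2_on U f" "open U" "z \<in> U" shows "bounded_linear (D2 f z a)" "bounded_linear (\<lambda>a. D2 f z a b)"
proof -
  obtain f'' where "\<And>z a b. z \<in> U \<Longrightarrow> D2 f z a b = blinfun_apply (blinfun_apply (f'' z) b) a"
    using C2_on_D1_D2[OF assms(1,2)] by metis
  then have "D2 f z = (\<lambda>a b. blinfun_apply (blinfun_apply (f'' z) b) a)" using assms(3) by blast
  then show "bounded_linear (D2 f z a)" "bounded_linear (\<lambda>a. D2 f z a b)"
    by (auto simp: blinfun.bounded_linear_right
        intro!: bounded_linear_compose[OF blinfun.bounded_linear_left])
qed

text \<open>The inverse function theorem provides a differentiable inverse; Cramer's rule expresses its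
  derivative by rational functions of the first derivatives of \<open>f\<close>, which are of class \<open>C\<^sup>1\<close>.\<close>

lemma C2_inverse_function:
  fixes f :: "real \<times> real \<Rightarrow> real \<times> real"
  assumes f: "C2_on U f" "open U" and z0: "z0 \<in> U" and inj: "inj (D1 f z0)"
  obtains U' V g where "open U'" "U' \<subseteq> U" "z0 \<in> U'" "open V" "homeomorphism U' V f g" "C2_on V g"
    "\<And>z. z \<in> U' \<Longrightarrow> bij (D1 f z)"
proof -
  obtain f' :: "real \<times> real \<Rightarrow> (real \<times> real) \<Rightarrow>\<^sub>L (real \<times> real)" where
    F: "\<And>z. z \<in> U \<Longrightarrow> (f has_derivative blinfun_apply (f' z)) (at z)" "C1_on U f'"
    using f(1) unfolding C2_on_iff_C1_derivative by blast
  have D: "D1 f z = blinfun_apply (f' z)" if "z \<in> U" for z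
    unfolding D1_def using frechet_derivative_at[OF F(1)[OF that]] by simp
  have "linear (blinfun_apply (f' z0))" by (rule bounded_linear.linear) (rule blinfun.bounded_linear_right)
  then obtain h where h: "linear h" "h \<circ> blinfun_apply (f' z0) = id"
    using linear_injective_left_inverse inj D[OF z0] by metis
  have "bounded_linear h" using h(1) by (simp add: linear_conv_bounded_linear)
  then have "Blinfun h o\<^sub>L f' z0 = id_blinfun"
    using h(2) by (intro blinfun_eqI) (simp add: bounded_linear_Blinfun_apply, metis comp_apply id_apply)
  from inverse_function_theorem[OF f(2) F(1) C1_on_imp_continuous_on[OF F(2)] z0 this]
  obtain U' V g g' where 1: "open U'" "U' \<subseteq> U" "z0 \<in> U'" "open V" "homeomorphism U' V f g"
    and g': "\<And>y. y \<in> V \<Longrightarrow> (g has_derivative g' y) (at y)"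
      "\<And>y. y \<in> V \<Longrightarrow> g' y = inv (blinfun_apply (f' (g y)))"
      "\<And>y. y \<in> V \<Longrightarrow> bij (blinfun_apply (f' (g y)))" by metis
  have gV: "g ` V = U'" "continuous_on V g" "f ` U' = V" using 1(5) by (auto simp: homeomorphism_def)
  have gf: "\<And>z. z \<in> U' \<Longrightarrow> g (f z) = z" using 1(5) by (auto simp: homeomorphism_def)
  define a where "a z = fst (blinfun_apply (f' z) (1, 0))" for z
  define b where "b z = snd (blinfun_apply (f' z) (1, 0))" for z
  define c where "c z = fst (blinfun_apply (f' z) (0, 1))" for z
  define d where "d z = snd (blinfun_apply (f' z) (0, 1))" for z
  define J where "J z = a z * d z + (- 1) * (b z * c z)" for z
  have ap: "blinfun_apply (f' z) h = (a z * fst h + c z * snd h, b z * fst h + d z * snd h)" for z h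
  proof -
    have "h = fst h *\<^sub>R (1, 0) + snd h *\<^sub>R (0, 1)" by (cases h) auto
    then have "blinfun_apply (f' z) h = fst h *\<^sub>R blinfun_apply (f' z) (1, 0) + snd h *\<^sub>R blinfun_apply (f' z) (0, 1)"
      by (metis blinfun.add_right blinfun.scaleR_right)
    then show ?thesis by (simp add: prod_eq_iff a_def b_def c_def d_def)
  qed
  have J0: "J (g y) \<noteq> 0" if y: "y \<in> V" for y
  proof
    assume J: "J (g y) = 0"
    have i: "inj (blinfun_apply (f' (g y)))" using g'(3)[OF y] by (simp add: bij_is_inj)
    have "blinfun_apply (f' (g y)) (d (g y), - b (g y)) = 0"
      using J by (simp add: ap J_def zero_prod_def algebra_simps)
    then have "(d (g y), - b (g y)) = 0" using i by (metis blinfun.zero_right injD)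
    then have "d (g y) = 0" "b (g y) = 0" by (auto simp: zero_prod_def)
    moreover have "blinfun_apply (f' (g y)) (c (g y), - a (g y)) = 0"
      using J by (simp add: ap J_def zero_prod_def algebra_simps)
    then have "(c (g y), - a (g y)) = 0" using i by (metis blinfun.zero_right injD)
    then have "c (g y) = 0" "a (g y) = 0" by (auto simp: zero_prod_def)
    ultimately have "blinfun_apply (f' (g y)) (1, 0) = blinfun_apply (f' (g y)) 0" by (simp add: ap blinfun.zero_right zero_prod_def)
    then show False using i by (metis injD one_neq_zero zero_prod_def prod.inject)
  qed
  define B1 :: "(real \<times> real) \<Rightarrow>\<^sub>L (real \<times> real)" where "B1 = Blinfun (\<lambda>h. (fst h, 0))"
  define B2 :: "(real \<times> real) \<Rightarrow>\<^sub>L (real \<times> real)" where "B2 = Blinfun (\<lambda>h. (snd h, 0))"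
  define B3 :: "(real \<times> real) \<Rightarrow>\<^sub>L (real \<times> real)" where "B3 = Blinfun (\<lambda>h. (0, fst h))"
  define B4 :: "(real \<times> real) \<Rightarrow>\<^sub>L (real \<times> real)" where "B4 = Blinfun (\<lambda>h. (0, snd h))"
  have B: "blinfun_apply B1 h = (fst h, 0)" "blinfun_apply B2 h = (snd h, 0)"
    "blinfun_apply B3 h = (0, fst h)" "blinfun_apply B4 h = (0, snd h)" for h
    unfolding B1_def B2_def B3_def B4_def
    by (subst bounded_linear_Blinfun_apply; auto intro!: bounded_linear_Pair bounded_linear_fst bounded_linear_snd bounded_linear_zero)+
  define G' where "G' y = (inverse (J (g y)) * d (g y)) *\<^sub>R B1 + (((- inverse (J (g y))) * c (g y)) *\<^sub>R B2
      + (((- inverse (J (g y))) * b (g y)) *\<^sub>R B3 + (inverse (J (g y)) * a (g y)) *\<^sub>R B4))" for y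
  have gG: "(g has_derivative blinfun_apply (G' y)) (at y)" if y: "y \<in> V" for y
  proof -
    have "g' y h = blinfun_apply (G' y) h" for h
    proof -
      have "blinfun_apply (f' (g y)) (blinfun_apply (G' y) h) = h"
      proof -
        define i where "i = inverse (J (g y))"
        have i: "i * J (g y) = 1" using J0[OF y] by (simp add: i_def)
        have "blinfun_apply (G' y) h = (i * (d (g y) * fst h - c (g y) * snd h), i * (a (g y) * snd h - b (g y) * fst h))"
          unfolding G'_def i_def[symmetric] plus_blinfun.rep_eq scaleR_blinfun.rep_eq B
          by (simp add: algebra_simps)
        moreover have "a (g y) * (i * (d (g y) * fst h - c (g y) * snd h)) + c (g y) * (i * (a (g y) * snd h - b (g y) * fst h))
            = (i * J (g y)) * fst h"
          "b (g y) * (i * (d (g y) * fst h - c (g y) * snd h)) + d (g y) * (i * (a (g y) * snd h - b (g y) * fst h))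
            = (i * J (g y)) * snd h"
          by (simp_all add: J_def algebra_simps)
        ultimately show ?thesis unfolding ap by (simp add: i)
      qed
      then show ?thesis unfolding g'(2)[OF y] using g'(3)[OF y]
        by (metis bij_inv_eq_iff)
    qed
    then show ?thesis using g'(1)[OF y] by (metis ext)
  qed
  have C1f: "C1_on U' a" "C1_on U' b" "C1_on U' c" "C1_on U' d"
    unfolding a_def[abs_def] b_def[abs_def] c_def[abs_def] d_def[abs_def]
    by (rule C1_on_bounded_linear_compose[OF _ C1_on_subset[OF F(2) 1(2)]],
       rule bounded_linear_compose[OF bounded_linear_fst blinfun.bounded_linear_left]
       bounded_linear_compose[OF bounded_linear_snd blinfun.bounded_linear_left])+
  have C1J: "C1_on U' J" unfolding J_def[abs_def]
    by (intro C1_on_add C1_on_bilinear[OF bounded_bilinear_mult] C1_on_const C1f)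
  have cont: "continuous_on V (\<lambda>y. h (g y))" if "C1_on U' h" for h :: "real \<times> real \<Rightarrow> real"
    using continuous_on_compose2[OF C1_on_imp_continuous_on[OF that] gV(2)] gV(1) by simp
  have "continuous_on V G'"
    unfolding G'_def[abs_def] using J0
    by (intro continuous_intros cont C1f C1J) auto
  then have C1g: "C1_on V g" using gG by (intro C1_onI)
  have C1i: "C1_on (- {0}) (inverse :: real \<Rightarrow> real)"
    by (rule C1_on_real[where f' = "\<lambda>t. - (inverse t ^ 2)"])
      (auto intro!: continuous_intros derivative_eq_intros simp: power2_eq_square)
  have cg: "C1_on V (\<lambda>y. h (g y))" if "C1_on U' h" for h :: "real \<times> real \<Rightarrow> real"
    using C1_on_compose[OF C1g that] gV(1) by simp
  have iJ: "C1_on V (\<lambda>y. inverse (J (g y)))"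
    by (rule C1_on_compose[OF cg[OF C1J] C1i]) (use J0 in auto)
  have niJ: "C1_on V (\<lambda>y. - inverse (J (g y)))"
    by (rule C1_on_bounded_linear_compose[OF bounded_linear_minus[OF bounded_linear_ident] iJ])
  have "C1_on V G'" unfolding G'_def[abs_def]
    by (intro C1_on_add C1_on_bilinear[OF bounded_bilinear_scaleR] C1_on_bilinear[OF bounded_bilinear_mult]
        iJ niJ cg C1f C1_on_const)
  then have "C2_on V g" using gG by (intro C2_onI)
  moreover have "bij (D1 f z)" if "z \<in> U'" for z
    using g'(3)[of "f z"] gV(3) that gf[OF that] D 1(2) by (metis image_eqI subsetD)
  ultimately show ?thesis using that 1 by blast
qed

section \<open>Orthonormal frames and traces\<close>

lemma form_simps:
  "form \<kappa> (a + b) c = form \<kappa> a c + form \<kappa> b c" "form \<kappa> c (a + b) = form \<kappa> c a + form \<kappa> c b"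
  "form \<kappa> (r *\<^sub>R a) c = r * form \<kappa> a c" "form \<kappa> c (r *\<^sub>R a) = r * form \<kappa> c a"
  "form \<kappa> (a - b) c = form \<kappa> a c - form \<kappa> b c" "form \<kappa> c (a - b) = form \<kappa> c a - form \<kappa> c b"
  "form \<kappa> (- a) c = - form \<kappa> a c" "form \<kappa> c (- a) = - form \<kappa> c a"
  "form \<kappa> 0 c = 0" "form \<kappa> c 0 = 0"
  by (simp_all add: form_def algebra_simps)

lemma form_commute: "form \<kappa> a b = form \<kappa> b a"
  by (simp add: form_def mult.commute)

lemma bounded_bilinear_form: "bounded_bilinear (form \<kappa>)"
  unfolding bilinear_conv_bounded_bilinear[symmetric] bilinear_def
  by (auto intro!: linearI simp: form_simps)

lemma bounded_bilinear_metric_form: "bounded_bilinear (metric_form \<kappa>)"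
  unfolding bilinear_conv_bounded_bilinear[symmetric] bilinear_def
  by (auto intro!: linearI simp: metric_form_def form_simps algebra_simps)

lemma metric_form_commute: "metric_form \<kappa> a b = metric_form \<kappa> b a"
  by (simp add: metric_form_def form_commute mult.commute)

text \<open>For \<open>\<kappa> = -1\<close> this is the reversed Cauchy-Schwarz inequality: vectors orthogonal to a
  timelike vector are spacelike.\<close>

lemma tangent_form_pos:
  assumes "\<kappa> \<in> {-1, 1}" "form \<kappa> x x = \<kappa>" "form \<kappa> x w = 0" "w \<noteq> 0"
  shows "form \<kappa> w w > 0"
proof (cases "\<kappa> = 1")
  case True
  have "w \<bullet> w > 0" using assms(4) by simp
  then show ?thesis using True by (simp add: form_def inner_vec_def sum_3)
next
  case False
  then have k: "\<kappa> = -1" using assms(1) by simp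
  have x3: "(x$3)\<^sup>2 = 1 + (x$1)\<^sup>2 + (x$2)\<^sup>2" using assms(2) by (simp add: k form_def power2_eq_square)
  have xw: "x$3 * w$3 = x$1 * w$1 + x$2 * w$2" using assms(3) by (simp add: k form_def)
  define s where "s = (w$1)\<^sup>2 + (w$2)\<^sup>2"
  have "(x$1 * w$1 + x$2 * w$2)\<^sup>2 + (x$1 * w$2 - x$2 * w$1)\<^sup>2 = ((x$1)\<^sup>2 + (x$2)\<^sup>2) * s"
    by (simp add: s_def power2_eq_square algebra_simps)
  then have "(x$3 * w$3)\<^sup>2 \<le> ((x$3)\<^sup>2 - 1) * s" using x3 by (simp add: xw) (smt (verit) zero_le_power2)
  then have le: "s \<le> (x$3)\<^sup>2 * (s - (w$3)\<^sup>2)" by (simp add: power_mult_distrib algebra_simps)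
  have s0: "s > 0"
  proof (rule ccontr)
    assume "\<not> s > 0"
    then have "w$1 = 0 \<and> w$2 = 0" by (simp add: s_def not_less sum_power2_le_zero_iff)
    moreover from this have "x$3 * w$3 = 0" using xw by simp
    moreover have "x$3 \<noteq> 0" using x3 by (smt (verit) zero_le_power2 power_zero_numeral)
    ultimately have "w = 0" by (simp add: vec_eq_iff forall_3)
    then show False using assms(4) by simp
  qed
  have "0 < (x$3)\<^sup>2 * (s - (w$3)\<^sup>2)" using le s0 by linarith
  then have "s - (w$3)\<^sup>2 > 0" by (simp add: zero_less_mult_iff)
  then show ?thesis by (simp add: k form_def s_def power2_eq_square)
qed

lemma tangent_form_nonneg:
  assumes "\<kappa> \<in> {-1, 1}" "form \<kappa> x x = \<kappa>" "form \<kappa> x w = 0"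
  shows "form \<kappa> w w \<ge> 0"
  using tangent_form_pos[OF assms] by (cases "w = 0") (auto simp: form_simps intro: less_imp_le)

definition frame :: "real \<Rightarrow> real^3 \<Rightarrow> real^3 \<Rightarrow> real^3 \<Rightarrow> bool" where
  "frame \<kappa> x e f \<longleftrightarrow> form \<kappa> x x = \<kappa> \<and> form \<kappa> e e = 1 \<and> form \<kappa> f f = 1 \<and>
     form \<kappa> x e = 0 \<and> form \<kappa> x f = 0 \<and> form \<kappa> e f = 0"

lemma frameD:
  assumes "frame \<kappa> x e f"
  shows "form \<kappa> x x = \<kappa>" "form \<kappa> e e = 1" "form \<kappa> f f = 1"
    "form \<kappa> x e = 0" "form \<kappa> x f = 0" "form \<kappa> e f = 0"
    "form \<kappa> e x = 0" "form \<kappa> f x = 0" "form \<kappa> f e = 0"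
  using assms unfolding frame_def by (auto simp: form_commute)

text \<open>Expansion in the frame is a left inverse of forming linear combinations, hence a two-sided
  inverse.\<close>

lemma frame_expansion:
  assumes \<kappa>: "\<kappa> \<in> {-1, 1}" and F: "frame \<kappa> x e f"
  shows "y = (\<kappa> * form \<kappa> y x) *\<^sub>R x + form \<kappa> y e *\<^sub>R e + form \<kappa> y f *\<^sub>R f"
proof -
  define Q :: "real^3 \<Rightarrow> real^3" where "Q v = (v$1) *\<^sub>R x + (v$2) *\<^sub>R e + (v$3) *\<^sub>R f" for v
  define L :: "real^3 \<Rightarrow> real^3" where "L y = vector [\<kappa> * form \<kappa> y x, form \<kappa> y e, form \<kappa> y f]" for y
  have k2: "\<kappa> * \<kappa> = 1" using \<kappa> by auto
  have "linear Q" unfolding Q_def by (rule linearI) (auto simp: algebra_simps)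
  moreover have "linear L" unfolding L_def
    by (rule linearI) (auto simp: form_simps vec_eq_iff forall_3 algebra_simps)
  moreover have "L \<circ> Q = id"
    using k2 by (auto simp: fun_eq_iff L_def Q_def form_simps frameD[OF F] vec_eq_iff forall_3 algebra_simps)
  ultimately have "Q \<circ> L = id" using linear_inverse_left by blast
  then have "Q (L y) = y" by (metis comp_apply id_apply)
  then show ?thesis by (simp add: Q_def L_def)
qed

lemma frame_form_expansion:
  assumes \<kappa>: "\<kappa> \<in> {-1, 1}" and F: "frame \<kappa> x e f"
  shows "form \<kappa> y w = \<kappa> * form \<kappa> y x * form \<kappa> w x + form \<kappa> y e * form \<kappa> w e + form \<kappa> y f * form \<kappa> w f"
  by (subst frame_expansion[OF assms, of y]) (simp add: form_simps form_commute[of \<kappa> x w] form_commute[of \<kappa> e w] form_commute[of \<kappa> f w])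

lemma frame_swap: "frame \<kappa> x e f \<Longrightarrow> frame \<kappa> x f e"
  unfolding frame_def by (auto simp: form_commute)

lemma frame_rotate:
  assumes \<kappa>: "\<kappa> \<in> {-1, 1}" and F: "frame \<kappa> x e f" and c: "c\<^sup>2 + \<kappa> * s\<^sup>2 = 1"
  shows "frame \<kappa> (c *\<^sub>R x + s *\<^sub>R e) ((- \<kappa> * s) *\<^sub>R x + c *\<^sub>R e) f"
proof -
  have "c * c = 1 - \<kappa> * (s * s)" using c by (simp add: power2_eq_square)
  then show ?thesis using \<kappa> unfolding frame_def
    by (auto simp: form_simps frameD[OF F] algebra_simps)
qed

text \<open>The third vector is the cross product, corrected by the sign of the form in the last
  coordinate.\<close>

lemma frame_third_vector:
  assumes \<kappa>: "\<kappa> \<in> {-1, 1}" and x: "form \<kappa> x x = \<kappa>" "form \<kappa> x e = 0" "form \<kappa> e e = 1"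
  obtains f where "frame \<kappa> x e f"
proof -
  define f :: "real^3" where "f = vector [x$2 * e$3 - x$3 * e$2, x$3 * e$1 - x$1 * e$3, \<kappa> * (x$1 * e$2 - x$2 * e$1)]"
  have k2: "\<kappa> * \<kappa> = 1" using \<kappa> by auto
  have "form \<kappa> f f = \<kappa> * (form \<kappa> x x * form \<kappa> e e - (form \<kappa> x e)\<^sup>2)"
    using \<kappa> by (auto simp: f_def form_def power2_eq_square algebra_simps)
  then have "form \<kappa> f f = 1" using x k2 by simp
  moreover have "form \<kappa> x f = 0" "form \<kappa> e f = 0"
    using \<kappa> by (auto simp: f_def form_def algebra_simps)
  ultimately show ?thesis using that x unfolding frame_def by blast
qed

text \<open>Applied to the horizontal part \<open>n\<close> of the normal, this makes the first frame vector parallel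
  to the gradient.\<close>

lemma adapted_frame:
  assumes \<kappa>: "\<kappa> \<in> {-1, 1}" and x: "form \<kappa> x x = \<kappa>" and n: "form \<kappa> x n = 0"
  obtains e f where "frame \<kappa> x e f" "form \<kappa> n f = 0"
proof -
  have unit: "\<exists>f. frame \<kappa> x ((1 / sqrt (form \<kappa> v v)) *\<^sub>R v) f" if v: "form \<kappa> x v = 0" "v \<noteq> 0" for v
  proof -
    have "form \<kappa> v v > 0" using tangent_form_pos[OF \<kappa> x v] .
    then have "form \<kappa> ((1 / sqrt (form \<kappa> v v)) *\<^sub>R v) ((1 / sqrt (form \<kappa> v v)) *\<^sub>R v) = 1"
      by (simp add: form_simps)
    then show ?thesis using frame_third_vector[OF \<kappa> x, of "(1 / sqrt (form \<kappa> v v)) *\<^sub>R v"] v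
      by (metis form_simps(4) mult_zero_right)
  qed
  show ?thesis
  proof (cases "n = 0")
    case False
    obtain f where f: "frame \<kappa> x ((1 / sqrt (form \<kappa> n n)) *\<^sub>R n) f" using unit[OF n False] by blast
    have "form \<kappa> n n > 0" using tangent_form_pos[OF \<kappa> x n False] .
    moreover have "1 / sqrt (form \<kappa> n n) * form \<kappa> n f = 0" using frameD(6)[OF f] by (simp add: form_simps)
    ultimately have "form \<kappa> n f = 0" by simp
    then show ?thesis using that f by blast
  next
    case True
    define v :: "real^3" where "v = (if x$1 = 0 \<and> x$2 = 0 then vector [1, 0, 0] else vector [x$2, - x$1, 0])"
    have "form \<kappa> x v = 0" by (auto simp: v_def form_def)
    moreover have "v \<noteq> 0" by (auto simp: v_def vec_eq_iff forall_3)
    ultimately obtain f where "frame \<kappa> x ((1 / sqrt (form \<kappa> v v)) *\<^sub>R v) f" using unit by blast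
    then show ?thesis using that True by (auto simp: form_simps)
  qed
qed

lemma orthonormal_spans_plane:
  fixes I :: "real \<times> real \<Rightarrow> real \<times> real \<Rightarrow> real"
  assumes I: "bounded_bilinear I" and ab: "I a a = 1" "I b b = 1" "I a b = 0" and sym: "I b a = 0"
  obtains x y where "g = x *\<^sub>R a + y *\<^sub>R b"
proof -
  interpret I: bounded_bilinear I by (rule I)
  obtain a1 a2 b1 b2 g1 g2 where E: "a = (a1, a2)" "b = (b1, b2)" "g = (g1, g2)" by (metis surj_pair)
  define d where "d = a1 * b2 - a2 * b1"
  have "d \<noteq> 0"
  proof
    assume d: "d = 0"
    have "b2 *\<^sub>R a - a2 *\<^sub>R b = 0" "b1 *\<^sub>R a - a1 *\<^sub>R b = 0"
      using d by (simp_all add: E d_def zero_prod_def algebra_simps)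
    moreover have "I (r *\<^sub>R a - s *\<^sub>R b) a = r" "I (r *\<^sub>R a - s *\<^sub>R b) b = - s" for r s
      using ab sym by (simp_all add: I.diff_left I.scaleR_left)
    ultimately have "a1 = 0" "a2 = 0" by (metis I.zero_left neg_equal_0_iff_equal)+
    then have "a = 0" by (simp add: E zero_prod_def)
    then show False using ab(1) by (simp add: I.zero_left)
  qed
  then have "g = ((g1 * b2 - g2 * b1) / d) *\<^sub>R a + ((a1 * g2 - a2 * g1) / d) *\<^sub>R b"
    by (simp add: E field_simps) (simp add: d_def algebra_simps)
  then show ?thesis using that by blast
qed

text \<open>The trace of \<open>B\<close> with respect to \<open>I\<close>, computed in an orthonormal basis and in an arbitrary
  pair of vectors.\<close>

lemma trace_in_orthonormal_basis:
  fixes I B :: "real \<times> real \<Rightarrow> real \<times> real \<Rightarrow> real"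
  assumes I: "bounded_bilinear I" and B: "bounded_bilinear B"
    and sym: "\<And>a b. I a b = I b a" "\<And>a b. B a b = B b a"
    and ab: "I a a = 1" "I b b = 1" "I a b = 0"
  shows "(B a a + B b b) * (I g g * I h h - (I g h)\<^sup>2) = I h h * B g g - 2 * I g h * B g h + I g g * B h h"
proof -
  interpret I: bounded_bilinear I by (rule I)
  interpret B: bounded_bilinear B by (rule B)
  have ba: "I b a = 0" using ab sym by metis
  obtain x y where g: "g = x *\<^sub>R a + y *\<^sub>R b" using orthonormal_spans_plane[OF I ab ba] by blast
  obtain z w where h: "h = z *\<^sub>R a + w *\<^sub>R b" using orthonormal_spans_plane[OF I ab ba] by blast
  have Iv: "I g g = x * x + y * y" "I h h = z * z + w * w" "I g h = x * z + y * w"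
    using ab ba by (simp_all add: g h I.add_left I.add_right I.scaleR_left I.scaleR_right)
  have Bv: "B g g = x * x * B a a + 2 * x * y * B a b + y * y * B b b"
    "B h h = z * z * B a a + 2 * z * w * B a b + w * w * B b b"
    "B g h = x * z * B a a + (x * w + y * z) * B a b + y * w * B b b"
    by (simp_all add: g h B.add_left B.add_right B.scaleR_left B.scaleR_right sym(2)[of b a] algebra_simps)
  show ?thesis unfolding Iv Bv by (simp add: power2_eq_square algebra_simps)
qed

text \<open>Turning an orthonormal basis by a right angle changes the sign of the mixed entry of \<open>B\<close>, so
  it vanishes in between.\<close>

lemma exists_principal_basis:
  fixes I B :: "real \<times> real \<Rightarrow> real \<times> real \<Rightarrow> real"
  assumes I: "bounded_bilinear I" and B: "bounded_bilinear B"
    and sym: "\<And>a b. I a b = I b a" "\<And>a b. B a b = B b a"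
    and pos: "\<And>a. a \<noteq> 0 \<Longrightarrow> I a a > 0"
  obtains a b where "I a a = 1" "I b b = 1" "I a b = 0" "B a b = 0"
proof -
  interpret I: bounded_bilinear I by (rule I)
  interpret B: bounded_bilinear B by (rule B)
  define N where "N v = (1 / sqrt (I v v)) *\<^sub>R v" for v
  have N: "I (N v) (N v) = 1" if "v \<noteq> 0" for v
    using pos[OF that] by (simp add: N_def I.scaleR_left I.scaleR_right)
  define p where "p = N (1, 0)"
  define q0 where "q0 = (0, 1) - I (0, 1) p *\<^sub>R p"
  define q where "q = N q0"
  have p1: "I p p = 1" unfolding p_def by (rule N) (simp add: zero_prod_def)
  have "q0 \<noteq> 0" by (auto simp: q0_def p_def N_def zero_prod_def)
  then have q1: "I q q = 1" unfolding q_def by (rule N)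
  have "I q0 p = 0" by (simp add: q0_def I.diff_left I.scaleR_left p1)
  then have qp: "I q p = 0" by (simp add: q_def N_def I.scaleR_left)
  then have pq: "I p q = 0" using sym(1) by metis
  define a where "a t = cos t *\<^sub>R p + sin t *\<^sub>R q" for t
  define b where "b t = (- sin t) *\<^sub>R p + cos t *\<^sub>R q" for t
  have on: "I (a t) (a t) = 1" "I (b t) (b t) = 1" "I (a t) (b t) = 0" for t
    using sin_cos_squared_add3[of t]
    by (simp_all add: a_def b_def I.add_left I.add_right I.scaleR_left I.scaleR_right I.minus_left I.minus_right I.diff_left I.diff_right p1 q1 pq qp algebra_simps)
  define h where "h t = B (a t) (b t)" for t
  have "continuous_on {0..pi/2} h" unfolding h_def a_def b_def
    by (intro B.continuous_on continuous_intros)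
  moreover have "h (pi/2) = - h 0"
    by (simp add: h_def a_def b_def B.minus_right sym(2)[of q p])
  ultimately have "\<exists>t. 0 \<le> t \<and> t \<le> pi/2 \<and> h t = 0"
    using IVT'[of h 0 0 "pi/2"] IVT2'[of h "pi/2" 0 0] by (cases "h 0 \<le> 0") auto
  then obtain t where "h t = 0" by blast
  then show ?thesis using that on h_def by metis
qed

section \<open>Graph charts and the mean curvature\<close>

text \<open>The two frame components of the horizontal part: an orthographic projection onto the plane
  spanned by \<open>e\<close> and \<open>f\<close>.\<close>

definition proj :: "real \<Rightarrow> real^3 \<Rightarrow> real^3 \<Rightarrow> ambient \<Rightarrow> real \<times> real" where
  "proj \<kappa> e f p = (form \<kappa> (fst p) e, form \<kappa> (fst p) f)"

lemma bounded_linear_proj: "bounded_linear (proj \<kappa> e f)"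
  unfolding proj_def
  by (intro bounded_linear_Pair bounded_linear_compose[OF bounded_bilinear.bounded_linear_left[OF bounded_bilinear_form]]
      bounded_linear_fst)

text \<open>A local inverse \<open>G\<close> of the projection on the surface.  As the projection is linear,
  comparing \<open>G\<close> with any chart needs no further regularity; the existential clause provides a
  chart at each point that is nondegenerate under the projection.\<close>

definition graph_chart :: "real \<Rightarrow> ambient set \<Rightarrow> real^3 \<Rightarrow> real^3 \<Rightarrow> (real \<times> real) set \<Rightarrow> ambient set \<Rightarrow>
    (real \<times> real \<Rightarrow> ambient) \<Rightarrow> bool" where
  "graph_chart \<kappa> S e f V N G \<longleftrightarrow> open V \<and> open N \<and> C2_on V G \<and>
     (\<forall>m\<in>V. G m \<in> S \<inter> N \<and> proj \<kappa> e f (G m) = m \<and>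
        (\<exists>X z. chart_at S (G m) X z \<and> surj (\<lambda>a. proj \<kappa> e f (D1 X z a)))) \<and>
     (\<forall>p \<in> S \<inter> N. proj \<kappa> e f p \<in> V \<and> G (proj \<kappa> e f p) = p)"

text \<open>The projection of an interior chart is locally invertible of class \<open>C\<^sup>2\<close>, and composing the
  chart with the inverse gives \<open>G\<close>.  The open set \<open>N\<close> exists because charts are open maps into the
  surface.\<close>

lemma exists_graph_chart:
  assumes X: "chart S U X" and z0: "z0 \<in> U" "snd z0 > 0"
    and inj: "\<And>a. proj \<kappa> e f (D1 X z0 a) = 0 \<Longrightarrow> a = 0"
  obtains V N G where "graph_chart \<kappa> S e f V N G" "X z0 \<in> N"
proof -
  have U: "open U" "C2_on U X" and XO: "openin (top_of_set S) (X ` (U \<inter> half_plane))"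
    using X by (auto simp: chart_def)
  obtain Y where Y: "homeomorphism (U \<inter> half_plane) (X ` (U \<inter> half_plane)) X Y"
    using X by (auto simp: chart_def)
  define U1 where "U1 = U \<inter> {w. 0 < snd w}"
  have U1: "open U1" unfolding U1_def using U(1) by (intro open_Int open_Collect_less continuous_intros)
  have U1h: "U1 \<subseteq> U \<inter> half_plane" by (auto simp: U1_def half_plane_def)
  have C2X: "C2_on U1 X" using C2_on_subset[OF U(2)] U1h by auto
  define \<Theta> where "\<Theta> = (\<lambda>z. proj \<kappa> e f (X z))"
  have C2\<Theta>: "C2_on U1 \<Theta>" unfolding \<Theta>_def by (rule C2_on_bounded_linear_compose[OF bounded_linear_proj C2X])
  have D\<Theta>: "D1 \<Theta> z a = proj \<kappa> e f (D1 X z a)" if "z \<in> U1" for z a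
    unfolding \<Theta>_def by (rule D1_D2_linear(1)[OF bounded_linear_proj C2X U1 that])
  have z1: "z0 \<in> U1" using z0 by (auto simp: U1_def)
  have "inj (D1 \<Theta> z0)"
    using linear_injective_0[OF bounded_linear.linear[OF D1_bounded_linear[OF C2\<Theta> U1 z1]]]
    by (simp add: D\<Theta>[OF z1] inj)
  from C2_inverse_function[OF C2\<Theta> U1 z1 this]
  obtain U' V g where I: "open U'" "U' \<subseteq> U1" "z0 \<in> U'" "open V" "homeomorphism U' V \<Theta> g" "C2_on V g"
    "\<And>z. z \<in> U' \<Longrightarrow> bij (D1 \<Theta> z)" by metis
  have gV: "g ` V = U'" "\<Theta> ` U' = V" and g\<Theta>: "\<And>z. z \<in> U' \<Longrightarrow> g (\<Theta> z) = z" and \<Theta>g: "\<And>m. m \<in> V \<Longrightarrow> \<Theta> (g m) = m"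
    using I(5) by (auto simp: homeomorphism_def)
  have "openin (top_of_set (U \<inter> half_plane)) U'"
    using I(1,2) U1h unfolding openin_open by (intro exI[of _ U']) auto
  then have "openin (top_of_set (X ` (U \<inter> half_plane))) (X ` U')"
    by (rule homeomorphism_imp_open_map[OF Y])
  then have "openin (top_of_set S) (X ` U')" using XO openin_trans by blast
  then obtain N where N: "open N" "X ` U' = S \<inter> N" by (auto simp: openin_open)
  define G where "G m = X (g m)" for m
  have "graph_chart \<kappa> S e f V N G"
    unfolding graph_chart_def
  proof (intro conjI ballI IntI)
    show "C2_on V G" unfolding G_def[abs_def]
      by (rule C2_on_compose[OF I(6) C2X]) (use gV I(2) in auto)
    fix m assume m: "m \<in> V"
    have gm: "g m \<in> U'" using m gV by auto
    show "G m \<in> S" "G m \<in> N" using gm N(2) by (auto simp: G_def)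
    show "proj \<kappa> e f (G m) = m" using \<Theta>g[OF m] by (simp add: \<Theta>_def G_def)
    have "chart_at S (G m) X (g m)"
      unfolding chart_at_def using X gm I(2) U1h by (auto simp: G_def)
    moreover have "surj (\<lambda>a. proj \<kappa> e f (D1 X (g m) a))"
      using bij_is_surj[OF I(7)[OF gm]] D\<Theta> gm I(2) by (metis (no_types, lifting) ext subsetD)
    ultimately show "\<exists>X z. chart_at S (G m) X z \<and> surj (\<lambda>a. proj \<kappa> e f (D1 X z a))" by blast
  next
    fix p assume "p \<in> S \<inter> N"
    then obtain z where z: "z \<in> U'" "p = X z" using N(2) by (metis imageE)
    then have "proj \<kappa> e f p = \<Theta> z" by (simp add: \<Theta>_def)
    then show "proj \<kappa> e f p \<in> V" "G (proj \<kappa> e f p) = p"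
      using gV(2) z g\<Theta>[OF z(1)] by (auto simp: G_def)
  qed (use I N in auto)
  moreover have "X z0 \<in> N" using I(3) N(2) by auto
  ultimately show ?thesis using that by blast
qed

text \<open>Near \<open>z\<close>, on the half plane, \<open>X\<close> is \<open>G\<close> composed with the projection of \<open>X\<close>; differentiate
  twice.\<close>

lemma chart_factors:
  assumes G: "graph_chart \<kappa> S e f V N G" and X: "chart_at S p X z" and p: "p \<in> N"
  shows "D1 X z a = D1 G (proj \<kappa> e f p) (proj \<kappa> e f (D1 X z a))"
    and "D2 X z a b = D2 G (proj \<kappa> e f p) (proj \<kappa> e f (D1 X z a)) (proj \<kappa> e f (D1 X z b))
      + D1 G (proj \<kappa> e f p) (proj \<kappa> e f (D2 X z a b))"
proof -
  obtain U where U: "chart S U X" "z \<in> U \<inter> half_plane" "X z = p" using X unfolding chart_at_def by blast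
  have oU: "open U" and C2X: "C2_on U X" and "openin (top_of_set S) (X ` (U \<inter> half_plane))"
    using U(1) unfolding chart_def by blast+
  then have XS: "X ` (U \<inter> half_plane) \<subseteq> S" by (meson openin_imp_subset)
  have V: "open V" "open N" and C2G: "C2_on V G"
    and GN: "\<And>p. p \<in> S \<inter> N \<Longrightarrow> proj \<kappa> e f p \<in> V \<and> G (proj \<kappa> e f p) = p"
    using G by (auto simp: graph_chart_def)
  define W where "W = U \<inter> X -` (N \<inter> proj \<kappa> e f -` V)"
  have "open (proj \<kappa> e f -` V)"
    by (rule continuous_open_vimage[OF V(1)]) (simp add: linear_continuous_at bounded_linear_proj)
  then have W: "open W" unfolding W_def
    using continuous_on_open_vimage[OF oU, of X] C1_on_imp_continuous_on[OF C2_on_imp_C1_on[OF C2X]] V(2)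
    by (metis (no_types, lifting) Int_commute open_Int)
  have WU: "W \<subseteq> U" by (auto simp: W_def)
  have pS: "p \<in> S" using XS U by auto
  have zW: "z \<in> W" using U p GN[of p] pS by (auto simp: W_def)
  have C2W: "C2_on W X" using C2_on_subset[OF C2X WU] .
  have C2P: "C2_on W (\<lambda>w. proj \<kappa> e f (X w))" by (rule C2_on_bounded_linear_compose[OF bounded_linear_proj C2W])
  have im: "(\<lambda>w. proj \<kappa> e f (X w)) ` W \<subseteq> V" by (auto simp: W_def)
  have eq: "X w = G (proj \<kappa> e f (X w))" if "w \<in> W \<inter> half_plane" for w
    using GN[of "X w"] XS that by (auto simp: W_def)
  have zWh: "z \<in> W \<inter> half_plane" using zW U by auto
  note E = D1_D2_eq_on_half_plane[OF C2W C2_on_compose[OF C2P C2G im] W zWh eq]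
  note L = D1_D2_linear[OF bounded_linear_proj C2W W zW]
  note C = D1_D2_compose[OF C2P W C2G V(1) im zW]
  show "D1 X z a = D1 G (proj \<kappa> e f p) (proj \<kappa> e f (D1 X z a))"
    using E(1)[of a] C(1)[of a] unfolding L U(3) by simp
  show "D2 X z a b = D2 G (proj \<kappa> e f p) (proj \<kappa> e f (D1 X z a)) (proj \<kappa> e f (D1 X z b))
      + D1 G (proj \<kappa> e f p) (proj \<kappa> e f (D2 X z a b))"
    using E(2)[of a b] C(2)[of a b] unfolding L U(3) by simp
qed

lemma graph_chart_tangent:
  assumes G: "graph_chart \<kappa> S e f V N G" and m: "m \<in> V"
  shows "D1 G m c \<in> tangent_plane S (G m)"
proof -
  obtain X z where X: "chart_at S (G m) X z" "surj (\<lambda>a. proj \<kappa> e f (D1 X z a))"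
    and pm: "proj \<kappa> e f (G m) = m" "G m \<in> N" using G m unfolding graph_chart_def by blast
  obtain a where "c = proj \<kappa> e f (D1 X z a)" using X(2) by (metis surjD)
  then have "D1 G m c = D1 X z a" using chart_factors(1)[OF G X(1) pm(2), of a] pm(1) by simp
  then show ?thesis using X(1) unfolding tangent_plane_def by blast
qed

text \<open>The second derivatives of a chart differ from those of \<open>G\<close> by tangential terms, so all
  charts at the point have the first and second fundamental forms of \<open>G\<close> up to a linear change of
  variables.  Hence the sum of principal curvatures is the trace of one pair of forms, and the
  description of the mean curvature is unambiguous.\<close>

lemma mean_curvature_graph_chart:
  assumes G: "graph_chart \<kappa> S e f V N G" and m: "m \<in> V"
    and \<eta>: "\<And>c. metric_form \<kappa> (\<eta> (G m)) (D1 G m c) = 0"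
    and pos: "\<And>c. c \<noteq> 0 \<Longrightarrow> metric_form \<kappa> (D1 G m c) (D1 G m c) > 0"
  defines "I \<equiv> \<lambda>a b. metric_form \<kappa> (D1 G m a) (D1 G m b)"
    and "B \<equiv> \<lambda>a b. metric_form \<kappa> (D2 G m a b) (\<eta> (G m))"
  shows "2 * mean_curvature \<kappa> S \<eta> (G m) * (I g g * I h h - (I g h)\<^sup>2)
    = I h h * B g g - 2 * I g h * B g h + I g g * B h h"
proof -
  have V: "open V" and C2G: "C2_on V G" using G by (auto simp: graph_chart_def)
  interpret M: bounded_bilinear "metric_form \<kappa>" by (rule bounded_bilinear_metric_form)
  have D1l: "bounded_linear (D1 G m)" by (rule D1_bounded_linear[OF C2G V m])
  note D2l = D2_bounded_linear[OF C2G V m]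
  note D1s = linear_add[OF bounded_linear.linear[OF D1l]] linear_scale[OF bounded_linear.linear[OF D1l]]
  note D2s = linear_add[OF bounded_linear.linear[OF D2l(1)]] linear_scale[OF bounded_linear.linear[OF D2l(1)]]
    linear_add[OF bounded_linear.linear[OF D2l(2)]] linear_scale[OF bounded_linear.linear[OF D2l(2)]]
  have I: "bounded_bilinear I"
    unfolding bilinear_conv_bounded_bilinear[symmetric] bilinear_def I_def
    by (intro conjI allI linearI; simp only: D1s M.add_left M.add_right M.scaleR_left M.scaleR_right real_scaleR_def)
  have B: "bounded_bilinear B"
    unfolding bilinear_conv_bounded_bilinear[symmetric] bilinear_def B_def
    by (intro conjI allI linearI; simp only: D2s M.add_left M.scaleR_left real_scaleR_def)
  have sym: "I a b = I b a" "B a b = B b a" for a b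
    unfolding I_def B_def using D2_symmetric[OF C2G V m, of a b] by (simp_all add: metric_form_commute)
  have pm: "proj \<kappa> e f (G m) = m" "G m \<in> N" using G m unfolding graph_chart_def by blast+
  have \<eta>': "metric_form \<kappa> (D1 G m c) (\<eta> (G m)) = 0" for c using \<eta>[of c] by (simp add: metric_form_commute)
  have fund: "metric_form \<kappa> (D1 X z a) (D1 X z b) = I (proj \<kappa> e f (D1 X z a)) (proj \<kappa> e f (D1 X z b))"
    "second_fundamental_form \<kappa> \<eta> X z a b = B (proj \<kappa> e f (D1 X z a)) (proj \<kappa> e f (D1 X z b))"
    if X: "chart_at S (G m) X z" for X z a b
  proof -
    have Xz: "X z = G m" using X by (auto simp: chart_at_def)
    note F = chart_factors[OF G X pm(2), unfolded pm(1)]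
    show "metric_form \<kappa> (D1 X z a) (D1 X z b) = I (proj \<kappa> e f (D1 X z a)) (proj \<kappa> e f (D1 X z b))"
      unfolding I_def by (simp only: F(1)[of a, symmetric] F(1)[of b, symmetric])
    show "second_fundamental_form \<kappa> \<eta> X z a b = B (proj \<kappa> e f (D1 X z a)) (proj \<kappa> e f (D1 X z b))"
      unfolding B_def second_fundamental_form_def Xz by (subst F(2)) (simp add: M.add_left \<eta>')
  qed
  define P where "P a b \<longleftrightarrow> I a a = 1 \<and> I b b = 1 \<and> I a b = 0 \<and> B a b = 0" for a b
  have ipos: "I a a > 0" if "a \<noteq> 0" for a unfolding I_def using pos that by blast
  obtain a b where ab: "P a b" using exists_principal_basis[OF I B sym ipos] unfolding P_def by metis
  define d where "d = I (1, 0) (1, 0) * I (0, 1) (0, 1) - (I (1, 0) (0, 1))\<^sup>2"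
  have trace: "(B a a + B b b) * d = I (0, 1) (0, 1) * B (1, 0) (1, 0) - 2 * I (1, 0) (0, 1) * B (1, 0) (0, 1) + I (1, 0) (1, 0) * B (0, 1) (0, 1)"
    if "P a b" for a b
    unfolding d_def using trace_in_orthonormal_basis[OF I B sym, of a b "(1, 0)" "(0, 1)"] that unfolding P_def by blast
  have d0: "d \<noteq> 0"
  proof
    assume "d = 0"
    \<comment> \<open>if the Gram determinant vanished, this vector would have length zero\<close>
    define v where "v = I (0, 1) (0, 1) *\<^sub>R (1, 0) - I (1, 0) (0, 1) *\<^sub>R ((0, 1) :: real \<times> real)"
    have "I (r *\<^sub>R p - s *\<^sub>R q) (r *\<^sub>R p - s *\<^sub>R q) = r * r * I p p - 2 * r * s * I p q + s * s * I q q" for r s p q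
      by (simp add: bounded_bilinear.diff_left[OF I] bounded_bilinear.diff_right[OF I]
          bounded_bilinear.scaleR_left[OF I] bounded_bilinear.scaleR_right[OF I] sym(1)[of q p] algebra_simps)
    then have "I v v = I (0, 1) (0, 1) * d"
      unfolding v_def d_def by (simp only: power2_eq_square) (simp add: algebra_simps)
    then have "I v v = 0" using \<open>d = 0\<close> by simp
    then have "v = 0" using ipos[of v] by fastforce
    then have "I (0, 1) (0, 1) = 0" by (simp add: v_def zero_prod_def)
    then show False using ipos[of "(0, 1)"] by (simp add: zero_prod_def)
  qed
  define t where "t = (I (0, 1) (0, 1) * B (1, 0) (1, 0) - 2 * I (1, 0) (0, 1) * B (1, 0) (0, 1) + I (1, 0) (1, 0) * B (0, 1) (0, 1)) / d"
  have traceP: "B a a + B b b = t" if "P a b" for a b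
    using trace[OF that] d0 by (simp add: t_def eq_divide_eq)
  have pc: "k1 + k2 = t" if "principal_curvatures \<kappa> S \<eta> (G m) k1 k2" for k1 k2
  proof -
    from that obtain X z a b where X: "chart_at S (G m) X z"
      and h: "metric_form \<kappa> (D1 X z a) (D1 X z a) = 1" "metric_form \<kappa> (D1 X z b) (D1 X z b) = 1"
        "metric_form \<kappa> (D1 X z a) (D1 X z b) = 0" "second_fundamental_form \<kappa> \<eta> X z a a = k1"
        "second_fundamental_form \<kappa> \<eta> X z b b = k2" "second_fundamental_form \<kappa> \<eta> X z a b = 0"
      unfolding principal_curvatures_def by blast
    have "P (proj \<kappa> e f (D1 X z a)) (proj \<kappa> e f (D1 X z b))"
      unfolding P_def using h fund[OF X] by simp
    from traceP[OF this] show ?thesis using h fund[OF X] by simp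
  qed
  have ex: "principal_curvatures \<kappa> S \<eta> (G m) (B a a) (B b b)"
  proof -
    obtain X z where X: "chart_at S (G m) X z" "surj (\<lambda>a. proj \<kappa> e f (D1 X z a))"
      using G m unfolding graph_chart_def by blast
    obtain a' where a': "proj \<kappa> e f (D1 X z a') = a" using surjD[OF X(2), of a] by blast
    obtain b' where b': "proj \<kappa> e f (D1 X z b') = b" using surjD[OF X(2), of b] by blast
    show ?thesis unfolding principal_curvatures_def
      using ab X(1) unfolding P_def
      by (intro exI[of _ X] exI[of _ z] exI[of _ a'] exI[of _ b']) (simp only: fund[OF X(1)] a' b' simp_thms)
  qed
  have "mean_curvature \<kappa> S \<eta> (G m) = t / 2"
    unfolding mean_curvature_def
  proof (rule the_equality)
    show "\<exists>k1 k2. principal_curvatures \<kappa> S \<eta> (G m) k1 k2 \<and> t / 2 = (k1 + k2) / 2"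
      using ex traceP[OF ab] by (intro exI[of _ "B a a"] exI[of _ "B b b"]) simp
  next
    fix h assume "\<exists>k1 k2. principal_curvatures \<kappa> S \<eta> (G m) k1 k2 \<and> h = (k1 + k2) / 2"
    then show "h = t / 2" using pc by auto
  qed
  then have "2 * mean_curvature \<kappa> S \<eta> (G m) = B a a + B b b" using traceP[OF ab] by simp
  then show ?thesis
    using trace_in_orthonormal_basis[OF I B sym, of a b g h] ab unfolding P_def by (simp only:)
qed

section \<open>Fermi coordinates\<close>

lemma csk_snk_has_derivative:
  assumes "\<kappa> \<in> {-1, 1}"
  shows "((\<lambda>z. csk \<kappa> (fst z)) has_derivative (\<lambda>h. - \<kappa> * snk \<kappa> (fst z) * fst h)) (at (z :: real \<times> real))"
    and "((\<lambda>z. snk \<kappa> (fst z)) has_derivative (\<lambda>h. csk \<kappa> (fst z) * fst h)) (at z)"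
    and "((\<lambda>z. csk \<kappa> (snd z)) has_derivative (\<lambda>h. - \<kappa> * snk \<kappa> (snd z) * snd h)) (at z)"
    and "((\<lambda>z. snk \<kappa> (snd z)) has_derivative (\<lambda>h. csk \<kappa> (snd z) * snd h)) (at z)"
  using has_derivative_compose[OF bounded_linear_imp_has_derivative[OF bounded_linear_fst]
      csk_snk_deriv(1)[OF assms, unfolded has_field_derivative_def]]
    has_derivative_compose[OF bounded_linear_imp_has_derivative[OF bounded_linear_fst]
      csk_snk_deriv(2)[OF assms, unfolded has_field_derivative_def]]
    has_derivative_compose[OF bounded_linear_imp_has_derivative[OF bounded_linear_snd]
      csk_snk_deriv(1)[OF assms, unfolded has_field_derivative_def]]
    has_derivative_compose[OF bounded_linear_imp_has_derivative[OF bounded_linear_snd]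
      csk_snk_deriv(2)[OF assms, unfolded has_field_derivative_def]] by blast+

lemma C2_on_csk_snk:
  assumes "\<kappa> \<in> {-1, 1}"
  shows "C2_on UNIV (csk \<kappa>)" "C2_on UNIV (snk \<kappa>)"
proof -
  note D = csk_snk_deriv[OF assms]
  have c: "continuous_on UNIV (csk \<kappa>)" "continuous_on UNIV (snk \<kappa>)"
    by (rule continuous_at_imp_continuous_on, rule ballI, rule DERIV_isCont, rule D)+
  show "C2_on UNIV (csk \<kappa>)"
    by (rule C2_on_real[where f' = "\<lambda>r. - \<kappa> * snk \<kappa> r" and f'' = "\<lambda>r. - \<kappa> * csk \<kappa> r"])
      (use D(1) DERIV_cmult[OF D(2), of "- \<kappa>"] c in \<open>auto intro!: continuous_intros simp del: mult_minus_left\<close>)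
  show "C2_on UNIV (snk \<kappa>)"
    by (rule C2_on_real[where f' = "csk \<kappa>" and f'' = "\<lambda>r. - \<kappa> * snk \<kappa> r"])
      (use D c in \<open>auto intro!: continuous_intros\<close>)
qed

definition fermi_geodesic :: "real \<Rightarrow> real^3 \<Rightarrow> real^3 \<Rightarrow> real \<Rightarrow> real^3" where
  "fermi_geodesic \<kappa> x e s = csk \<kappa> s *\<^sub>R x + snk \<kappa> s *\<^sub>R e"

definition fermi_tangent :: "real \<Rightarrow> real^3 \<Rightarrow> real^3 \<Rightarrow> real \<Rightarrow> real^3" where
  "fermi_tangent \<kappa> x e s = (- \<kappa> * snk \<kappa> s) *\<^sub>R x + csk \<kappa> s *\<^sub>R e"

text \<open>Fermi coordinates \<open>(s, r)\<close> about the geodesic through \<open>x\<close> with direction \<open>e\<close>: go distance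
  \<open>s\<close> along it, then distance \<open>r\<close> orthogonally to it.\<close>

definition fermi :: "real \<Rightarrow> real^3 \<Rightarrow> real^3 \<Rightarrow> real^3 \<Rightarrow> real \<times> real \<Rightarrow> real^3" where
  "fermi \<kappa> x e f z = csk \<kappa> (snd z) *\<^sub>R fermi_geodesic \<kappa> x e (fst z) + snk \<kappa> (snd z) *\<^sub>R f"

definition fermi_normal :: "real \<Rightarrow> real^3 \<Rightarrow> real^3 \<Rightarrow> real^3 \<Rightarrow> real \<times> real \<Rightarrow> real^3" where
  "fermi_normal \<kappa> x e f z = (- \<kappa> * snk \<kappa> (snd z)) *\<^sub>R fermi_geodesic \<kappa> x e (fst z) + csk \<kappa> (snd z) *\<^sub>R f"

lemma fermi_frames:
  assumes \<kappa>: "\<kappa> \<in> {-1, 1}" and F: "frame \<kappa> x e f"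
  shows "frame \<kappa> (fermi_geodesic \<kappa> x e s) (fermi_tangent \<kappa> x e s) f"
    and "frame \<kappa> (fermi \<kappa> x e f z) (fermi_tangent \<kappa> x e (fst z)) (fermi_normal \<kappa> x e f z)"
proof -
  show 1: "frame \<kappa> (fermi_geodesic \<kappa> x e s) (fermi_tangent \<kappa> x e s) f" for s
    unfolding fermi_geodesic_def fermi_tangent_def by (rule frame_rotate[OF \<kappa> F csk_snk_squares[OF \<kappa>]])
  show "frame \<kappa> (fermi \<kappa> x e f z) (fermi_tangent \<kappa> x e (fst z)) (fermi_normal \<kappa> x e f z)"
    unfolding fermi_def fermi_normal_def
    by (rule frame_swap[OF frame_rotate[OF \<kappa> frame_swap[OF 1] csk_snk_squares[OF \<kappa>]]])
qed

lemma D1_eqI: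
  assumes "(f has_derivative f') (at z)" shows "D1 f z a = f' a"
  unfolding D1_def using fun_cong[OF frechet_derivative_at[OF assms], of a] by simp

lemma D2_eqI:
  assumes "\<And>w. D1 f w a = g w" "(g has_derivative g') (at z)" shows "D2 f z a b = g' b"
  unfolding D2_def assms(1) using fun_cong[OF frechet_derivative_at[OF assms(2)], of b] by simp

lemma fermi_derivatives:
  assumes \<kappa>: "\<kappa> \<in> {-1, 1}"
  shows "D1 (fermi \<kappa> x e f) z (1, 0) = csk \<kappa> (snd z) *\<^sub>R fermi_tangent \<kappa> x e (fst z)"
    and "D1 (fermi \<kappa> x e f) z (0, 1) = fermi_normal \<kappa> x e f z"
    and "D2 (fermi \<kappa> x e f) z (1, 0) (1, 0) = (- \<kappa> * csk \<kappa> (snd z)) *\<^sub>R fermi_geodesic \<kappa> x e (fst z)"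
    and "D2 (fermi \<kappa> x e f) z (1, 0) (0, 1) = (- \<kappa> * snk \<kappa> (snd z)) *\<^sub>R fermi_tangent \<kappa> x e (fst z)"
    and "D2 (fermi \<kappa> x e f) z (0, 1) (0, 1) = - \<kappa> *\<^sub>R fermi \<kappa> x e f z"
proof -
  note [derivative_intros] = csk_snk_has_derivative[OF \<kappa>]
  have g: "((\<lambda>z. fermi_geodesic \<kappa> x e (fst z)) has_derivative (\<lambda>h. fst h *\<^sub>R fermi_tangent \<kappa> x e (fst z))) (at (z :: real \<times> real))" for z
    unfolding fermi_geodesic_def fermi_tangent_def
    by (auto intro!: derivative_eq_intros simp: fun_eq_iff algebra_simps)
  have t: "((\<lambda>z. fermi_tangent \<kappa> x e (fst z)) has_derivative (\<lambda>h. (- \<kappa> * fst h) *\<^sub>R fermi_geodesic \<kappa> x e (fst z))) (at (z :: real \<times> real))" for z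
    unfolding fermi_geodesic_def fermi_tangent_def
    by (auto intro!: derivative_eq_intros simp: fun_eq_iff algebra_simps)
  note [derivative_intros] = g t
  have "(fermi \<kappa> x e f has_derivative (\<lambda>h. fst h *\<^sub>R (csk \<kappa> (snd z) *\<^sub>R fermi_tangent \<kappa> x e (fst z))
      + snd h *\<^sub>R fermi_normal \<kappa> x e f z)) (at z)" for z
    unfolding fermi_def[abs_def] fermi_normal_def
    by (auto intro!: derivative_eq_intros simp: fun_eq_iff algebra_simps)
  note D1_eqI[OF this]
  then have D: "D1 (fermi \<kappa> x e f) z h = fst h *\<^sub>R (csk \<kappa> (snd z) *\<^sub>R fermi_tangent \<kappa> x e (fst z))
      + snd h *\<^sub>R fermi_normal \<kappa> x e f z" for z h .
  have D': "D1 (fermi \<kappa> x e f) z (1, 0) = csk \<kappa> (snd z) *\<^sub>R fermi_tangent \<kappa> x e (fst z)"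
    "D1 (fermi \<kappa> x e f) z (0, 1) = fermi_normal \<kappa> x e f z" for z
    by (simp_all add: D)
  then show "D1 (fermi \<kappa> x e f) z (1, 0) = csk \<kappa> (snd z) *\<^sub>R fermi_tangent \<kappa> x e (fst z)"
    "D1 (fermi \<kappa> x e f) z (0, 1) = fermi_normal \<kappa> x e f z" .
  have "((\<lambda>z. csk \<kappa> (snd z) *\<^sub>R fermi_tangent \<kappa> x e (fst z)) has_derivative
      (\<lambda>h. (fst h * (- \<kappa> * csk \<kappa> (snd z))) *\<^sub>R fermi_geodesic \<kappa> x e (fst z) +
        (snd h * (- \<kappa> * snk \<kappa> (snd z))) *\<^sub>R fermi_tangent \<kappa> x e (fst z))) (at z)"
    by (auto intro!: derivative_eq_intros simp: fun_eq_iff algebra_simps)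
  note D2_eqI[OF D'(1) this]
  then have "D2 (fermi \<kappa> x e f) z (1, 0) h = (fst h * (- \<kappa> * csk \<kappa> (snd z))) *\<^sub>R fermi_geodesic \<kappa> x e (fst z) +
        (snd h * (- \<kappa> * snk \<kappa> (snd z))) *\<^sub>R fermi_tangent \<kappa> x e (fst z)" for h .
  then show "D2 (fermi \<kappa> x e f) z (1, 0) (1, 0) = (- \<kappa> * csk \<kappa> (snd z)) *\<^sub>R fermi_geodesic \<kappa> x e (fst z)"
    "D2 (fermi \<kappa> x e f) z (1, 0) (0, 1) = (- \<kappa> * snk \<kappa> (snd z)) *\<^sub>R fermi_tangent \<kappa> x e (fst z)"
    by simp_all
  have "(fermi_normal \<kappa> x e f has_derivative
      (\<lambda>h. (fst h * (- \<kappa> * snk \<kappa> (snd z))) *\<^sub>R fermi_tangent \<kappa> x e (fst z) + (- \<kappa> * snd h) *\<^sub>R fermi \<kappa> x e f z)) (at z)"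
    unfolding fermi_def[abs_def] fermi_normal_def[abs_def]
    by (auto intro!: derivative_eq_intros simp: fun_eq_iff algebra_simps)
  note D2_eqI[OF D'(2) this]
  then have "D2 (fermi \<kappa> x e f) z (0, 1) h = (fst h * (- \<kappa> * snk \<kappa> (snd z))) *\<^sub>R fermi_tangent \<kappa> x e (fst z) + (- \<kappa> * snd h) *\<^sub>R fermi \<kappa> x e f z" for h .
  then show "D2 (fermi \<kappa> x e f) z (0, 1) (0, 1) = - \<kappa> *\<^sub>R fermi \<kappa> x e f z" by simp
qed

lemma fermi_projection_C2:
  assumes \<kappa>: "\<kappa> \<in> {-1, 1}"
  shows "C2_on UNIV (\<lambda>z. (csk \<kappa> (snd z) * snk \<kappa> (fst z), snk \<kappa> (snd z)))"
proof -
  have c: "C2_on UNIV (\<lambda>z :: real \<times> real. g (fst z))" "C2_on UNIV (\<lambda>z :: real \<times> real. g (snd z))"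
    if "C2_on UNIV g" for g :: "real \<Rightarrow> real"
    using C2_on_compose[OF C2_on_bounded_linear[OF bounded_linear_fst] that, of UNIV]
      C2_on_compose[OF C2_on_bounded_linear[OF bounded_linear_snd] that, of UNIV] by auto
  note k = C2_on_csk_snk[OF \<kappa>]
  have "C2_on UNIV (\<lambda>z. (csk \<kappa> (snd z) * snk \<kappa> (fst z)) *\<^sub>R (1, 0) + snk \<kappa> (snd z) *\<^sub>R (0, 1 :: real) :: real \<times> real)"
    by (rule C2_on_add[OF C2_on_bilinear[OF bounded_bilinear_scaleR C2_on_bilinear[OF bounded_bilinear_mult c(2)[OF k(1)] c(1)[OF k(2)]] C2_on_const]
          C2_on_bilinear[OF bounded_bilinear_scaleR c(2)[OF k(2)] C2_on_const]])
  then show ?thesis by simp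
qed

lemma C2_on_has_hessian:
  fixes u :: "real \<times> real \<Rightarrow> real"
  assumes u: "C2_on U u" "open U"
  shows "has_hessian u (\<lambda>z. D1 u z (1, 0)) (\<lambda>z. D1 u z (0, 1)) (\<lambda>z. D2 u z (1, 0) (1, 0)) (\<lambda>z. D2 u z (1, 0) (0, 1)) (\<lambda>z. D2 u z (0, 1) (0, 1)) U"
    and "continuous_on U (\<lambda>z. D2 u z a b)"
proof -
  obtain u' u'' where D: "\<And>z. z \<in> U \<Longrightarrow> (u has_derivative blinfun_apply (u' z)) (at z)"
    "\<And>z. z \<in> U \<Longrightarrow> (u' has_derivative blinfun_apply (u'' z)) (at z)" "continuous_on U u''"
    "\<And>z. z \<in> U \<Longrightarrow> D1 u z = blinfun_apply (u' z)"
    "\<And>z a b. z \<in> U \<Longrightarrow> D2 u z a b = blinfun_apply (blinfun_apply (u'' z) b) a"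
    using C2_on_D1_D2[OF u] by metis
  have lin: "L h = L (1, 0) * fst h + L (0, 1) * snd h" if "linear L" for L :: "real \<times> real \<Rightarrow> real" and h
  proof -
    have "L h = L (fst h *\<^sub>R (1, 0) + snd h *\<^sub>R (0, 1))" by (cases h) simp
    also have "\<dots> = L (1, 0) * fst h + L (0, 1) * snd h"
      by (simp only: linear_add[OF that] linear_scale[OF that] real_scaleR_def mult.commute)
    finally show ?thesis .
  qed
  show "has_hessian u (\<lambda>z. D1 u z (1, 0)) (\<lambda>z. D1 u z (0, 1)) (\<lambda>z. D2 u z (1, 0) (1, 0)) (\<lambda>z. D2 u z (1, 0) (0, 1)) (\<lambda>z. D2 u z (0, 1) (0, 1)) U"
    unfolding has_hessian_def
  proof (intro ballI conjI)
    fix z assume z: "z \<in> U"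
    have "(u has_derivative D1 u z) (at z)" using D(1)[OF z] D(4)[OF z] by simp
    then show "has_grad u (D1 u z (1, 0)) (D1 u z (0, 1)) z" unfolding has_grad_def
      by (rule has_derivative_eq_rhs) (intro ext lin bounded_linear.linear D1_bounded_linear[OF u z])
    have D1d: "((\<lambda>w. D1 u w a) has_derivative D2 u z a) (at z)" for a
    proof -
      have "((\<lambda>w. blinfun_apply (u' w) a) has_derivative (\<lambda>b. blinfun_apply (blinfun_apply (u'' z) b) a)) (at z)"
        using bounded_linear.has_derivative[OF blinfun.bounded_linear_left D(2)[OF z]] by simp
      moreover have "(\<lambda>b. blinfun_apply (blinfun_apply (u'' z) b) a) = D2 u z a" by (rule ext) (simp only: D(5)[OF z])
      ultimately have "((\<lambda>w. blinfun_apply (u' w) a) has_derivative D2 u z a) (at z)" by simp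
      then show ?thesis by (rule has_derivative_transform_within_open[OF _ u(2) z]) (simp add: D(4))
    qed
    note l2 = lin[OF bounded_linear.linear[OF D2_bounded_linear(1)[OF u z]]]
    show "has_grad (\<lambda>z. D1 u z (1, 0)) (D2 u z (1, 0) (1, 0)) (D2 u z (1, 0) (0, 1)) z"
      unfolding has_grad_def by (rule has_derivative_eq_rhs[OF D1d]) (intro ext l2)
    have "has_grad (\<lambda>z. D1 u z (0, 1)) (D2 u z (0, 1) (1, 0)) (D2 u z (0, 1) (0, 1)) z"
      unfolding has_grad_def by (rule has_derivative_eq_rhs[OF D1d]) (intro ext l2)
    then show "has_grad (\<lambda>z. D1 u z (0, 1)) (D2 u z (1, 0) (0, 1)) (D2 u z (0, 1) (0, 1)) z"
      using D2_symmetric_real[OF u z] by metis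
  qed
  have "continuous_on U (\<lambda>z. blinfun_apply (blinfun_apply (u'' z) b) a)"
    using D(3) by (intro continuous_intros)
  then show "continuous_on U (\<lambda>z. D2 u z a b)"
    by (rule continuous_on_eq) (simp add: D(5))
qed

lemma prod_space_tangent:
  assumes G: "C2_on V G" "open V" and m: "m \<in> V" and S: "\<And>m. m \<in> W \<Longrightarrow> G m \<in> prod_space \<kappa>"
    and W: "open W" "m \<in> W"
  shows "form \<kappa> (fst (G m)) (fst (D1 G m c)) = 0"
proof -
  interpret F: bounded_bilinear "form \<kappa>" by (rule bounded_bilinear_form)
  obtain G' where D: "(G has_derivative blinfun_apply (G' m)) (at m)" "D1 G m = blinfun_apply (G' m)"
    using C2_on_D1_D2[OF G] m by metis
  have "((\<lambda>m. form \<kappa> (fst (G m)) (fst (G m))) has_derivative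
    (\<lambda>h. form \<kappa> (fst (G m)) (fst (G' m h)) + form \<kappa> (fst (G' m h)) (fst (G m)))) (at m)"
    by (intro F.FDERIV has_derivative_fst D(1))
  moreover have "((\<lambda>m. form \<kappa> (fst (G m)) (fst (G m))) has_derivative (\<lambda>h. 0)) (at m)"
  proof (rule has_derivative_transform_within_open[OF has_derivative_const[of \<kappa>] W])
    show "\<kappa> = form \<kappa> (fst (G h)) (fst (G h))" if "h \<in> W" for h
      using S[OF that] by (cases "G h") (auto simp: prod_space_def space_form_def)
  qed
  ultimately have "(\<lambda>h. form \<kappa> (fst (G m)) (fst (G' m h)) + form \<kappa> (fst (G' m h)) (fst (G m))) = (\<lambda>h. 0)"
    by (rule has_derivative_unique)
  then show ?thesis using form_commute[of \<kappa> "fst (G m)" "fst (G' m c)"] D(2) by (simp add: fun_eq_iff) (metis mult_2 mult_eq_0_iff zero_neq_numeral)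
qed

section \<open>The height estimate\<close>

text \<open>Projecting the derivative of \<open>G\<close> gives the identity, so its horizontal part is a nonzero
  tangent vector of the space form, and such vectors have positive length.\<close>

lemma graph_chart_immersion:
  assumes \<kappa>: "\<kappa> \<in> {-1, 1}" and G: "graph_chart \<kappa> S e f V N G" and S: "S \<subseteq> prod_space \<kappa>" and m: "m \<in> V"
  shows "proj \<kappa> e f (D1 G m c) = c"
    and "c \<noteq> 0 \<Longrightarrow> metric_form \<kappa> (D1 G m c) (D1 G m c) > 0"
proof -
  have V: "open V" and C2G: "C2_on V G" and GS: "\<And>m. m \<in> V \<Longrightarrow> G m \<in> prod_space \<kappa>"
    and pG: "\<And>m. m \<in> V \<Longrightarrow> proj \<kappa> e f (G m) = m"
    using G S unfolding graph_chart_def by blast+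
  have "D1 (\<lambda>m. proj \<kappa> e f (G m)) m = D1 (\<lambda>m. m) m"
    by (rule D1_D2_eq_on_open(1)[OF V m]) (rule pG)
  then show p: "proj \<kappa> e f (D1 G m c) = c"
    using D1_D2_linear(1)[OF bounded_linear_proj C2G V m, of \<kappa> e f c] D1_eqI[OF has_derivative_ident, of m c] by simp
  assume "c \<noteq> 0"
  then have nz: "fst (D1 G m c) \<noteq> 0" using p by (auto simp: proj_def form_simps zero_prod_def)
  have x: "form \<kappa> (fst (G m)) (fst (G m)) = \<kappa>"
    using GS[OF m] by (cases "G m") (auto simp: prod_space_def space_form_def)
  have "form \<kappa> (fst (D1 G m c)) (fst (D1 G m c)) > 0"
    by (rule tangent_form_pos[OF \<kappa> x prod_space_tangent[OF C2G V m GS V m] nz])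
  then show "metric_form \<kappa> (D1 G m c) (D1 G m c) > 0"
    by (simp add: metric_form_def add_pos_nonneg)
qed

text \<open>The third frame component is determined up to sign by the other two, and the sign is fixed
  by positivity.\<close>

lemma space_form_eq_fermi:
  assumes \<kappa>: "\<kappa> \<in> {-1, 1}" and F: "frame \<kappa> x e f" and y: "y \<in> space_form \<kappa>"
    and p: "form \<kappa> y e = csk \<kappa> (snd z) * snk \<kappa> (fst z)" "form \<kappa> y f = snk \<kappa> (snd z)"
    and pos: "\<kappa> * form \<kappa> y x > 0" "csk \<kappa> (snd z) > 0" "csk \<kappa> (fst z) > 0"
  shows "y = fermi \<kappa> x e f z"
proof -
  have k2: "\<kappa> * \<kappa> = 1" using \<kappa> by auto
  have yy: "form \<kappa> y y = \<kappa>" using y by (simp add: space_form_def)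
  have "form \<kappa> y y = \<kappa> * form \<kappa> y x * form \<kappa> y x + form \<kappa> y e * form \<kappa> y e + form \<kappa> y f * form \<kappa> y f"
    by (rule frame_form_expansion[OF \<kappa> F])
  then have "\<kappa> * \<kappa> = \<kappa> * (\<kappa> * form \<kappa> y x * form \<kappa> y x + form \<kappa> y e * form \<kappa> y e + form \<kappa> y f * form \<kappa> y f)"
    using yy by simp
  then have "1 = (\<kappa> * form \<kappa> y x)\<^sup>2 + \<kappa> * ((form \<kappa> y e)\<^sup>2 + (form \<kappa> y f)\<^sup>2)"
    using k2 by (simp add: power2_eq_square algebra_simps)
  moreover have "1 = (csk \<kappa> (snd z) * csk \<kappa> (fst z))\<^sup>2 + \<kappa> * ((csk \<kappa> (snd z) * snk \<kappa> (fst z))\<^sup>2 + (snk \<kappa> (snd z))\<^sup>2)"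
  proof -
    have "(csk \<kappa> (snd z) * csk \<kappa> (fst z))\<^sup>2 + \<kappa> * ((csk \<kappa> (snd z) * snk \<kappa> (fst z))\<^sup>2 + (snk \<kappa> (snd z))\<^sup>2)
      = (csk \<kappa> (snd z))\<^sup>2 * ((csk \<kappa> (fst z))\<^sup>2 + \<kappa> * (snk \<kappa> (fst z))\<^sup>2) + \<kappa> * (snk \<kappa> (snd z))\<^sup>2"
      by (simp add: power_mult_distrib algebra_simps)
    then show ?thesis by (simp add: csk_snk_squares[OF \<kappa>])
  qed
  ultimately have "(\<kappa> * form \<kappa> y x)\<^sup>2 = (csk \<kappa> (snd z) * csk \<kappa> (fst z))\<^sup>2" using p by simp
  moreover have "csk \<kappa> (snd z) * csk \<kappa> (fst z) > 0" using pos by simp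
  ultimately have "\<kappa> * form \<kappa> y x = csk \<kappa> (snd z) * csk \<kappa> (fst z)" using pos(1)
    by (simp add: power2_eq_iff_nonneg)
  then show ?thesis
    using frame_expansion[OF \<kappa> F, of y] p
    by (simp add: fermi_def fermi_geodesic_def scaleR_add_right)
qed

text \<open>With \<open>(n, \<nu>)\<close> a unit normal to the graph of \<open>\<sigma> w\<close>, orthogonality determines \<open>n\<close> and the unit
  length determines \<open>\<nu>\<close> up to sign.  The entries \<open>L\<close>, \<open>M\<close>, \<open>N\<close> of the second fundamental form are
  then \<open>\<sigma> \<nu>\<close> times Hessian entries, and the trace formula for the mean curvature \<open>h\<close> becomes the
  equation of \<open>H_graph\<close>.\<close>

lemma fermi_graph_equation:
  assumes \<kappa>: "\<kappa> \<in> {-1, 1}" and F: "frame \<kappa> x e f" and \<sigma>: "\<sigma> \<in> {-1, 1::real}"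
    and Cp: "csk \<kappa> (snd z) > 0"
    and \<eta>: "form \<kappa> (fermi \<kappa> x e f z) n = 0" "form \<kappa> n n + \<nu>\<^sup>2 = 1" "\<sigma> * \<nu> > 0"
      "csk \<kappa> (snd z) * form \<kappa> n (fermi_tangent \<kappa> x e (fst z)) + \<nu> * (\<sigma> * p) = 0"
      "form \<kappa> n (fermi_normal \<kappa> x e f z) + \<nu> * (\<sigma> * q) = 0"
    and W: "W = sqrt (1 + p\<^sup>2 / (csk \<kappa> (snd z))\<^sup>2 + q\<^sup>2)"
    and L: "L = form \<kappa> ((- \<kappa> * csk \<kappa> (snd z)) *\<^sub>R fermi_geodesic \<kappa> x e (fst z)) n + \<nu> * (\<sigma> * w11)"
    and M: "M = form \<kappa> ((- \<kappa> * snk \<kappa> (snd z)) *\<^sub>R fermi_tangent \<kappa> x e (fst z)) n + \<nu> * (\<sigma> * w12)"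
    and N: "N = form \<kappa> (- \<kappa> *\<^sub>R fermi \<kappa> x e f z) n + \<nu> * (\<sigma> * w22)"
    and mean: "2 * h * (((csk \<kappa> (snd z))\<^sup>2 + p\<^sup>2) * (1 + q\<^sup>2) - (p * q)\<^sup>2) = (1 + q\<^sup>2) * L - 2 * (p * q) * M + ((csk \<kappa> (snd z))\<^sup>2 + p\<^sup>2) * N"
  shows "\<sigma> * \<nu> = 1 / W"
    and "((csk \<kappa> (snd z))\<^sup>2 + p\<^sup>2) * w22 - 2 * p * q * (w12 + \<kappa> * p * snk \<kappa> (snd z) / csk \<kappa> (snd z))
      + (1 + q\<^sup>2) * (w11 - \<kappa> * q * csk \<kappa> (snd z) * snk \<kappa> (snd z)) = 2 * (csk \<kappa> (snd z))\<^sup>2 * W ^ 3 * h"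
proof -
  have s2: "\<sigma> * \<sigma> = 1" using \<sigma> by auto
  have k2: "\<kappa> * \<kappa> = 1" using \<kappa> by auto
  define C where "C = csk \<kappa> (snd z)"
  define T where "T = snk \<kappa> (snd z)"
  define E where "E = fermi_tangent \<kappa> x e (fst z)"
  define P where "P = fermi_geodesic \<kappa> x e (fst z)"
  define Q where "Q = fermi_normal \<kappa> x e f z"
  define X where "X = fermi \<kappa> x e f z"
  have C: "C > 0" using Cp by (simp add: C_def)
  have F1: "frame \<kappa> P E f" unfolding P_def E_def by (rule fermi_frames(1)[OF \<kappa> F])
  have F2: "frame \<kappa> X E Q" unfolding X_def E_def Q_def by (rule fermi_frames(2)[OF \<kappa> F])
  have XQ: "X = C *\<^sub>R P + T *\<^sub>R f" "Q = (- \<kappa> * T) *\<^sub>R P + C *\<^sub>R f"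
    by (simp_all add: X_def Q_def C_def T_def P_def fermi_def fermi_normal_def)
  have nE: "form \<kappa> n E = - \<nu> * \<sigma> * p / C" using \<eta>(4) C by (simp add: E_def C_def field_simps)
  have nQ: "form \<kappa> n Q = - \<nu> * \<sigma> * q" using \<eta>(5) by (simp add: Q_def)
  have nX: "form \<kappa> n X = 0" using \<eta>(1) by (simp add: X_def form_commute)
  define \<mu> where "\<mu> = \<sigma> * \<nu>"
  have mu: "\<mu> > 0" "\<nu>\<^sup>2 = \<mu>\<^sup>2" using \<eta>(3) s2 by (simp_all add: \<mu>_def power2_eq_square algebra_simps)
  have W0: "W\<^sup>2 = 1 + p\<^sup>2 / C\<^sup>2 + q\<^sup>2" and Wp: "W > 0"
    unfolding W C_def by (auto simp: add_nonneg_nonneg add_pos_nonneg)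
  have nn: "form \<kappa> n n = \<mu>\<^sup>2 * (p\<^sup>2 / C\<^sup>2 + q\<^sup>2)"
    unfolding frame_form_expansion[OF \<kappa> F2, of n n] nX nE nQ using C
    by (simp add: \<mu>_def power2_eq_square field_simps)
  have "\<mu>\<^sup>2 * W\<^sup>2 = 1" using \<eta>(2) unfolding nn mu(2) W0 by (simp add: algebra_simps)
  then have "(\<mu> * W)\<^sup>2 = 1" by (simp add: power_mult_distrib)
  then have muW: "\<mu> * W = 1" using mu(1) Wp by (smt (verit) mult_pos_pos power2_eq_1_iff)
  then show "\<sigma> * \<nu> = 1 / W" using Wp by (simp add: \<mu>_def field_simps)
  have "form \<kappa> P n = - T * form \<kappa> n Q"
    unfolding frame_form_expansion[OF \<kappa> F2, of P n] nX
    using k2 by (simp add: XQ form_simps frameD[OF F1])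
  then have Pn: "form \<kappa> P n = T * \<mu> * q" by (simp add: nQ \<mu>_def)
  have L': "L = \<mu> * (w11 - \<kappa> * q * C * T)"
    unfolding L by (simp add: P_def[symmetric] C_def[symmetric] form_simps Pn \<mu>_def algebra_simps)
  have M': "M = \<mu> * (w12 + \<kappa> * p * T / C)"
    unfolding M E_def[symmetric] T_def[symmetric] form_simps form_commute[of \<kappa> E n] nE
    by (simp add: \<mu>_def algebra_simps)
  have N': "N = \<mu> * w22"
    unfolding N using nX by (simp add: X_def[symmetric] form_simps form_commute[of \<kappa> X n] \<mu>_def algebra_simps)
  have CW: "(C\<^sup>2 + p\<^sup>2) * (1 + q\<^sup>2) - (p * q)\<^sup>2 = C\<^sup>2 * W\<^sup>2"
    unfolding W0 using C by (simp add: field_simps power2_eq_square)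
  have key: "2 * h * (C\<^sup>2 * W\<^sup>2) = \<mu> * ((1 + q\<^sup>2) * (w11 - \<kappa> * q * C * T) - 2 * (p * q) * (w12 + \<kappa> * p * T / C) + (C\<^sup>2 + p\<^sup>2) * w22)"
    using mean unfolding C_def[symmetric] CW L' M' N' by (simp add: algebra_simps)
  have "2 * C\<^sup>2 * W ^ 3 * h = W * (2 * h * (C\<^sup>2 * W\<^sup>2))" by (simp add: power2_eq_square power3_eq_cube)
  also have "\<dots> = (\<mu> * W) * ((1 + q\<^sup>2) * (w11 - \<kappa> * q * C * T) - 2 * (p * q) * (w12 + \<kappa> * p * T / C) + (C\<^sup>2 + p\<^sup>2) * w22)"
    unfolding key by (simp add: mult_ac)
  finally have "2 * C\<^sup>2 * W ^ 3 * h = (1 + q\<^sup>2) * (w11 - \<kappa> * q * C * T) - 2 * (p * q) * (w12 + \<kappa> * p * T / C) + (C\<^sup>2 + p\<^sup>2) * w22"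
    unfolding muW by simp
  then show "((csk \<kappa> (snd z))\<^sup>2 + p\<^sup>2) * w22 - 2 * p * q * (w12 + \<kappa> * p * snk \<kappa> (snd z) / csk \<kappa> (snd z))
      + (1 + q\<^sup>2) * (w11 - \<kappa> * q * csk \<kappa> (snd z) * snk \<kappa> (snd z)) = 2 * (csk \<kappa> (snd z))\<^sup>2 * W ^ 3 * h"
    unfolding C_def[symmetric] T_def[symmetric] by (simp add: mult.assoc)
qed

text \<open>The frame at \<open>p0\<close> is adapted to the horizontal part of the normal, which gives \<open>w2 0 = 0\<close>. 
  For \<open>\<sigma> = -1\<close> the height is reflected; the mean curvature equation is preserved because \<open>\<H>\<close> is
  even.\<close>

lemma interior_point_H_graph:
  assumes \<kappa>: "\<kappa> \<in> {-1, 1}" and \<sigma>: "\<sigma> \<in> {-1, 1}" and even: "\<And>y. y \<in> {-1..1} \<Longrightarrow> \<H> y = \<H> (- y)"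
    and S: "H_surface \<kappa> \<H> S \<eta>" and pos: "\<And>p. p \<in> S \<Longrightarrow> \<sigma> * snd (\<eta> p) > 0"
    and p0: "p0 \<in> S" "p0 \<notin> surface_boundary S"
  obtains R w w1 w2 w11 w12 w22 where "H_graph \<kappa> \<H> R w w1 w2 w11 w12 w22" "w2 0 = 0"
    "w 0 = \<sigma> * snd p0" "\<sigma> * snd (\<eta> p0) = 1 / graph_W \<kappa> w1 w2 0"
    "\<And>z. z \<in> ball 0 R \<Longrightarrow> \<exists>p\<in>S. w z = \<sigma> * snd p \<and> \<sigma> * snd (\<eta> p) = 1 / graph_W \<kappa> w1 w2 z"
proof -
  have surf: "S \<subseteq> prod_space \<kappa>" and un: "unit_normal \<kappa> S \<eta>"
    and mc: "\<And>p. p \<in> S \<Longrightarrow> mean_curvature \<kappa> S \<eta> p = \<H> (angle_function \<kappa> \<eta> p)"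
    and ch: "\<exists>X z. chart_at S p0 X z" using S p0(1) unfolding H_surface_def surface_def by blast+
  have s2: "\<sigma> * \<sigma> = 1" using \<sigma> by auto
  have \<eta>t: "form \<kappa> (fst p) (fst (\<eta> p)) = 0" "form \<kappa> (fst (\<eta> p)) (fst (\<eta> p)) + (snd (\<eta> p))\<^sup>2 = 1"
    "\<And>w. w \<in> tangent_plane S p \<Longrightarrow> metric_form \<kappa> (\<eta> p) w = 0" if "p \<in> S" for p
    using un that unfolding unit_normal_def by (auto simp: prod_tangent_def metric_form_def power2_eq_square)
  obtain X z0 where X: "chart_at S p0 X z0" using ch by blast
  then obtain U where U: "chart S U X" "z0 \<in> U \<inter> half_plane" "X z0 = p0" unfolding chart_at_def by blast
  have "snd z0 \<noteq> 0" using p0 X unfolding surface_boundary_def by blast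
  then have z0: "snd z0 > 0" using U(2) by (simp add: half_plane_def)
  have x0: "form \<kappa> (fst p0) (fst p0) = \<kappa>"
    using p0(1) surf by (cases p0) (auto simp: prod_space_def space_form_def)
  obtain e f where F: "frame \<kappa> (fst p0) e f" and nf: "form \<kappa> (fst (\<eta> p0)) f = 0"
    using adapted_frame[OF \<kappa> x0 \<eta>t(1)[OF p0(1)]] by blast
  have oU: "open U" and C2X: "C2_on U X" and "openin (top_of_set S) (X ` (U \<inter> half_plane))"
    and injX: "inj (D1 X z0)"
    using U(1,2) unfolding chart_def by blast+
  then have XS: "X ` (U \<inter> half_plane) \<subseteq> S" by (meson openin_imp_subset)
  have injp: "a = 0" if a: "proj \<kappa> e f (D1 X z0 a) = 0" for a
  proof -
    define v where "v = D1 X z0 a"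
    define U1 where "U1 = U \<inter> {w. 0 < snd w}"
    have "open U1" unfolding U1_def using oU by (intro open_Int open_Collect_less continuous_intros)
    moreover have "z0 \<in> U1" "z0 \<in> U" using U(2) z0 by (auto simp: U1_def)
    moreover have "X w \<in> prod_space \<kappa>" if "w \<in> U1" for w
    proof -
      have "w \<in> U \<inter> half_plane" using that by (auto simp: U1_def half_plane_def)
      then show ?thesis using XS surf by blast
    qed
    ultimately have "form \<kappa> (fst p0) (fst v) = 0"
      using prod_space_tangent[OF C2X oU, of z0 U1 \<kappa> a] U(3) v_def by blast
    moreover have "form \<kappa> (fst v) e = 0" "form \<kappa> (fst v) f = 0" using a by (auto simp: v_def proj_def zero_prod_def)
    ultimately have fv: "fst v = 0" using frame_expansion[OF \<kappa> F, of "fst v"] by (simp add: form_commute)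
    have "v \<in> tangent_plane S p0" unfolding tangent_plane_def v_def using X by blast
    from \<eta>t(3)[OF p0(1) this] have "snd (\<eta> p0) * snd v = 0" using fv by (simp add: metric_form_def form_simps)
    then have "snd v = 0" using pos[OF p0(1)] by auto
    then have "v = 0" using fv by (simp add: prod_eq_iff)
    moreover have "D1 X z0 0 = 0"
      using linear_0[OF bounded_linear.linear[OF D1_bounded_linear[OF C2X oU]]] U(2) by auto
    ultimately show "a = 0" using injX v_def by (metis injD)
  qed
  obtain V N G where G: "graph_chart \<kappa> S e f V N G" and p0N: "p0 \<in> N"
    using exists_graph_chart[where \<kappa> = \<kappa> and e = e and f = f, OF U(1) _ z0 injp] U(2,3) by (metis IntD1)
  have V: "open V" and C2G: "C2_on V G" and GS: "\<And>m. m \<in> V \<Longrightarrow> G m \<in> S"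
    and pG: "\<And>m. m \<in> V \<Longrightarrow> proj \<kappa> e f (G m) = m"
    and Gp: "proj \<kappa> e f p0 \<in> V" "G (proj \<kappa> e f p0) = p0"
    using G p0(1) p0N unfolding graph_chart_def by blast+
  have pp0: "proj \<kappa> e f p0 = 0" by (simp add: proj_def frameD[OF F] zero_prod_def)
  define A where "A z = (csk \<kappa> (snd z) * snk \<kappa> (fst z), snk \<kappa> (snd z))" for z :: "real \<times> real"
  have C2A: "C2_on UNIV A" unfolding A_def by (rule fermi_projection_C2[OF \<kappa>])
  have A0: "A 0 = 0" by (simp add: A_def zero_prod_def)
  \<comment> \<open>\<open>A\<close> is the projection of the point with Fermi coordinates \<open>z\<close>, and \<open>\<Gamma>\<close> the surface in Fermi coordinates\<close>
  define V1 where "V1 = A -` V"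
  have contA: "continuous_on UNIV A" by (rule C1_on_imp_continuous_on[OF C2_on_imp_C1_on[OF C2A]])
  have V1: "open V1" unfolding V1_def using contA V by (simp add: open_vimage)
  have A0V: "0 \<in> V1" using Gp(1) by (simp add: V1_def A0 pp0)
  define \<Gamma> where "\<Gamma> z = G (A z)" for z
  have C2\<Gamma>1: "C2_on V1 \<Gamma>" unfolding \<Gamma>_def[abs_def]
    by (rule C2_on_compose[OF C2_on_subset[OF C2A] C2G]) (auto simp: V1_def)
  have \<Gamma>0: "\<Gamma> 0 = p0" using Gp(2) unfolding pp0 by (simp add: \<Gamma>_def A0)
  have "continuous_on V1 \<Gamma>" by (rule C1_on_imp_continuous_on[OF C2_on_imp_C1_on[OF C2\<Gamma>1]])
  then have "continuous_on V1 (\<lambda>z. \<kappa> * form \<kappa> (fst (\<Gamma> z)) (fst p0))"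
    by (intro continuous_intros bounded_bilinear.continuous_on[OF bounded_bilinear_form])
  then have "isCont (\<lambda>z. \<kappa> * form \<kappa> (fst (\<Gamma> z)) (fst p0)) 0"
    using V1 A0V by (simp add: continuous_on_eq_continuous_at)
  moreover have "\<kappa> * form \<kappa> (fst (\<Gamma> 0)) (fst p0) = 1" using x0 \<kappa> \<Gamma>0 by auto
  ultimately obtain d1 where d1: "d1 > 0" "\<And>z. dist z 0 < d1 \<Longrightarrow> dist (\<kappa> * form \<kappa> (fst (\<Gamma> z)) (fst p0)) 1 < 1"
    unfolding continuous_at_eps_delta dist_norm by (metis zero_less_one)
  obtain d2 where d2: "d2 > 0" "ball 0 d2 \<subseteq> V1" using V1 A0V open_contains_ball by blast
  \<comment> \<open>the radius \<open>d1\<close> keeps the component along \<open>fst p0\<close> positive, which excludes the antipodal solution\<close>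
  define R where "R = min 1 (min d1 d2)"
  have R: "0 < R" "R \<le> 1" "R \<le> d1" "R \<le> d2" using d1 d2 by (auto simp: R_def)
  define D where "D = ball (0 :: real \<times> real) R"
  have D: "open D" "0 \<in> D" "D \<subseteq> V1" using R d2(2) by (auto simp: D_def)
  have C2\<Gamma>: "C2_on D \<Gamma>" by (rule C2_on_subset[OF C2\<Gamma>1 D(3)])
  have AV: "A z \<in> V" if "z \<in> D" for z using that D(3) by (auto simp: V1_def)
  have small: "csk \<kappa> (fst z) > 0" "csk \<kappa> (snd z) > 0" if "z \<in> D" for z
  proof -
    have "\<bar>fst z\<bar> < 1" "\<bar>snd z\<bar> < 1"
      using that R norm_fst_le[of "fst z" "snd z"] norm_snd_le[of "snd z" "fst z"] by (cases z; auto simp: D_def)+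
    then show "csk \<kappa> (fst z) > 0" "csk \<kappa> (snd z) > 0" using csk_pos by auto
  qed
  have \<Gamma>f: "fst (\<Gamma> z) = fermi \<kappa> (fst p0) e f z" if z: "z \<in> D" for z
  proof (rule space_form_eq_fermi[OF \<kappa> F])
    show "fst (\<Gamma> z) \<in> space_form \<kappa>"
      using GS[OF AV[OF z]] surf by (cases "\<Gamma> z") (auto simp: \<Gamma>_def prod_space_def)
    show "form \<kappa> (fst (\<Gamma> z)) e = csk \<kappa> (snd z) * snk \<kappa> (fst z)" "form \<kappa> (fst (\<Gamma> z)) f = snk \<kappa> (snd z)"
      using pG[OF AV[OF z]] by (auto simp: \<Gamma>_def proj_def A_def)
    show "\<kappa> * form \<kappa> (fst (\<Gamma> z)) (fst p0) > 0"
      using d1(2)[of z] z R by (auto simp: D_def dist_real_def)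
  qed (use small[OF z] in auto)
  define w where "w z = \<sigma> * snd (\<Gamma> z)" for z
  have Lw: "bounded_linear (\<lambda>p :: ambient. \<sigma> * snd p)" by (intro bounded_linear_mult_right[THEN bounded_linear_compose] bounded_linear_snd)
  have C2w: "C2_on D w" unfolding w_def by (rule C2_on_bounded_linear_compose[OF Lw C2\<Gamma>])
  note wD = D1_D2_linear[OF Lw C2\<Gamma> D(1), folded w_def]
  define w1 where "w1 z = D1 w z (1, 0)" for z
  define w2 where "w2 z = D1 w z (0, 1)" for z
  define w11 where "w11 z = D2 w z (1, 0) (1, 0)" for z
  define w12 where "w12 z = D2 w z (1, 0) (0, 1)" for z
  define w22 where "w22 z = D2 w z (0, 1) (0, 1)" for z
  have sw: "snd v = \<sigma> * (\<sigma> * snd v)" for v :: ambient using s2 by (simp add: mult.assoc[symmetric])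
  have snd\<Gamma>: "snd (D1 \<Gamma> z (1, 0)) = \<sigma> * w1 z" "snd (D1 \<Gamma> z (0, 1)) = \<sigma> * w2 z"
    "snd (D2 \<Gamma> z (1, 0) (1, 0)) = \<sigma> * w11 z" "snd (D2 \<Gamma> z (1, 0) (0, 1)) = \<sigma> * w12 z"
    "snd (D2 \<Gamma> z (0, 1) (0, 1)) = \<sigma> * w22 z" if "z \<in> D" for z
    unfolding w1_def w2_def w11_def w12_def w22_def wD[OF that] by (rule sw)+
  have fst\<Gamma>: "fst (D1 \<Gamma> z a) = D1 (fermi \<kappa> (fst p0) e f) z a" "fst (D2 \<Gamma> z a b) = D2 (fermi \<kappa> (fst p0) e f) z a b"
    if "z \<in> D" for z a b
    using D1_D2_eq_on_open[OF D(1) that \<Gamma>f] D1_D2_linear[OF bounded_linear_fst C2\<Gamma> D(1) that, of a] by auto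
  have main: "\<sigma> * snd (\<eta> (\<Gamma> z)) = 1 / graph_W \<kappa> w1 w2 z"
    "((csk \<kappa> (snd z))\<^sup>2 + (w1 z)\<^sup>2) * w22 z - 2 * w1 z * w2 z * (w12 z + \<kappa> * w1 z * snk \<kappa> (snd z) / csk \<kappa> (snd z))
      + (1 + (w2 z)\<^sup>2) * (w11 z - \<kappa> * w2 z * csk \<kappa> (snd z) * snk \<kappa> (snd z))
      = 2 * (csk \<kappa> (snd z))\<^sup>2 * graph_W \<kappa> w1 w2 z ^ 3 * \<H> (1 / graph_W \<kappa> w1 w2 z)"
    "w2 0 = 0" if z: "z \<in> D" for z
  proof -
    have pS: "\<Gamma> z \<in> S" if "z \<in> D" for z using GS[OF AV[OF that]] by (simp add: \<Gamma>_def)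
    note chain = D1_D2_compose[OF C2_on_subset[OF C2A subset_UNIV] D(1) C2G V, folded \<Gamma>_def]
    have AD: "A ` D \<subseteq> V" using AV by auto
    have orthG: "metric_form \<kappa> (\<eta> (\<Gamma> z)) (D1 G (A z) c) = 0" if "z \<in> D" for z c
      using \<eta>t(3)[OF pS[OF that] graph_chart_tangent[OF G AV[OF that], of c, folded \<Gamma>_def]] .
    have orth: "metric_form \<kappa> (\<eta> (\<Gamma> z)) (D1 \<Gamma> z a) = 0" if "z \<in> D" for z a
      using orthG[OF that] chain(1)[OF AD that] by simp
    have r1: "csk \<kappa> (snd z) * form \<kappa> (fst (\<eta> (\<Gamma> z))) (fermi_tangent \<kappa> (fst p0) e (fst z)) + snd (\<eta> (\<Gamma> z)) * (\<sigma> * w1 z) = 0"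
      "form \<kappa> (fst (\<eta> (\<Gamma> z))) (fermi_normal \<kappa> (fst p0) e f z) + snd (\<eta> (\<Gamma> z)) * (\<sigma> * w2 z) = 0" if "z \<in> D" for z
      using orth[OF that, of "(1, 0)"] orth[OF that, of "(0, 1)"]
      unfolding metric_form_def fst\<Gamma>[OF that] fermi_derivatives[OF \<kappa>] snd\<Gamma>[OF that] by (auto simp: form_simps)
    have "fermi_normal \<kappa> (fst p0) e f 0 = f" by (simp add: fermi_normal_def)
    then have "snd (\<eta> p0) * (\<sigma> * w2 0) = 0" using r1(2)[OF D(2)] nf \<Gamma>0 by simp
    then show "w2 0 = 0" using pos[OF p0(1)] by auto
    define I where "I a b = metric_form \<kappa> (D1 \<Gamma> z a) (D1 \<Gamma> z b)" for a b
    define B where "B a b = metric_form \<kappa> (D2 \<Gamma> z a b) (\<eta> (\<Gamma> z))" for a b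
    have F2: "frame \<kappa> (fermi \<kappa> (fst p0) e f z) (fermi_tangent \<kappa> (fst p0) e (fst z)) (fermi_normal \<kappa> (fst p0) e f z)"
      by (rule fermi_frames(2)[OF \<kappa> F])
    have Iv: "I (1, 0) (1, 0) = (csk \<kappa> (snd z))\<^sup>2 + (w1 z)\<^sup>2" "I (1, 0) (0, 1) = w1 z * w2 z" "I (0, 1) (0, 1) = 1 + (w2 z)\<^sup>2"
      using s2 unfolding I_def metric_form_def fst\<Gamma>[OF z] fermi_derivatives[OF \<kappa>] snd\<Gamma>[OF z]
      by (simp_all add: form_simps frameD[OF F2] power2_eq_square)
    have Bv: "B a b = form \<kappa> (D2 (fermi \<kappa> (fst p0) e f) z a b) (fst (\<eta> (\<Gamma> z))) + snd (\<eta> (\<Gamma> z)) * snd (D2 \<Gamma> z a b)" for a b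
      by (simp add: B_def metric_form_def fst\<Gamma>[OF z])
    have mean: "2 * mean_curvature \<kappa> S \<eta> (\<Gamma> z) * (I (1, 0) (1, 0) * I (0, 1) (0, 1) - (I (1, 0) (0, 1))\<^sup>2)
      = I (0, 1) (0, 1) * B (1, 0) (1, 0) - 2 * I (1, 0) (0, 1) * B (1, 0) (0, 1) + I (1, 0) (1, 0) * B (0, 1) (0, 1)"
    proof -
      have Ic: "I a b = metric_form \<kappa> (D1 G (A z) (D1 A z a)) (D1 G (A z) (D1 A z b))" for a b
        unfolding I_def chain(1)[OF AD z] ..
      have Bc: "B a b = metric_form \<kappa> (D2 G (A z) (D1 A z a) (D1 A z b)) (\<eta> (G (A z)))" for a b
      proof -
        have "metric_form \<kappa> (D1 G (A z) c) (\<eta> (\<Gamma> z)) = 0" for c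
          using orthG[OF z, of c] by (simp add: metric_form_commute)
        then show ?thesis
          unfolding B_def chain(2)[OF AD z] bounded_bilinear.add_left[OF bounded_bilinear_metric_form]
          by (simp add: \<Gamma>_def)
      qed
      show ?thesis
        using mean_curvature_graph_chart[where \<eta> = \<eta>, OF G AV[OF z] orthG[OF z, unfolded \<Gamma>_def] graph_chart_immersion(2)[OF \<kappa> G surf AV[OF z]],
            of "D1 A z (1, 0)" "D1 A z (0, 1)"]
        unfolding Ic Bc \<Gamma>_def by simp
    qed
    define W where "W = sqrt (1 + (w1 z)\<^sup>2 / (csk \<kappa> (snd z))\<^sup>2 + (w2 z)\<^sup>2)"
    have WW: "graph_W \<kappa> w1 w2 z = W" by (simp add: graph_W_def W_def)
    have e1: "form \<kappa> (fermi \<kappa> (fst p0) e f z) (fst (\<eta> (\<Gamma> z))) = 0"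
      using \<eta>t(1)[OF pS[OF z]] \<Gamma>f[OF z] by simp
    note eq = fermi_graph_equation[OF \<kappa> F \<sigma> small(2)[OF z] e1 \<eta>t(2)[OF pS[OF z]] pos[OF pS[OF z]] r1[OF z] W_def
        refl refl refl, of "mean_curvature \<kappa> S \<eta> (\<Gamma> z)" "w11 z" "w12 z" "w22 z"]
    have m': "2 * mean_curvature \<kappa> S \<eta> (\<Gamma> z) * (((csk \<kappa> (snd z))\<^sup>2 + (w1 z)\<^sup>2) * (1 + (w2 z)\<^sup>2) - (w1 z * w2 z)\<^sup>2)
      = (1 + (w2 z)\<^sup>2) * (form \<kappa> ((- \<kappa> * csk \<kappa> (snd z)) *\<^sub>R fermi_geodesic \<kappa> (fst p0) e (fst z)) (fst (\<eta> (\<Gamma> z))) + snd (\<eta> (\<Gamma> z)) * (\<sigma> * w11 z))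
      - 2 * (w1 z * w2 z) * (form \<kappa> ((- \<kappa> * snk \<kappa> (snd z)) *\<^sub>R fermi_tangent \<kappa> (fst p0) e (fst z)) (fst (\<eta> (\<Gamma> z))) + snd (\<eta> (\<Gamma> z)) * (\<sigma> * w12 z))
      + ((csk \<kappa> (snd z))\<^sup>2 + (w1 z)\<^sup>2) * (form \<kappa> (- \<kappa> *\<^sub>R fermi \<kappa> (fst p0) e f z) (fst (\<eta> (\<Gamma> z))) + snd (\<eta> (\<Gamma> z)) * (\<sigma> * w22 z))"
      using mean unfolding Iv Bv fermi_derivatives[OF \<kappa>] snd\<Gamma>[OF z] .
    show s: "\<sigma> * snd (\<eta> (\<Gamma> z)) = 1 / graph_W \<kappa> w1 w2 z" unfolding WW by (rule eq(1)[OF m'])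
    have "mean_curvature \<kappa> S \<eta> (\<Gamma> z) = \<H> (1 / W)"
    proof -
      have "mean_curvature \<kappa> S \<eta> (\<Gamma> z) = \<H> (snd (\<eta> (\<Gamma> z)))"
        using mc[OF pS[OF z]] by (simp add: angle_function_def metric_form_def e3_def form_simps)
      moreover have "1 / W \<in> {-1..1}"
        using graph_W_ge_1[of \<kappa> w1 w2 z] unfolding WW by (simp add: field_simps)
      moreover have "snd (\<eta> (\<Gamma> z)) = 1 / W \<or> snd (\<eta> (\<Gamma> z)) = - (1 / W)"
        using s \<sigma> unfolding WW by (auto simp: minus_equation_iff)
      ultimately show ?thesis using even[of "1 / W"] by metis
    qed
    then show "((csk \<kappa> (snd z))\<^sup>2 + (w1 z)\<^sup>2) * w22 z - 2 * w1 z * w2 z * (w12 z + \<kappa> * w1 z * snk \<kappa> (snd z) / csk \<kappa> (snd z))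
      + (1 + (w2 z)\<^sup>2) * (w11 z - \<kappa> * w2 z * csk \<kappa> (snd z) * snk \<kappa> (snd z))
      = 2 * (csk \<kappa> (snd z))\<^sup>2 * graph_W \<kappa> w1 w2 z ^ 3 * \<H> (1 / graph_W \<kappa> w1 w2 z)"
      unfolding WW using eq(2)[OF m'] by simp
  qed
  note hess = C2_on_has_hessian[OF C2w D(1)]
  have c0: "isCont (\<lambda>z. D2 w z a b) 0" for a b
    using hess(2) D(1,2) by (simp add: continuous_on_eq_continuous_at)
  have "H_graph \<kappa> \<H> R w w1 w2 w11 w12 w22"
    unfolding H_graph_def
    using R hess(1) c0 main(2) unfolding w1_def[abs_def] w2_def[abs_def] w11_def[abs_def] w12_def[abs_def] w22_def[abs_def] D_def
    by blast
  moreover have "\<exists>p\<in>S. w z = \<sigma> * snd p \<and> \<sigma> * snd (\<eta> p) = 1 / graph_W \<kappa> w1 w2 z" if "z \<in> ball 0 R" for z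
    using main(1)[of z] that GS[OF AV[of z]] by (intro bexI[of _ "\<Gamma> z"]) (auto simp: w_def D_def \<Gamma>_def)
  moreover have "w 0 = \<sigma> * snd p0" by (simp add: w_def \<Gamma>0)
  moreover have "\<sigma> * snd (\<eta> p0) = 1 / graph_W \<kappa> w1 w2 0" using main(1)[OF D(2)] \<Gamma>0 by simp
  ultimately show ?thesis using that main(3)[OF D(2)] by blast
qed

text \<open>The vertical segment is an admissible curve.  An infimum is a lower bound only for sets that
  are bounded below, so the lengths have to be shown nonnegative; this holds since velocities are
  tangent to the product space, where the metric is positive.\<close>

lemma dist_to_horizontal_plane_le:
  assumes \<kappa>: "\<kappa> \<in> {-1, 1}" and p: "p \<in> prod_space \<kappa>"
  shows "dist_to_set \<kappa> p (horizontal_plane \<kappa> t) \<le> \<bar>snd p - t\<bar>"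
proof -
  define A where "A = {curve_length \<kappa> \<gamma> |\<gamma>. \<gamma> C1_differentiable_on {0..1} \<and> path_image \<gamma> \<subseteq> prod_space \<kappa> \<and>
     pathstart \<gamma> = p \<and> pathfinish \<gamma> \<in> horizontal_plane \<kappa> t}"
  have nonneg: "curve_length \<kappa> \<gamma> \<ge> 0" if g: "\<gamma> C1_differentiable_on {0..1}" "path_image \<gamma> \<subseteq> prod_space \<kappa>" for \<gamma>
  proof -
    have "metric_form \<kappa> (vector_derivative \<gamma> (at s)) (vector_derivative \<gamma> (at s)) \<ge> 0" if s: "s \<in> {0..1}" for s
    proof -
      interpret F: bounded_bilinear "form \<kappa>" by (rule bounded_bilinear_form)
      define v where "v = vector_derivative \<gamma> (at s)"
      have "(\<gamma> has_vector_derivative v) (at s)"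
        using g(1) s unfolding v_def C1_differentiable_on_eq vector_derivative_works by blast
      then have "(\<gamma> has_vector_derivative v) (at s within {0..1})" by (rule has_vector_derivative_at_within)
      then have d: "((\<lambda>s. fst (\<gamma> s)) has_vector_derivative fst v) (at s within {0..1})"
        unfolding has_vector_derivative_def by (auto dest!: has_derivative_fst)
      have on: "form \<kappa> (fst (\<gamma> s)) (fst (\<gamma> s)) = \<kappa>" if "s \<in> {0..1}" for s
      proof -
        have "\<gamma> s \<in> prod_space \<kappa>" using g(2) that by (auto simp: path_image_def)
        then show ?thesis by (cases "\<gamma> s") (auto simp: prod_space_def space_form_def)
      qed
      have d1: "((\<lambda>s. form \<kappa> (fst (\<gamma> s)) (fst (\<gamma> s))) has_vector_derivative
          form \<kappa> (fst (\<gamma> s)) (fst v) + form \<kappa> (fst v) (fst (\<gamma> s))) (at s within {0..1})"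
        by (rule F.has_vector_derivative[OF d d])
      have d2: "((\<lambda>s. form \<kappa> (fst (\<gamma> s)) (fst (\<gamma> s))) has_vector_derivative 0) (at s within {0..1})"
        by (rule has_vector_derivative_transform[OF s on has_vector_derivative_const])
      have "form \<kappa> (fst (\<gamma> s)) (fst v) + form \<kappa> (fst v) (fst (\<gamma> s)) = 0"
        by (rule vector_derivative_unique_within_closed_interval[where a = 0 and b = 1 and x = s,
              unfolded box_real, OF zero_less_one s d1 d2])
      then have "form \<kappa> (fst (\<gamma> s)) (fst v) = 0" by (simp add: form_commute)
      from tangent_form_nonneg[OF \<kappa> on[OF s] this]
      show ?thesis by (simp add: v_def[symmetric] metric_form_def)
    qed
    then show ?thesis unfolding curve_length_def
      by (cases "(\<lambda>t. sqrt (metric_form \<kappa> (vector_derivative \<gamma> (at t)) (vector_derivative \<gamma> (at t)))) integrable_on {0..1}")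
        (auto intro!: integral_nonneg simp: not_integrable_integral)
  qed
  then have "bdd_below A" unfolding A_def by (intro bdd_belowI[of _ 0]) blast
  moreover have "\<bar>snd p - t\<bar> \<in> A"
  proof -
    define \<gamma> :: "real \<Rightarrow> ambient" where "\<gamma> s = (fst p, snd p + s * (t - snd p))" for s
    have d: "(\<gamma> has_vector_derivative (0, t - snd p)) (at s)" for s
      unfolding \<gamma>_def by (auto intro!: derivative_eq_intros)
    have "curve_length \<kappa> \<gamma> = \<bar>snd p - t\<bar>"
      unfolding curve_length_def vector_derivative_at[OF d]
      by (simp add: metric_form_def form_simps real_sqrt_mult_self abs_minus_commute)
    moreover have "\<gamma> C1_differentiable_on {0..1}"
      unfolding C1_differentiable_on_def using d by (intro exI[of _ "\<lambda>_. (0, t - snd p)"]) auto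
    moreover have "path_image \<gamma> \<subseteq> prod_space \<kappa>" "pathstart \<gamma> = p" "pathfinish \<gamma> \<in> horizontal_plane \<kappa> t"
      using p by (auto simp: \<gamma>_def path_image_def pathstart_def pathfinish_def prod_space_def horizontal_plane_def)
    ultimately show ?thesis unfolding A_def by (metis (mono_tags, lifting) mem_Collect_eq)
  qed
  ultimately show ?thesis unfolding dist_to_set_def A_def[symmetric] by (intro cInf_lower)
qed

lemma vertical_height_estimate:
  assumes \<kappa>: "\<kappa> \<in> {-1, 1}" and \<sigma>: "\<sigma> \<in> {-1, 1}" and even: "\<And>y. y \<in> {-1..1} \<Longrightarrow> \<H> y = \<H> (- y)"
    and H: "\<And>y. y \<in> {-1..1} \<Longrightarrow> (\<H> has_real_derivative \<H>' y) (at y within {-1..1})" "continuous_on {-1..1} \<H>'"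
    and \<delta>: "\<delta> > 0" "\<delta> < \<H> 1"
    "\<And>k. k \<ge> 1 \<Longrightarrow> touching_defect \<kappa> (\<H> (1 / k\<^sup>2)) (\<H>' (1 / k\<^sup>2)) \<delta> k > 0"
    and S: "compact S" "H_surface \<kappa> \<H> S \<eta>" and pos: "\<And>p. p \<in> S \<Longrightarrow> \<sigma> * snd (\<eta> p) > 0"
    and bd: "surface_boundary S \<subseteq> horizontal_plane \<kappa> t" and p: "p \<in> S"
  shows "\<bar>snd p - t\<bar> \<le> 2 / \<delta>"
proof -
  have un: "unit_normal \<kappa> S \<eta>" and SP: "S \<subseteq> prod_space \<kappa>" using S(2) unfolding H_surface_def surface_def by auto
  have c\<eta>: "continuous_on S \<eta>" using un by (simp add: unit_normal_def)
  have bdt: "snd q = t" if "q \<in> surface_boundary S" for q using bd that by (auto simp: horizontal_plane_def)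
  have upper: "\<sigma> * snd p \<le> \<sigma> * t"
  proof -
    have "continuous_on S (\<lambda>p. \<sigma> * snd p)" by (intro continuous_intros)
    then obtain p0 where p0: "p0 \<in> S" "\<And>q. q \<in> S \<Longrightarrow> \<sigma> * snd q \<le> \<sigma> * snd p0"
      using continuous_attains_sup[OF S(1)] p by (metis empty_iff)
    have "p0 \<in> surface_boundary S"
    proof (rule ccontr)
      assume nb: "p0 \<notin> surface_boundary S"
      obtain R w w1 w2 w11 w12 w22 where W: "H_graph \<kappa> \<H> R w w1 w2 w11 w12 w22"
        "w 0 = \<sigma> * snd p0"
        "\<And>z. z \<in> ball 0 R \<Longrightarrow> \<exists>p\<in>S. w z = \<sigma> * snd p \<and> \<sigma> * snd (\<eta> p) = 1 / graph_W \<kappa> w1 w2 z"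
        using interior_point_H_graph[OF \<kappa> \<sigma> even S(2) pos p0(1) nb] by metis
      show False
        by (rule H_graph_no_interior_max[OF W(1)]) (use \<delta> W(2,3) p0(2) in \<open>force+\<close>)
    qed
    then show ?thesis using p0(2)[OF p] bdt by simp
  qed
  have lower: "\<sigma> * t - 2 / \<delta> \<le> \<sigma> * snd p"
  proof -
    define \<phi> where "\<phi> q = \<sigma> * snd q + 2 / \<delta> * sqrt (\<sigma> * snd (\<eta> q))" for q
    have "continuous_on S \<phi>" unfolding \<phi>_def by (intro continuous_intros c\<eta>)
    then obtain p0 where p0: "p0 \<in> S" "\<And>q. q \<in> S \<Longrightarrow> \<phi> p0 \<le> \<phi> q"
      using continuous_attains_inf[OF S(1)] p by (metis empty_iff)
    have "p0 \<in> surface_boundary S"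
    proof (rule ccontr)
      assume nb: "p0 \<notin> surface_boundary S"
      obtain R w w1 w2 w11 w12 w22 where W: "H_graph \<kappa> \<H> R w w1 w2 w11 w12 w22" "w2 0 = 0"
        "w 0 = \<sigma> * snd p0" "\<sigma> * snd (\<eta> p0) = 1 / graph_W \<kappa> w1 w2 0"
        "\<And>z. z \<in> ball 0 R \<Longrightarrow> \<exists>p\<in>S. w z = \<sigma> * snd p \<and> \<sigma> * snd (\<eta> p) = 1 / graph_W \<kappa> w1 w2 z"
        using interior_point_H_graph[OF \<kappa> \<sigma> even S(2) pos p0(1) nb] by metis
      have min: "w 0 + 2 / \<delta> * sqrt (1 / graph_W \<kappa> w1 w2 0) \<le> w z + 2 / \<delta> * sqrt (1 / graph_W \<kappa> w1 w2 z)"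
        if zR: "z \<in> ball 0 R" for z
      proof -
        obtain q where q: "q \<in> S" "w z = \<sigma> * snd q" "\<sigma> * snd (\<eta> q) = 1 / graph_W \<kappa> w1 w2 z" using W(5)[OF zR] by blast
        show ?thesis using p0(2)[OF q(1)] unfolding \<phi>_def q(2,3) W(3,4) .
      qed
      have "\<H> 1 \<le> \<delta> \<or> (\<exists>k\<ge>1. touching_defect \<kappa> (\<H> (1 / k\<^sup>2)) (\<H>' (1 / k\<^sup>2)) \<delta> k \<le> 0)"
        by (rule H_graph_touching_inequality[OF \<kappa> W(1,2) H \<delta>(1) min])
      then show False using \<delta>(2,3) by force
    qed
    then have "\<sigma> * t \<le> \<phi> p0" using bdt[of p0] pos[OF p0(1)] \<delta>(1) by (simp add: \<phi>_def less_imp_le)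
    also have "\<dots> \<le> \<phi> p" by (rule p0(2)[OF p])
    also have "\<phi> p \<le> \<sigma> * snd p + 2 / \<delta> * 1"
    proof -
      have px: "form \<kappa> (fst p) (fst p) = \<kappa>" using p SP by (cases p) (auto simp: prod_space_def space_form_def)
      have \<eta>p: "form \<kappa> (fst p) (fst (\<eta> p)) = 0" "form \<kappa> (fst (\<eta> p)) (fst (\<eta> p)) + (snd (\<eta> p))\<^sup>2 = 1"
        using un p unfolding unit_normal_def by (auto simp: prod_tangent_def metric_form_def power2_eq_square)
      have "(snd (\<eta> p))\<^sup>2 \<le> 1" using tangent_form_nonneg[OF \<kappa> px \<eta>p(1)] \<eta>p(2) by linarith
      then have "\<bar>snd (\<eta> p)\<bar> \<le> 1" by (simp add: abs_square_le_1)
      then have "\<sigma> * snd (\<eta> p) \<le> 1" using \<sigma> by auto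
      then have "sqrt (\<sigma> * snd (\<eta> p)) \<le> 1" by simp
      then show ?thesis unfolding \<phi>_def using \<delta>(1) by (intro add_left_mono mult_left_mono) auto
    qed
    finally show ?thesis by simp
  qed
  show ?thesis using upper lower \<sigma> by auto
qed

theorem theorem3p5:
  fixes \<kappa> :: real and \<H> :: "real \<Rightarrow> real"
  assumes "\<kappa> \<in> {-1, 1}"
    and "C1_on_interval (-1) 1 \<H>"
    and "\<forall>y\<in>{-1..1}. \<H> y = \<H> (-y)"
    and "\<forall>y\<in>{-1..1}. 4 * \<H> y > (1 - \<kappa>) * sqrt (1 - y\<^sup>2)"
  shows "\<forall>v\<in>{e3, -e3}. \<exists>C>0. \<forall>S \<eta> t.
    compact S \<and> vertical_graph \<kappa> S \<and> H_surface \<kappa> \<H> S \<eta> \<and>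
    (\<forall>p\<in>S. metric_form \<kappa> (\<eta> p) v > 0) \<and>
    surface_boundary S \<subseteq> horizontal_plane \<kappa> t \<longrightarrow>
    (\<forall>p\<in>S. dist_to_set \<kappa> p (horizontal_plane \<kappa> t) \<le> C)"
proof -
  obtain \<H>' where H: "\<And>y. y \<in> {-1..1} \<Longrightarrow> (\<H> has_real_derivative \<H>' y) (at y within {-1..1})"
    "continuous_on {-1..1} \<H>'"
    using assms(2) unfolding C1_on_interval_def by blast
  have cH: "continuous_on {-1..1} \<H>" by (rule DERIV_continuous_on[OF H(1)])
  have "(\<H> has_real_derivative \<H>' 0) (at 0)"
    using H(1)[of 0] at_within_interior[of 0 "{-1..1::real}"] by simp
  then have H0: "\<H>' 0 = 0"
  proof (rule even_derivative_0)
    fix y :: real assume "\<bar>y\<bar> \<le> 1"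
    then have "y \<in> {-1..1}" by auto
    then show "\<H> y = \<H> (- y)" using assms(3) by blast
  qed
  obtain \<delta> where \<delta>: "\<delta> > 0" "\<delta> < \<H> 1"
    "\<And>k. k \<ge> 1 \<Longrightarrow> touching_defect \<kappa> (\<H> (1 / k\<^sup>2)) (\<H>' (1 / k\<^sup>2)) \<delta> k > 0"
    using exists_slope_parameter[OF assms(1) cH H(2) H0] assms(4) by blast
  show ?thesis
  proof
    fix v assume "v \<in> {e3, -e3}"
    then obtain \<sigma> :: real where \<sigma>: "\<sigma> \<in> {-1, 1}" and v: "v = (0, \<sigma>)" by (auto simp: e3_def)
    show "\<exists>C>0. \<forall>S \<eta> t. compact S \<and> vertical_graph \<kappa> S \<and> H_surface \<kappa> \<H> S \<eta> \<and>
      (\<forall>p\<in>S. metric_form \<kappa> (\<eta> p) v > 0) \<and> surface_boundary S \<subseteq> horizontal_plane \<kappa> t \<longrightarrow>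
      (\<forall>p\<in>S. dist_to_set \<kappa> p (horizontal_plane \<kappa> t) \<le> C)"
    proof (intro exI[of _ "2 / \<delta>"] conjI allI impI ballI)
      fix S \<eta> t p
      assume A: "compact S \<and> vertical_graph \<kappa> S \<and> H_surface \<kappa> \<H> S \<eta> \<and>
        (\<forall>p\<in>S. metric_form \<kappa> (\<eta> p) v > 0) \<and> surface_boundary S \<subseteq> horizontal_plane \<kappa> t" and p: "p \<in> S"
      have "\<bar>snd p - t\<bar> \<le> 2 / \<delta>"
      proof (rule vertical_height_estimate[OF assms(1) \<sigma> _ H \<delta>])
        show "\<sigma> * snd (\<eta> p) > 0" if "p \<in> S" for p
          using A that by (auto simp: v metric_form_def form_simps mult.commute)
        show "\<H> y = \<H> (- y)" if "y \<in> {-1..1}" for y using assms(3) that by blast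
      qed (use A p in auto)
      moreover have "p \<in> prod_space \<kappa>" using A p by (auto simp: H_surface_def surface_def)
      ultimately show "dist_to_set \<kappa> p (horizontal_plane \<kappa> t) \<le> 2 / \<delta>"
        using dist_to_horizontal_plane_le[OF assms(1)] order_trans by blast
    qed (use \<delta> in simp)
  qed
qed

end
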